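(* Let $(\mathcal S,\mathcal D,E,B)$ satisfy assumptions (i)–(iv) of the context, let $\Lambda=E(\mathcal S)$, and let $\mathrm W_\Lambda$ be the geodesic restriction of $\mathrm W$ to $\Lambda$. There exists a constant $C\in(0,\infty)$ such that for any $\theta\in\mathcal S$ and $\eta_1,\eta_2\in\mathcal D_\theta$, with $\gamma_i:[0,1]\ni t\mapsto\exp_\theta(t\eta_i)$ for $i=1,2$, one has $$\Big|\mathrm W_\Lambda(\lambda_{\gamma_1(t)},\lambda_{\gamma_2(t)})-t\,\|B_\theta(\eta_1-\eta_2)\|_{L^2(\lambda_\theta)}\Big|\le t^2\,C\,(\|\eta_1\|_\theta+\|\eta_2\|_\theta)^2$$ for all $t\in\big[0,\min\{1,\tfrac1{C\|\eta_1\|_\theta},\tfrac1{C\|\eta_2\|_\theta}\}\big)$. Moreover, $$\frac{d}{dt}\mathrm W_\Lambda(\lambda_{\gamma_1(t)},\lambda_{\gamma_2(t)})\Big|_{t=0}=\|B_\theta(\eta_1-\eta_2)\|_{L^2(\lambda_\theta)}.$$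
   Context: $\Omega\subset\mathbb R^d$ is compact and convex, $\mathcal P(\Omega)$ is the set of probability measures on $\Omega$, $\mathrm W$ is the Wasserstein-2 distance, $\mathrm W(\mu,\nu)^2=\inf_{\pi}\int|x-y|^2\,d\pi$ over couplings $\pi$ of $\mu,\nu$. $L^2(\mu)$ means $L^2(\mu;\mathbb R^d)$. $\|\cdot\|_{C^1(\mathbb R^d)}$ is the supremum norm of the function and its first derivatives. $\#$ denotes push-forward. Convention: $1/0=+\infty$; the derivative at $t=0$ is the right derivative. Assumptions. (i) $\mathcal S$ is a compact, connected, finite-dimensional smooth Riemannian manifold with tangent norms $\|\eta\|_\theta$ ($\eta\in T_\theta\mathcal S$) and induced distance $d_{\mathcal S}$. $\mathcal D\subset T\mathcal S$ is a subset on which the Riemannian exponential map is well defined, such that $(\theta,\eta)\in\mathcal D$ implies $(\theta,t\eta)\in\mathcal D$ for $t\in[0,1]$; for every $(\theta,\eta)\in\mathcal D$ the curve $\gamma(t)=\exp_\theta(t\eta)$, $t\in[0,1]$, is a constant speed geodesic from $\theta$ to $\exp_\theta(\eta)$ with $\|\dot\gamma(t)\|_{\gamma(t)}=\|\eta\|_\theta=d_{\mathcal S}(\theta,\exp_\theta(\eta))$ for $t\in[0,1]$; and, with $\mathcal D_\theta=\{\eta:(\theta,\eta)\in\mathcal D\}$, for any $\theta_0,\theta_1\in\mathcal S$ there is $\eta\in\mathcal D_{\theta_0}$ with $\theta_1=\exp_{\theta_0}(\eta)$. ($\mathcal S$ may have a boundary as long as it is a geodesically convex subset of a larger, not necessarily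 compact, such manifold and the construction of geodesics via $\mathcal D$ remains valid.) (ii) $E:\mathcal S\to\mathcal P(\Omega)$ is a bi-Lipschitz bijection from $(\mathcal S,d_{\mathcal S})$ onto $\Lambda:=E(\mathcal S)$ with metric $\mathrm W$; write $\lambda_\theta=E(\theta)$. All $\lambda\in\Lambda$ are absolutely continuous with respect to Lebesgue measure. (iii) For each $\theta\in\mathcal S$, $B_\theta:T_\theta\mathcal S\to C^1(\mathbb R^d;\mathbb R^d)$ is linear with values in gradient vector fields, and there is $C_0\in(0,\infty)$ such that for all $(\theta,\eta)\in\mathcal D$, $x\in\mathbb R^d$, $t\in[0,1]$, with $\gamma(t)=\exp_\theta(t\eta)$: $C_0^{-1}\|\eta\|_\theta\le\|B_\theta\eta\|_{L^2(\lambda_\theta)}\le C_0\|\eta\|_\theta$; $\|B_\theta\eta\|_{C^1(\mathbb R^d)}\le C_0\|\eta\|_\theta$; $|\partial_t[B_{\gamma(t)}\dot\gamma(t)](x)|\le C_0\|\eta\|_\theta^2$. (iv) For every Lipschitz curve $\gamma:[0,1]\to\mathcal S$, let $v(t,\cdot)=B_{\gamma(t)}\dot\gamma(t)$ (defined for a.e. $t$) and let $\varphi:[0,1]\times\Omega\to\mathbb R^d$ be the solution of $\varphi(0,\cdot)=\mathrm{id}$, $\partial_t\varphi(t,\cdot)=v(t,\varphi(t,\cdot))$ for a.e. $t$; then $\lambda_{\gamma(t)}=\varphi(t,\cdot)_\#\lambda_{\gamma(0)}$ for all $t\in[0,1]$. Energy and geodesic restriction. For a Lipschitz curve $\rho:[0,1]\to(\mathcal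 P(\Omega),\mathrm W)$, $\mathrm{CE}(\rho)$ is the set of measurable $v$ with $v(t)\in L^2(\rho(t))$ such that for all $\phi\in C^1([0,1]\times\Omega)$: $\int_0^1\int_\Omega\partial_t\phi(t,\cdot)\,d\rho(t)\,dt+\int_0^1\int_\Omega\langle\nabla\phi(t,\cdot),v(t)\rangle\,d\rho(t)\,dt=\int_\Omega\phi(1,\cdot)\,d\rho(1)-\int_\Omega\phi(0,\cdot)\,d\rho(0)$. Set $\mathrm{energy}(\rho)=\inf\{\int_0^1\|v(t)\|_{L^2(\rho(t))}^2dt: v\in\mathrm{CE}(\rho)\}$. For $\mu,\nu\in\Lambda$, $\mathrm W_\Lambda(\mu,\nu)=\inf\{\mathrm{energy}(\rho)^{1/2}:\rho\in\mathrm{Lip}([0,1];(\Lambda,\mathrm W)),\rho(0)=\mu,\rho(1)=\nu\}$. *)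

theory Defs
  imports "HOL-Analysis.Analysis"
begin

section \<open>Smooth maps between Euclidean spaces\<close>

text \<open>Meant for open \<open>U\<close>. In finite dimensions, continuity of the directional derivatives of
  order \<open>k\<close> is continuity of the \<open>k\<close>-th Frechet derivative.\<close>

primrec Ck_on :: "nat \<Rightarrow> ('a::euclidean_space \<Rightarrow> 'b::real_normed_vector) \<Rightarrow> 'a set \<Rightarrow> bool" where
  "Ck_on 0 f U \<longleftrightarrow> continuous_on U f"
| "Ck_on (Suc k) f U \<longleftrightarrow>
     (\<forall>x\<in>U. f differentiable (at x)) \<and> (\<forall>v. Ck_on k (\<lambda>x. frechet_derivative f (at x) v) U)"

definition smooth_on :: "('a::euclidean_space \<Rightarrow> 'b::real_normed_vector) \<Rightarrow> 'a set \<Rightarrow> bool" where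
  "smooth_on f U \<longleftrightarrow> (\<forall>k. Ck_on k f U)"


section \<open>Riemannian manifolds\<close>

text \<open>The points of the manifold are the elements of a type \<open>'m\<close> and the atlas is a family indexed
  by a type \<open>'i\<close>. A tangent vector at \<open>p\<close> is the family of its coordinate vectors, one for each
  chart around \<open>p\<close>, related by the derivatives of the transition maps; by convention it is \<open>0\<close>
  at the charts that do not contain \<open>p\<close>. Linear operations are pointwise.\<close>

type_synonym ('i, 'e) tangent = "'i \<Rightarrow> 'e"

record ('i, 'm, 'e) riem_data =
  chart_dom :: "'i \<Rightarrow> 'm set"
  chart_map :: "'i \<Rightarrow> 'm \<Rightarrow> 'e"
  metric :: "'m \<Rightarrow> ('i, 'e) tangent \<Rightarrow> ('i, 'e) tangent \<Rightarrow> real"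

definition chart_image :: "('i, 'm, 'e) riem_data \<Rightarrow> 'i \<Rightarrow> 'e set" where
  "chart_image M i = chart_map M i ` chart_dom M i"

definition chart_inv :: "('i, 'm, 'e) riem_data \<Rightarrow> 'i \<Rightarrow> 'e \<Rightarrow> 'm" where
  "chart_inv M i = inv_into (chart_dom M i) (chart_map M i)"

definition smooth_atlas ::
  "('i, 'm::topological_space, 'e::euclidean_space) riem_data \<Rightarrow> bool" where
  "smooth_atlas M \<longleftrightarrow>
     (\<Union>i. chart_dom M i) = UNIV \<and>
     (\<forall>i. open (chart_dom M i) \<and> open (chart_image M i) \<and>
          homeomorphism (chart_dom M i) (chart_image M i) (chart_map M i) (chart_inv M i)) \<and>
     (\<forall>i j. smooth_on (chart_map M j \<circ> chart_inv M i)
                      (chart_map M i ` (chart_dom M i \<inter> chart_dom M j)))"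

definition transition_deriv ::
  "('i, 'm, 'e::euclidean_space) riem_data \<Rightarrow> 'i \<Rightarrow> 'i \<Rightarrow> 'm \<Rightarrow> 'e \<Rightarrow> 'e" where
  "transition_deriv M i j p =
     frechet_derivative (chart_map M j \<circ> chart_inv M i) (at (chart_map M i p))"

definition tangent_space ::
  "('i, 'm, 'e::euclidean_space) riem_data \<Rightarrow> 'm \<Rightarrow> ('i, 'e) tangent set" where
  "tangent_space M p =
     {\<eta>. (\<forall>i. p \<notin> chart_dom M i \<longrightarrow> \<eta> i = 0) \<and>
         (\<forall>i j. p \<in> chart_dom M i \<inter> chart_dom M j \<longrightarrow> \<eta> j = transition_deriv M i j p (\<eta> i))}"

text \<open>The tangent vector at \<open>p\<close> with coordinate vector \<open>u\<close> in chart \<open>i\<close>.\<close>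

definition tangent_of ::
  "('i, 'm, 'e::euclidean_space) riem_data \<Rightarrow> 'i \<Rightarrow> 'm \<Rightarrow> 'e \<Rightarrow> ('i, 'e) tangent" where
  "tangent_of M i p u = (\<lambda>j. if p \<in> chart_dom M j then transition_deriv M i j p u else 0)"

definition metric_coord ::
  "('i, 'm, 'e::euclidean_space) riem_data \<Rightarrow> 'i \<Rightarrow> 'e \<Rightarrow> 'e \<Rightarrow> 'e \<Rightarrow> real" where
  "metric_coord M i x u v =
     (let p = chart_inv M i x in metric M p (tangent_of M i p u) (tangent_of M i p v))"

definition riemannian_metric :: "('i, 'm, 'e::euclidean_space) riem_data \<Rightarrow> bool" where
  "riemannian_metric M \<longleftrightarrow>
     (\<forall>p. \<forall>\<eta>\<in>tangent_space M p. \<forall>\<zeta>\<in>tangent_space M p. \<forall>\<xi>\<in>tangent_space M p. \<forall>a b.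
        metric M p (\<lambda>i. a *\<^sub>R \<eta> i + b *\<^sub>R \<zeta> i) \<xi> = a * metric M p \<eta> \<xi> + b * metric M p \<zeta> \<xi>) \<and>
     (\<forall>p. \<forall>\<eta>\<in>tangent_space M p. \<forall>\<zeta>\<in>tangent_space M p. metric M p \<eta> \<zeta> = metric M p \<zeta> \<eta>) \<and>
     (\<forall>p. \<forall>\<eta>\<in>tangent_space M p. \<eta> \<noteq> (\<lambda>i. 0) \<longrightarrow> 0 < metric M p \<eta> \<eta>) \<and>
     (\<forall>i u v. smooth_on (\<lambda>x. metric_coord M i x u v) (chart_image M i))"

definition riemannian_manifold ::
  "('i, 'm::{t2_space, second_countable_topology}, 'e::euclidean_space) riem_data \<Rightarrow> bool" where
  "riemannian_manifold M \<longleftrightarrow>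
     connected (UNIV :: 'm set) \<and> smooth_atlas M \<and> riemannian_metric M"

definition tnorm :: "('i, 'm, 'e) riem_data \<Rightarrow> 'm \<Rightarrow> ('i, 'e) tangent \<Rightarrow> real" where
  "tnorm M p \<eta> = sqrt (metric M p \<eta> \<eta>)"

text \<open>Velocity of a curve with parameter interval \<open>[0,1]\<close>; one-sided at the end points.\<close>

definition velocity ::
  "('i, 'm, 'e::euclidean_space) riem_data \<Rightarrow> (real \<Rightarrow> 'm) \<Rightarrow> real \<Rightarrow> ('i, 'e) tangent" where
  "velocity M \<gamma> t =
     (\<lambda>i. if \<gamma> t \<in> chart_dom M i
          then vector_derivative (chart_map M i \<circ> \<gamma>) (at t within {0..1}) else 0)"

definition piecewise_C1_curve ::
  "('i, 'm::topological_space, 'e::euclidean_space) riem_data \<Rightarrow> (real \<Rightarrow> 'm) \<Rightarrow> bool" where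
  "piecewise_C1_curve M \<gamma> \<longleftrightarrow> continuous_on {0..1} \<gamma> \<and>
     (\<exists>F. finite F \<and>
        (\<forall>i. (\<forall>t\<in>{t\<in>{0..1} - F. \<gamma> t \<in> chart_dom M i}.
                (chart_map M i \<circ> \<gamma>) differentiable (at t within {0..1})) \<and>
             continuous_on {t\<in>{0..1} - F. \<gamma> t \<in> chart_dom M i} (\<lambda>t. velocity M \<gamma> t i)))"

definition curve_length ::
  "('i, 'm, 'e::euclidean_space) riem_data \<Rightarrow> (real \<Rightarrow> 'm) \<Rightarrow> ennreal" where
  "curve_length M \<gamma> = (\<integral>\<^sup>+t\<in>{0..1}. ennreal (tnorm M (\<gamma> t) (velocity M \<gamma> t)) \<partial>lborel)"

text \<open>Distance induced on \<open>S\<close> by the Riemannian metric. The infimum is finite when \<open>S\<close> is the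
  whole connected manifold or a geodesically convex subset.\<close>

definition riem_dist ::
  "('i, 'm::topological_space, 'e::euclidean_space) riem_data \<Rightarrow> 'm set \<Rightarrow> 'm \<Rightarrow> 'm \<Rightarrow> real" where
  "riem_dist M S p q =
     enn2real (INF \<gamma>\<in>{\<gamma>. piecewise_C1_curve M \<gamma> \<and> \<gamma> ` {0..1} \<subseteq> S \<and> \<gamma> 0 = p \<and> \<gamma> 1 = q}.
       curve_length M \<gamma>)"

text \<open>Christoffel symbols of the first kind,
  \<open>\<Gamma>(u,v;w) = (D\<^sub>u g(v,w) + D\<^sub>v g(u,w) - D\<^sub>w g(u,v)) / 2\<close>.\<close>

definition christoffel ::
  "('i, 'm, 'e::euclidean_space) riem_data \<Rightarrow> 'i \<Rightarrow> 'e \<Rightarrow> 'e \<Rightarrow> 'e \<Rightarrow> 'e \<Rightarrow> real" where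
  "christoffel M i x u v w =
     (frechet_derivative (\<lambda>y. metric_coord M i y v w) (at x) u
      + frechet_derivative (\<lambda>y. metric_coord M i y u w) (at x) v
      - frechet_derivative (\<lambda>y. metric_coord M i y u v) (at x) w) / 2"

text \<open>Geodesic equation in charts, with lowered index: \<open>g(x'', w) + \<Gamma>(x', x'; w) = 0\<close> for all
  \<open>w\<close>.\<close>

definition geodesic ::
  "('i, 'm::topological_space, 'e::euclidean_space) riem_data \<Rightarrow> (real \<Rightarrow> 'm) \<Rightarrow> bool" where
  "geodesic M \<gamma> \<longleftrightarrow> continuous_on {0..1} \<gamma> \<and>
     (\<forall>i. \<forall>t\<in>{0..1}. \<gamma> t \<in> chart_dom M i \<longrightarrow>
        (chart_map M i \<circ> \<gamma>) differentiable (at t within {0..1}) \<and>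
        (\<exists>a. ((\<lambda>s. velocity M \<gamma> s i) has_vector_derivative a) (at t within {0..1}) \<and>
             (\<forall>w. metric_coord M i (chart_map M i (\<gamma> t)) a w
                  + christoffel M i (chart_map M i (\<gamma> t))
                      (velocity M \<gamma> t i) (velocity M \<gamma> t i) w = 0)))"

definition geodesic_from ::
  "('i, 'm::topological_space, 'e::euclidean_space) riem_data
   \<Rightarrow> 'm \<Rightarrow> ('i, 'e) tangent \<Rightarrow> (real \<Rightarrow> 'm) \<Rightarrow> bool" where
  "geodesic_from M p \<eta> \<gamma> \<longleftrightarrow> geodesic M \<gamma> \<and> \<gamma> 0 = p \<and> velocity M \<gamma> 0 = \<eta>"

definition exp_domain ::
  "('i, 'm::topological_space, 'e::euclidean_space) riem_data \<Rightarrow> ('m \<times> ('i, 'e) tangent) set" where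
  "exp_domain M = {(p, \<eta>). \<eta> \<in> tangent_space M p \<and> (\<exists>\<gamma>. geodesic_from M p \<eta> \<gamma>)}"

definition riem_exp ::
  "('i, 'm::topological_space, 'e::euclidean_space) riem_data \<Rightarrow> 'm \<Rightarrow> ('i, 'e) tangent \<Rightarrow> 'm" where
  "riem_exp M p \<eta> = (THE q. \<exists>\<gamma>. geodesic_from M p \<eta> \<gamma> \<and> \<gamma> 1 = q)"

definition exp_curve ::
  "('i, 'm::topological_space, 'e::euclidean_space) riem_data
   \<Rightarrow> 'm \<Rightarrow> ('i, 'e) tangent \<Rightarrow> real \<Rightarrow> 'm" where
  "exp_curve M p \<eta> = (\<lambda>t. riem_exp M p (\<lambda>i. t *\<^sub>R \<eta> i))"

definition geodesically_convex ::
  "('i, 'm::topological_space, 'e::euclidean_space) riem_data \<Rightarrow> 'm set \<Rightarrow> bool" where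
  "geodesically_convex M S \<longleftrightarrow>
     (\<forall>p\<in>S. \<forall>q\<in>S. \<exists>\<gamma>. geodesic M \<gamma> \<and> \<gamma> ` {0..1} \<subseteq> S \<and> \<gamma> 0 = p \<and> \<gamma> 1 = q \<and>
        curve_length M \<gamma> = ennreal (riem_dist M UNIV p q))"

definition lipschitz_curve :: "('a \<Rightarrow> 'a \<Rightarrow> real) \<Rightarrow> 'a set \<Rightarrow> (real \<Rightarrow> 'a) \<Rightarrow> bool" where
  "lipschitz_curve d X \<gamma> \<longleftrightarrow> \<gamma> ` {0..1} \<subseteq> X \<and>
     (\<exists>L. \<forall>s\<in>{0..1}. \<forall>t\<in>{0..1}. d (\<gamma> s) (\<gamma> t) \<le> L * \<bar>s - t\<bar>)"


section \<open>Wasserstein distance and geodesic restriction\<close>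

definition prob_measures_on :: "'x::euclidean_space set \<Rightarrow> 'x measure set" where
  "prob_measures_on \<Omega> = {\<mu>. sets \<mu> = sets borel \<and> emeasure \<mu> UNIV = 1 \<and> emeasure \<mu> \<Omega> = 1}"

definition couplings ::
  "'x::euclidean_space measure \<Rightarrow> 'x measure \<Rightarrow> ('x \<times> 'x) measure set" where
  "couplings \<mu> \<nu> = {\<pi>. sets \<pi> = sets borel \<and> distr \<pi> borel fst = \<mu> \<and> distr \<pi> borel snd = \<nu>}"

definition W2 :: "'x::euclidean_space measure \<Rightarrow> 'x measure \<Rightarrow> real" where
  "W2 \<mu> \<nu> =
     sqrt (enn2real (INF \<pi>\<in>couplings \<mu> \<nu>. \<integral>\<^sup>+z. ennreal ((norm (fst z - snd z))\<^sup>2) \<partial>\<pi>))"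

definition L2_norm_of :: "'x measure \<Rightarrow> ('x \<Rightarrow> 'y::real_normed_vector) \<Rightarrow> real" where
  "L2_norm_of \<mu> f = sqrt (\<integral>x. (norm (f x))\<^sup>2 \<partial>\<mu>)"

text \<open>Test functions: \<open>\<phi>\<close> is continuously differentiable on \<open>[0,1] \<times> \<Omega>\<close> with time derivative
  \<open>\<phi>t\<close> and spatial gradient \<open>\<phi>x\<close>.\<close>

definition C1_test_function ::
  "'x::euclidean_space set \<Rightarrow> (real \<times> 'x \<Rightarrow> real) \<Rightarrow> (real \<times> 'x \<Rightarrow> real) \<Rightarrow> (real \<times> 'x \<Rightarrow> 'x)
   \<Rightarrow> bool" where
  "C1_test_function \<Omega> \<phi> \<phi>t \<phi>x \<longleftrightarrow>
     continuous_on ({0..1} \<times> \<Omega>) \<phi>t \<and> continuous_on ({0..1} \<times> \<Omega>) \<phi>x \<and>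
     (\<forall>z\<in>{0..1} \<times> \<Omega>.
        (\<phi> has_derivative (\<lambda>(s, h). \<phi>t z * s + \<phi>x z \<bullet> h)) (at z within {0..1} \<times> \<Omega>))"

text \<open>Velocity fields are Borel on the whole of \<open>\<real> \<times> \<real>\<^sup>d\<close>; a Borel field on \<open>[0,1] \<times> \<Omega>\<close> is
  identified with its extension by zero.\<close>

definition CE ::
  "'x::euclidean_space set \<Rightarrow> (real \<Rightarrow> 'x measure) \<Rightarrow> (real \<Rightarrow> 'x \<Rightarrow> 'x) set" where
  "CE \<Omega> \<rho> = {v.
     (\<lambda>(t, x). v t x) \<in> borel_measurable borel \<and>
     (\<forall>t\<in>{0..1}. integrable (\<rho> t) (\<lambda>x. (norm (v t x))\<^sup>2)) \<and>
     (\<forall>\<phi> \<phi>t \<phi>x. C1_test_function \<Omega> \<phi> \<phi>t \<phi>x \<longrightarrow>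
        (LINT t:{0..1}|lborel. (LINT x:\<Omega>|\<rho> t. \<phi>t (t, x)))
        + (LINT t:{0..1}|lborel. (LINT x:\<Omega>|\<rho> t. \<phi>x (t, x) \<bullet> v t x))
        = (LINT x:\<Omega>|\<rho> 1. \<phi> (1, x)) - (LINT x:\<Omega>|\<rho> 0. \<phi> (0, x)))}"

definition energy :: "'x::euclidean_space set \<Rightarrow> (real \<Rightarrow> 'x measure) \<Rightarrow> ennreal" where
  "energy \<Omega> \<rho> =
     (INF v\<in>CE \<Omega> \<rho>. \<integral>\<^sup>+t\<in>{0..1}. ennreal ((L2_norm_of (\<rho> t) (v t))\<^sup>2) \<partial>lborel)"

definition ennsqrt :: "ennreal \<Rightarrow> ennreal" where
  "ennsqrt a = (if a = \<infinity> then \<infinity> else ennreal (sqrt (enn2real a)))"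

definition W_restricted ::
  "'x::euclidean_space set \<Rightarrow> 'x measure set \<Rightarrow> 'x measure \<Rightarrow> 'x measure \<Rightarrow> ennreal" where
  "W_restricted \<Omega> \<Lambda> \<mu> \<nu> =
     (INF \<rho>\<in>{\<rho>. lipschitz_curve W2 \<Lambda> \<rho> \<and> \<rho> 0 = \<mu> \<and> \<rho> 1 = \<nu>}. ennsqrt (energy \<Omega> \<rho>))"


section \<open>The standing assumptions\<close>

text \<open>Parameter manifold and geodesics. \<open>S\<close> is either the whole manifold or a geodesically convex
  subset of it; \<open>D\<close> is the given set of tangent vectors.\<close>

definition parameter_manifold ::
  "('i, 'm::{t2_space, second_countable_topology}, 'e::euclidean_space) riem_data
   \<Rightarrow> 'm set \<Rightarrow> ('m \<times> ('i, 'e) tangent) set \<Rightarrow> bool" where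
  "parameter_manifold M S D \<longleftrightarrow>
     riemannian_manifold M \<and> compact S \<and> connected S \<and>
     (S = UNIV \<or> geodesically_convex M S) \<and>
     D \<subseteq> {(\<theta>, \<eta>). \<theta> \<in> S \<and> \<eta> \<in> tangent_space M \<theta>} \<and>
     D \<subseteq> exp_domain M \<and>
     (\<forall>(\<theta>, \<eta>)\<in>D. \<forall>t\<in>{0..1}. (\<theta>, \<lambda>i. t *\<^sub>R \<eta> i) \<in> D) \<and>
     (\<forall>(\<theta>, \<eta>)\<in>D. let \<gamma> = exp_curve M \<theta> \<eta> in
        geodesic_from M \<theta> \<eta> \<gamma> \<and> \<gamma> ` {0..1} \<subseteq> S \<and>
        (\<forall>t\<in>{0..1}. tnorm M (\<gamma> t) (velocity M \<gamma> t) = tnorm M \<theta> \<eta>) \<and>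
        tnorm M \<theta> \<eta> = riem_dist M S \<theta> (riem_exp M \<theta> \<eta>)) \<and>
     (\<forall>\<theta>0\<in>S. \<forall>\<theta>1\<in>S. \<exists>\<eta>. (\<theta>0, \<eta>) \<in> D \<and> \<theta>1 = riem_exp M \<theta>0 \<eta>)"

definition measure_parametrization ::
  "('i, 'm::topological_space, 'e::euclidean_space) riem_data \<Rightarrow> 'm set
   \<Rightarrow> 'x::euclidean_space set \<Rightarrow> ('m \<Rightarrow> 'x measure) \<Rightarrow> bool" where
  "measure_parametrization M S \<Omega> E \<longleftrightarrow>
     E ` S \<subseteq> prob_measures_on \<Omega> \<and> inj_on E S \<and>
     (\<exists>c C. 0 < c \<and> 0 < C \<and>
        (\<forall>\<theta>\<in>S. \<forall>\<theta>'\<in>S. c * riem_dist M S \<theta> \<theta>' \<le> W2 (E \<theta>) (E \<theta>') \<and>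
                          W2 (E \<theta>) (E \<theta>') \<le> C * riem_dist M S \<theta> \<theta>')) \<and>
     (\<forall>\<theta>\<in>S. absolutely_continuous lborel (E \<theta>))"

definition gradient_field :: "('x::euclidean_space \<Rightarrow> 'x) \<Rightarrow> bool" where
  "gradient_field f \<longleftrightarrow> (\<exists>\<psi>. \<forall>x. GDERIV \<psi> x :> f x)"

text \<open>Supremum norm of \<open>f\<close> and its first derivative; \<open>\<infinity>\<close> if one of them is unbounded.\<close>

definition C1_norm :: "('x::euclidean_space \<Rightarrow> 'x) \<Rightarrow> ennreal" where
  "C1_norm f = (SUP x. ennreal (max (norm (f x)) (onorm (frechet_derivative f (at x)))))"

definition tangent_model ::
  "('i, 'm::topological_space, 'e::euclidean_space) riem_data \<Rightarrow> 'm set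
   \<Rightarrow> ('m \<times> ('i, 'e) tangent) set \<Rightarrow> ('m \<Rightarrow> 'x::euclidean_space measure)
   \<Rightarrow> ('m \<Rightarrow> ('i, 'e) tangent \<Rightarrow> 'x \<Rightarrow> 'x) \<Rightarrow> bool" where
  "tangent_model M S D E B \<longleftrightarrow>
     (\<forall>\<theta>\<in>S. \<forall>\<eta>\<in>tangent_space M \<theta>. Ck_on 1 (B \<theta> \<eta>) UNIV \<and> gradient_field (B \<theta> \<eta>)) \<and>
     (\<forall>\<theta>\<in>S. \<forall>\<eta>\<in>tangent_space M \<theta>. \<forall>\<zeta>\<in>tangent_space M \<theta>. \<forall>a b x.
        B \<theta> (\<lambda>i. a *\<^sub>R \<eta> i + b *\<^sub>R \<zeta> i) x = a *\<^sub>R B \<theta> \<eta> x + b *\<^sub>R B \<theta> \<zeta> x) \<and>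
     (\<exists>C0>0. \<forall>(\<theta>, \<eta>)\<in>D.
        inverse C0 * tnorm M \<theta> \<eta> \<le> L2_norm_of (E \<theta>) (B \<theta> \<eta>) \<and>
        L2_norm_of (E \<theta>) (B \<theta> \<eta>) \<le> C0 * tnorm M \<theta> \<eta> \<and>
        C1_norm (B \<theta> \<eta>) \<le> ennreal (C0 * tnorm M \<theta> \<eta>) \<and>
        (let \<gamma> = exp_curve M \<theta> \<eta> in
           \<forall>x. \<forall>t\<in>{0..1}. \<exists>u.
             ((\<lambda>s. B (\<gamma> s) (velocity M \<gamma> s) x) has_vector_derivative u) (at t within {0..1}) \<and>
             norm u \<le> C0 * (tnorm M \<theta> \<eta>)\<^sup>2))"

definition absolutely_continuous_curve :: "(real \<Rightarrow> 'x::real_normed_vector) \<Rightarrow> bool" where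
  "absolutely_continuous_curve f \<longleftrightarrow>
     (\<forall>\<epsilon>>0. \<exists>\<delta>>0. \<forall>(n::nat) a b.
        (\<forall>k<n. 0 \<le> a k \<and> a k \<le> b k \<and> b k \<le> 1) \<and> (\<forall>k l. k < l \<and> l < n \<longrightarrow> b k \<le> a l) \<and>
        (\<Sum>k<n. b k - a k) < \<delta> \<longrightarrow> (\<Sum>k<n. norm (f (b k) - f (a k))) < \<epsilon>)"

text \<open>Caratheodory solutions: absolute continuity in time is part of the notion of a solution of an
  ODE that only holds for almost every \<open>t\<close>.\<close>

definition flow_solution ::
  "'x::euclidean_space set \<Rightarrow> (real \<Rightarrow> 'x \<Rightarrow> 'x) \<Rightarrow> (real \<Rightarrow> 'x \<Rightarrow> 'x) \<Rightarrow> bool" where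
  "flow_solution \<Omega> v \<phi> \<longleftrightarrow>
     (\<forall>x\<in>\<Omega>. \<phi> 0 x = x \<and> absolutely_continuous_curve (\<lambda>t. \<phi> t x)) \<and>
     (AE t in lborel. t \<in> {0..1} \<longrightarrow>
        (\<forall>x\<in>\<Omega>. ((\<lambda>s. \<phi> s x) has_vector_derivative v t (\<phi> t x)) (at t within {0..1})))"

text \<open>The definite article in ``the solution'' is read as existence together with a statement about
  every solution. The flow is only specified on \<open>\<Omega>\<close>, so the measure is restricted to \<open>\<Omega>\<close> before
  being pushed forward.\<close>

definition flow_compatible ::
  "('i, 'm::topological_space, 'e::euclidean_space) riem_data \<Rightarrow> 'm set
   \<Rightarrow> 'x::euclidean_space set \<Rightarrow> ('m \<Rightarrow> 'x measure)
   \<Rightarrow> ('m \<Rightarrow> ('i, 'e) tangent \<Rightarrow> 'x \<Rightarrow> 'x) \<Rightarrow> bool" where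
  "flow_compatible M S \<Omega> E B \<longleftrightarrow>
     (\<forall>\<gamma>. lipschitz_curve (riem_dist M S) S \<gamma> \<longrightarrow>
        (let v = (\<lambda>t. B (\<gamma> t) (velocity M \<gamma> t)) in
           (\<exists>\<phi>. flow_solution \<Omega> v \<phi>) \<and>
           (\<forall>\<phi>. flow_solution \<Omega> v \<phi> \<longrightarrow>
              (\<forall>t\<in>{0..1}. E (\<gamma> t) = distr (restrict_space (E (\<gamma> 0)) \<Omega>) borel (\<phi> t)))))"

end

theory Submission
  imports Defs
begin

text \<open>Let \<open>X\<close> and \<open>Y\<close> be the flow maps along \<open>\<gamma>\<^sub>1\<close> and \<open>\<gamma>\<^sub>2\<close> at time \<open>t\<close> and put
  \<open>w = B \<theta> (\<eta>2 - \<eta>1)\<close>. The bounds on \<open>B\<close> give \<open>Y - X = t w + O(t\<^sup>2)\<close>, and \<open>w = \<nabla>\<psi>\<close> is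
  Lipschitz, so the coupling of the two image measures by \<open>(X, Y)\<close> is nearly optimal.

  Lower bound: in the continuity equation of any curve joining the two measures we test with an explicit
  smooth subsolution of the Hamilton-Jacobi equation started at \<open>t \<psi>\<close>. This bounds the energy below
  by \<open>(1 - O(t)) \<parallel>Y - X\<parallel>\<^sup>2 - O(t\<^sup>4)\<close>.

  Upper bound: a geodesic of \<open>S\<close> joins the two parameters. By the bi-Lipschitz property its length is
  \<open>O(W\<^sub>2) = O(t)\<close>. Its flow solves the continuity equation, and its energy is controlled by the norm of
  its initial velocity, a gradient, which exceeds \<open>\<parallel>Y - X\<parallel>\<close> by at most \<open>O(t\<^sup>2)\<close>.\<close>

section \<open>Geodesics and the induced distance\<close>

text \<open>The final square root is the obstacle: an absolute error of order t^3 in a squared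
  distance could cost t^(3/2) when \<open>w\<close> is nearly zero. Every third-order error is
  therefore kept as a multiple of a squared distance; the remaining ones are of order t^4 or higher,
  or carry t^2 times a distance. This dictates the test function. An exact Hamilton-Jacobi solution
  would require inverting the characteristics; the subsolution used instead is explicit, involves
  only first derivatives of \<open>w\<close>, and loses only a multiple of |w|^2. In the upper bound
  the initial velocity of the connecting geodesic belongs to \<theta>', while \<open>w\<close>
  belongs to \<theta>. The two are never compared as vector fields. Only the two end measures link
  them, through the potential of that initial velocity, so the variation of \<open>B\<close> with
  the base point enters solely along geodesics of \<open>D\<close>.\<close>

lemma transition_differentiable:
  assumes "smooth_atlas M" "p \<in> chart_dom M i" "p \<in> chart_dom M j"
  shows "(chart_map M j \<circ> chart_inv M i) differentiable (at (chart_map M i p))"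
proof -
  have "smooth_on (chart_map M j \<circ> chart_inv M i) (chart_map M i ` (chart_dom M i \<inter> chart_dom M j))"
    using assms(1) by (simp add: smooth_atlas_def)
  then have "Ck_on (Suc 0) (chart_map M j \<circ> chart_inv M i) (chart_map M i ` (chart_dom M i \<inter> chart_dom M j))"
    unfolding smooth_on_def by blast
  then show ?thesis using assms(2,3) by simp
qed

lemma linear_transition_deriv:
  assumes "smooth_atlas M" "p \<in> chart_dom M i" "p \<in> chart_dom M j"
  shows "linear (transition_deriv M i j p)"
  unfolding transition_deriv_def
  by (rule linear_frechet_derivative[OF transition_differentiable[OF assms]])

lemma tangent_space_lincomb:
  assumes M: "smooth_atlas M" and "\<eta> \<in> tangent_space M p" "\<zeta> \<in> tangent_space M p"
  shows "(\<lambda>i. a *\<^sub>R \<eta> i + b *\<^sub>R \<zeta> i) \<in> tangent_space M p"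
proof -
  have "a *\<^sub>R \<eta> j + b *\<^sub>R \<zeta> j = transition_deriv M i j p (a *\<^sub>R \<eta> i + b *\<^sub>R \<zeta> i)"
    if "p \<in> chart_dom M i" "p \<in> chart_dom M j" for i j
  proof -
    interpret linear "transition_deriv M i j p" by (rule linear_transition_deriv[OF M that])
    have "\<eta> j = transition_deriv M i j p (\<eta> i)" "\<zeta> j = transition_deriv M i j p (\<zeta> i)"
      using assms(2,3) that unfolding tangent_space_def by blast+
    then show ?thesis by (simp only: add scale)
  qed
  moreover have "\<eta> i = 0" "\<zeta> i = 0" if "p \<notin> chart_dom M i" for i
    using assms(2,3) that unfolding tangent_space_def by blast+
  ultimately show ?thesis unfolding tangent_space_def by simp
qed

lemma tangent_space_scale:
  assumes "smooth_atlas M" "\<eta> \<in> tangent_space M p"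
  shows "(\<lambda>i. a *\<^sub>R \<eta> i) \<in> tangent_space M p"
  using tangent_space_lincomb[OF assms assms(2), of a 0] by simp

lemma tangent_space_diff:
  assumes "smooth_atlas M" "\<eta> \<in> tangent_space M p" "\<zeta> \<in> tangent_space M p"
  shows "(\<lambda>i. \<eta> i - \<zeta> i) \<in> tangent_space M p"
  using tangent_space_lincomb[OF assms, of 1 "-1"] by simp

lemma tnorm_scale:
  assumes A: "smooth_atlas M" and R: "riemannian_metric M" and e: "\<eta> \<in> tangent_space M p"
  shows "tnorm M p (\<lambda>i. a *\<^sub>R \<eta> i) = \<bar>a\<bar> * tnorm M p \<eta>"
proof -
  have lin: "metric M p (\<lambda>i. a *\<^sub>R \<zeta> i) \<xi> = a * metric M p \<zeta> \<xi>"
    if "\<zeta> \<in> tangent_space M p" "\<xi> \<in> tangent_space M p" for \<zeta> \<xi>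
  proof -
    have "metric M p (\<lambda>i. a *\<^sub>R \<zeta> i + 0 *\<^sub>R \<zeta> i) \<xi> = a * metric M p \<zeta> \<xi> + 0 * metric M p \<zeta> \<xi>"
      using R that unfolding riemannian_metric_def by blast
    then show ?thesis by simp
  qed
  have sym: "metric M p \<zeta> \<xi> = metric M p \<xi> \<zeta>"
    if "\<zeta> \<in> tangent_space M p" "\<xi> \<in> tangent_space M p" for \<zeta> \<xi>
    using R that unfolding riemannian_metric_def by blast
  note ae = tangent_space_scale[OF A e, of a]
  have "metric M p (\<lambda>i. a *\<^sub>R \<eta> i) (\<lambda>i. a *\<^sub>R \<eta> i) = a * (a * metric M p \<eta> \<eta>)"
    using lin[OF e ae] lin[OF e e] sym[OF ae e] by (simp add: lin[OF e ae])
  then show ?thesis by (simp add: tnorm_def real_sqrt_mult flip: mult.assoc)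
qed

lemma tnorm_nonneg:
  assumes A: "smooth_atlas M" and R: "riemannian_metric M" and e: "\<eta> \<in> tangent_space M p"
  shows "0 \<le> tnorm M p \<eta>"
proof (cases "\<eta> = (\<lambda>i. 0)")
  case True
  have "tnorm M p (\<lambda>i. 0 *\<^sub>R \<eta> i) = 0" using tnorm_scale[OF A R e, of 0] by simp
  then show ?thesis using True by simp
next
  case False
  then show ?thesis using R e unfolding riemannian_metric_def tnorm_def
    by (simp add: order_less_imp_le)
qed

text \<open>Compatibility between two charts is the chain rule for the transition map. By continuity
  the curve stays in chart \<open>i\<close> near \<open>t\<close>, and there the transition map
  composed with the first coordinate representation is the second one.\<close>

lemma velocity_tangent:
  assumes A: "smooth_atlas M" and c: "continuous_on {0..1} \<gamma>" and t: "t \<in> {0..1}"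
    and d: "\<And>i. \<gamma> t \<in> chart_dom M i \<Longrightarrow> (chart_map M i \<circ> \<gamma>) differentiable (at t within {0..1})"
  shows "velocity M \<gamma> t \<in> tangent_space M (\<gamma> t)"
proof -
  have "velocity M \<gamma> t j = transition_deriv M i j (\<gamma> t) (velocity M \<gamma> t i)"
    if i: "\<gamma> t \<in> chart_dom M i" and j: "\<gamma> t \<in> chart_dom M j" for i j
  proof -
    let ?T = "chart_map M j \<circ> chart_inv M i"
    have hom: "homeomorphism (chart_dom M i) (chart_image M i) (chart_map M i) (chart_inv M i)"
      and op: "open (chart_dom M i)" using A by (auto simp: smooth_atlas_def)
    have "((chart_map M i \<circ> \<gamma>) has_vector_derivative velocity M \<gamma> t i) (at t within {0..1})"
      using d[OF i] i by (simp add: velocity_def vector_derivative_works)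
    moreover have "(?T has_derivative transition_deriv M i j (\<gamma> t)) (at (chart_map M i (\<gamma> t)))"
      unfolding transition_deriv_def
      using transition_differentiable[OF A i j] frechet_derivative_works by blast
    ultimately have "((?T \<circ> (chart_map M i \<circ> \<gamma>)) has_derivative
        (transition_deriv M i j (\<gamma> t) \<circ> (\<lambda>h. h *\<^sub>R velocity M \<gamma> t i))) (at t within {0..1})"
      unfolding has_vector_derivative_def
      by (intro diff_chain_within) (auto intro: has_derivative_at_withinI)
    moreover have "transition_deriv M i j (\<gamma> t) \<circ> (\<lambda>h. h *\<^sub>R velocity M \<gamma> t i)
        = (\<lambda>h. h *\<^sub>R transition_deriv M i j (\<gamma> t) (velocity M \<gamma> t i))"
      using linear_scale[OF linear_transition_deriv[OF A i j]] by auto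
    ultimately have "((?T \<circ> (chart_map M i \<circ> \<gamma>)) has_vector_derivative
        transition_deriv M i j (\<gamma> t) (velocity M \<gamma> t i)) (at t within {0..1})"
      by (simp add: has_vector_derivative_def)
    moreover have "\<forall>\<^sub>F s in at t within {0..1}. \<gamma> s \<in> chart_dom M i"
    proof -
      have "(\<gamma> \<longlongrightarrow> \<gamma> t) (at t within {0..1})" using c t by (simp add: continuous_on_def)
      then show ?thesis using op i topological_tendstoD by blast
    qed
    then have "\<forall>\<^sub>F s in at t within {0..1}. (?T \<circ> (chart_map M i \<circ> \<gamma>)) s = (chart_map M j \<circ> \<gamma>) s"
      by eventually_elim (use hom in \<open>auto simp: homeomorphism_def\<close>)
    moreover have "(?T \<circ> (chart_map M i \<circ> \<gamma>)) t = (chart_map M j \<circ> \<gamma>) t"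
      using hom i by (auto simp: homeomorphism_def)
    ultimately have "((chart_map M j \<circ> \<gamma>) has_vector_derivative
        transition_deriv M i j (\<gamma> t) (velocity M \<gamma> t i)) (at t within {0..1})"
      unfolding has_vector_derivative_def
      using t by (blast intro: has_derivative_transform_eventually)
    then have "vector_derivative (chart_map M j \<circ> \<gamma>) (at t within {0..1})
        = transition_deriv M i j (\<gamma> t) (velocity M \<gamma> t i)"
      using t by (intro vector_derivative_within_cbox[of 0 1, simplified]) auto
    then show ?thesis using j by (simp add: velocity_def[of M \<gamma> t])
  qed
  then show ?thesis by (auto simp: tangent_space_def velocity_def)
qed

lemma geodesic_velocity_tangent:
  assumes "smooth_atlas M" "geodesic M \<gamma>" "t \<in> {0..1}"
  shows "velocity M \<gamma> t \<in> tangent_space M (\<gamma> t)"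
  using assms by (intro velocity_tangent) (auto simp: geodesic_def)

text \<open>The piece of \<gamma> between the two times, affinely reparametrized over
  \<open>{0..1}\<close>, is a competitor in the infimum. For t < s it runs backwards, and
  homogeneity of the norm produces the absolute value.\<close>

lemma riem_dist_geodesic_le:
  assumes A: "smooth_atlas M" and R: "riemannian_metric M" and g: "geodesic M \<gamma>"
    and S: "\<gamma> ` {0..1} \<subseteq> S" and k: "\<And>r. r \<in> {0..1} \<Longrightarrow> tnorm M (\<gamma> r) (velocity M \<gamma> r) = k"
    and s: "s \<in> {0..1}" and t: "t \<in> {0..1}"
  shows "riem_dist M S (\<gamma> s) (\<gamma> t) \<le> k * \<bar>s - t\<bar>"
proof -
  define f where "f r = s + r * (t - s)" for r
  define \<sigma> where "\<sigma> = \<gamma> \<circ> f"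
  have f01: "f r \<in> {0..1}" if "r \<in> {0..1}" for r
  proof -
    have "f r = (1 - r) * s + r * t" by (simp add: f_def algebra_simps)
    moreover have "(1 - r) * s + r * t \<le> (1 - r) * 1 + r * 1"
      using that s t by (intro add_mono mult_left_mono) auto
    ultimately show ?thesis using that s t by auto
  qed
  have k0: "0 \<le> k"
    using tnorm_nonneg[OF A R geodesic_velocity_tangent[OF A g s]] k[OF s] by simp
  have fc: "continuous_on X f" for X unfolding f_def by (intro continuous_intros)
  have cg: "continuous_on {0..1} \<gamma>" using g by (simp add: geodesic_def)
  have c\<sigma>: "continuous_on {0..1} \<sigma>"
    unfolding \<sigma>_def using f01 by (intro continuous_on_compose fc continuous_on_subset[OF cg]) auto
  have vd: "((chart_map M i \<circ> \<sigma>) has_vector_derivative (t - s) *\<^sub>R velocity M \<gamma> (f r) i) (at r within {0..1})"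
    if r: "r \<in> {0..1}" and i: "\<sigma> r \<in> chart_dom M i" for r i
  proof -
    have "(chart_map M i \<circ> \<gamma>) differentiable (at (f r) within {0..1})"
      using g i f01[OF r] by (simp add: geodesic_def \<sigma>_def)
    then have "((chart_map M i \<circ> \<gamma>) has_vector_derivative velocity M \<gamma> (f r) i) (at (f r) within {0..1})"
      using i by (simp add: velocity_def vector_derivative_works \<sigma>_def)
    then have *: "((chart_map M i \<circ> \<gamma>) has_vector_derivative velocity M \<gamma> (f r) i) (at (f r) within f ` {0..1})"
      using f01 by (blast intro: has_vector_derivative_within_subset)
    have "(f has_vector_derivative (t - s)) (at r within {0..1})"
      unfolding f_def by (auto intro!: derivative_eq_intros)
    from vector_diff_chain_within[OF this *] show ?thesis by (simp only: \<sigma>_def comp_assoc)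
  qed
  have vel: "velocity M \<sigma> r = (\<lambda>i. (t - s) *\<^sub>R velocity M \<gamma> (f r) i)" if r: "r \<in> {0..1}" for r
  proof
    fix i
    show "velocity M \<sigma> r i = (t - s) *\<^sub>R velocity M \<gamma> (f r) i"
    proof (cases "\<sigma> r \<in> chart_dom M i")
      case True
      then show ?thesis
        using vector_derivative_within_cbox[of 0 1, simplified, OF _ vd[OF r True]] r
        by (simp add: velocity_def[of M \<sigma>])
    next
      case False
      then show ?thesis by (simp add: velocity_def \<sigma>_def)
    qed
  qed
  have cv: "continuous_on {r\<in>{0..1}. \<sigma> r \<in> chart_dom M i} (\<lambda>r. velocity M \<sigma> r i)" for i
  proof -
    \<comment> \<open>The geodesic equation contains an acceleration, so in each chart the velocity
      is differentiable and hence continuous.\<close>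
    have "continuous_on {u\<in>{0..1}. \<gamma> u \<in> chart_dom M i} (\<lambda>u. velocity M \<gamma> u i)"
    proof (rule continuous_on_eq_continuous_within[THEN iffD2, rule_format])
      fix u assume "u \<in> {u\<in>{0..1}. \<gamma> u \<in> chart_dom M i}"
      then obtain a where "((\<lambda>s. velocity M \<gamma> s i) has_vector_derivative a) (at u within {0..1})"
        using g unfolding geodesic_def by blast
      then have "continuous (at u within {0..1}) (\<lambda>s. velocity M \<gamma> s i)"
        by (rule has_vector_derivative_continuous)
      then show "continuous (at u within {u\<in>{0..1}. \<gamma> u \<in> chart_dom M i}) (\<lambda>s. velocity M \<gamma> s i)"
        by (rule continuous_within_subset) auto
    qed
    then have "continuous_on {r\<in>{0..1}. \<sigma> r \<in> chart_dom M i} ((\<lambda>u. velocity M \<gamma> u i) \<circ> f)"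
      using f01 by (intro continuous_on_compose fc) (auto elim!: continuous_on_subset simp: \<sigma>_def)
    then have "continuous_on {r\<in>{0..1}. \<sigma> r \<in> chart_dom M i} (\<lambda>r. (t - s) *\<^sub>R velocity M \<gamma> (f r) i)"
      by (intro continuous_intros) (simp add: o_def)
    then show ?thesis by (rule continuous_on_eq) (simp add: vel)
  qed
  have pw: "piecewise_C1_curve M \<sigma>"
    unfolding piecewise_C1_curve_def
  proof (intro conjI c\<sigma> exI[of _ "{}"] allI ballI)
    show "(chart_map M i \<circ> \<sigma>) differentiable (at r within {0..1})"
      if "r \<in> {r \<in> {0..1} - {}. \<sigma> r \<in> chart_dom M i}" for r i
      using that by (intro differentiableI_vector[OF vd]) auto
    show "continuous_on {r \<in> {0..1} - {}. \<sigma> r \<in> chart_dom M i} (\<lambda>r. velocity M \<sigma> r i)" for i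
      using cv by simp
  qed simp
  have "tnorm M (\<sigma> r) (velocity M \<sigma> r) = k * \<bar>s - t\<bar>" if r: "r \<in> {0..1}" for r
    using tnorm_scale[OF A R geodesic_velocity_tangent[OF A g f01[OF r]], of "t - s"] k[OF f01[OF r]]
    unfolding vel[OF r] by (simp add: \<sigma>_def abs_minus_commute)
  then have "curve_length M \<sigma> = (\<integral>\<^sup>+r\<in>{0..1::real}. ennreal (k * \<bar>s - t\<bar>) \<partial>lborel)"
    unfolding curve_length_def by (auto intro!: nn_integral_cong split: split_indicator)
  also have "\<dots> = ennreal (k * \<bar>s - t\<bar>)"
    by (subst nn_integral_cmult_indicator) auto
  finally have len: "curve_length M \<sigma> = ennreal (k * \<bar>s - t\<bar>)" .
  have "(INF \<gamma>'\<in>{\<gamma>'. piecewise_C1_curve M \<gamma>' \<and> \<gamma>' ` {0..1} \<subseteq> S \<and> \<gamma>' 0 = \<gamma> s \<and> \<gamma>' 1 = \<gamma> t}.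
       curve_length M \<gamma>') \<le> curve_length M \<sigma>"
  proof (rule INF_lower, safe)
    show "piecewise_C1_curve M \<sigma>" by (rule pw)
    show "\<sigma> 0 = \<gamma> s" "\<sigma> 1 = \<gamma> t" by (simp_all add: \<sigma>_def f_def)
    fix r :: real assume "r \<in> {0..1}"
    then show "\<sigma> r \<in> S" using S f01 by (force simp: \<sigma>_def)
  qed
  \<comment> \<open>\<open>enn2real\<close> sends infinity to 0 and is monotone only below a finite
    bound; here the length of \<sigma> is that bound.\<close>
  then have "riem_dist M S (\<gamma> s) (\<gamma> t) \<le> enn2real (ennreal (k * \<bar>s - t\<bar>))"
    unfolding riem_dist_def len by (rule enn2real_mono) simp
  then show ?thesis using k0 by simp
qed


section \<open>Absolutely continuous curves\<close>

text \<open>Lists replace indexed families because the bisection argument below joins families of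
  intervals, and appending avoids a shift of indices.\<close>

lemma absolutely_continuous_curve_list:
  assumes ac: "absolutely_continuous_curve f" and "0 < \<epsilon>"
  shows "\<exists>\<delta>>0. \<forall>xs::(real \<times> real) list. (\<forall>p\<in>set xs. 0 \<le> fst p \<and> fst p \<le> snd p \<and> snd p \<le> 1) \<and>
    sorted_wrt (\<lambda>p q. snd p \<le> fst q) xs \<and> (\<Sum>p\<leftarrow>xs. snd p - fst p) < \<delta>
    \<longrightarrow> (\<Sum>p\<leftarrow>xs. norm (f (snd p) - f (fst p))) < \<epsilon>"
proof -
  obtain \<delta> where "\<delta> > 0" and d: "\<forall>(n::nat) a b. (\<forall>k<n. 0 \<le> a k \<and> a k \<le> b k \<and> b k \<le> 1) \<and>
      (\<forall>k l. k < l \<and> l < n \<longrightarrow> b k \<le> a l) \<and> (\<Sum>k<n. b k - a k) < \<delta> \<longrightarrow>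
      (\<Sum>k<n. norm (f (b k) - f (a k))) < \<epsilon>"
    using ac[unfolded absolutely_continuous_curve_def, THEN spec, THEN mp, OF \<open>0 < \<epsilon>\<close>] by (elim exE conjE)
  have "(\<Sum>p\<leftarrow>xs. norm (f (snd p) - f (fst p))) < \<epsilon>"
    if 1: "\<forall>p\<in>set xs. 0 \<le> fst p \<and> fst p \<le> snd p \<and> snd p \<le> 1"
      and 2: "sorted_wrt (\<lambda>p q. snd p \<le> fst q) xs" and 3: "(\<Sum>p\<leftarrow>xs. snd p - fst p) < \<delta>"
    for xs :: "(real \<times> real) list"
    using d[THEN spec, THEN spec, THEN spec, of "length xs" "\<lambda>k. fst (xs ! k)" "\<lambda>k. snd (xs ! k)"] 1 2 3
    by (simp add: sum_list_sum_nth atLeast0LessThan sorted_wrt_iff_nth_less)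
  with \<open>\<delta> > 0\<close> show ?thesis by blast
qed

text \<open>A null set of exceptional times is covered by an open set of small measure. The bisection
  principle then splits the interval into pieces on which the derivative bound applies and pieces
  inside the open set, whose total variation is small by absolute continuity.\<close>

lemma absolutely_continuous_curve_bound:
  fixes f :: "real \<Rightarrow> 'a::real_normed_vector"
  assumes ac: "absolutely_continuous_curve f" and ab: "0 \<le> a" "a \<le> b" "b \<le> 1" and K: "0 \<le> K"
    and ae: "AE t in lborel. t \<in> {a..b} \<longrightarrow>
      (\<exists>f'. (f has_vector_derivative f') (at t within {0..1}) \<and> norm (f' - c) \<le> K)"
  shows "norm (f b - f a - (b - a) *\<^sub>R c) \<le> K * (b - a)"
proof (rule field_le_epsilon)
  fix e :: real assume "0 < e"
  \<comment> \<open>The final estimate collects three terms of size \<open>e1\<close>: the slack in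
    the derivative bound, the variation over the bad intervals, and their length times
    \<open>norm c\<close>.\<close>
  define e1 where "e1 = e / 4"
  have "0 < e1" using \<open>0 < e\<close> by (simp add: e1_def)
  \<comment> \<open>\<open>R\<close> is the defect of the affine approximation with slope
    \<open>c\<close>. It is subadditive under concatenation of intervals, which is what bisection
    needs.\<close>
  define R where "R p = norm (f (snd p) - f (fst p) - (snd p - fst p) *\<^sub>R c)" for p :: "real \<times> real"
  obtain \<delta>0 where \<delta>0: "\<delta>0 > 0" "\<And>xs::(real \<times> real) list. (\<forall>p\<in>set xs. 0 \<le> fst p \<and> fst p \<le> snd p \<and> snd p \<le> 1) \<Longrightarrow>
    sorted_wrt (\<lambda>p q. snd p \<le> fst q) xs \<Longrightarrow> (\<Sum>p\<leftarrow>xs. snd p - fst p) < \<delta>0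
    \<Longrightarrow> (\<Sum>p\<leftarrow>xs. norm (f (snd p) - f (fst p))) < e1"
    using absolutely_continuous_curve_list[OF ac \<open>0 < e1\<close>] by blast
  \<comment> \<open>The first bound makes the variation over the bad intervals small, the second one
    their total length times \<open>norm c\<close>. Adding 1 avoids a division by zero.\<close>
  define \<delta> where "\<delta> = min \<delta>0 (e1 / (norm c + 1))"
  have "norm c + 1 > 0" by (simp add: add_nonneg_pos)
  then have "\<delta> > 0" using \<delta>0(1) \<open>0 < e1\<close> by (simp add: \<delta>_def)
  obtain N where N: "N \<in> null_sets lborel"
    and der: "\<And>t. t \<in> {a..b} - N \<Longrightarrow>
      \<exists>f'. (f has_vector_derivative f') (at t within {0..1}) \<and> norm (f' - c) \<le> K"
    by (rule AE_E3[OF ae]) auto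
  have NL: "N \<in> sets lebesgue" "emeasure lebesgue N = 0"
    using N by (auto simp: null_sets_def)
  obtain U where U: "open U" "N \<subseteq> U" "U - N \<in> lmeasurable" "emeasure lebesgue (U - N) < ennreal \<delta>"
    using sets_lebesgue_outer_open[OF NL(1) \<open>\<delta> > 0\<close>] .
  have Ul: "U \<in> sets borel" using U(1) by simp
  have "emeasure lebesgue U \<le> emeasure lebesgue (U - N) + emeasure lebesgue N"
  proof -
    have "emeasure lebesgue ((U - N) \<union> N) \<le> emeasure lebesgue (U - N) + emeasure lebesgue N"
      using U(3) NL(1) by (intro emeasure_subadditive) auto
    moreover have "(U - N) \<union> N = U" using U(2) by auto
    ultimately show ?thesis by simp
  qed
  then have Um: "emeasure lborel U < ennreal \<delta>"
    using U(4) NL(2) Ul by (simp add: order_le_less_trans)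
  \<comment> \<open>Half-open intervals make \<open>m\<close> additive at a splitting point.\<close>
  define m where "m s t = measure lborel (U \<inter> {s<..t})" for s t
  have fin: "emeasure lborel (U \<inter> {s<..t}) < \<infinity>" for s t
    using emeasure_mono[of "U \<inter> {s<..t}" U lborel] Um Ul
    by (auto intro: le_less_trans less_trans)
  have m_add: "m s t + m t r = m s r" if "s \<le> t" "t \<le> r" for s t r
  proof -
    have "U \<inter> {s<..r} = (U \<inter> {s<..t}) \<union> (U \<inter> {t<..r})" using that by auto
    then show ?thesis unfolding m_def
      using fin Ul by (subst measure_Union[symmetric]) (auto simp: less_top)
  qed
  have m_le: "m s t < \<delta>" for s t
  proof -
    have "emeasure lborel (U \<inter> {s<..t}) < ennreal \<delta>"
      using emeasure_mono[of "U \<inter> {s<..t}" U lborel] Um Ul by (auto intro: le_less_trans)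
    moreover have "emeasure lborel (U \<inter> {s<..t}) = ennreal (m s t)"
      unfolding m_def using fin[of s t] by (intro emeasure_eq_ennreal_measure) auto
    ultimately show ?thesis by (simp add: ennreal_less_iff m_def)
  qed
  \<comment> \<open>\<open>xs\<close> lists the bad intervals. Their total length is charged to the
    measure of \<open>U\<close>, so it stays below \<delta> however often the interval is
    split.\<close>
  define ok where "ok s t xs \<longleftrightarrow> (\<forall>p\<in>set xs. s \<le> fst p \<and> fst p \<le> snd p \<and> snd p \<le> t) \<and>
      sorted_wrt (\<lambda>p q. snd p \<le> fst q) xs \<and> (\<Sum>p\<leftarrow>xs. snd p - fst p) \<le> m s t \<and>
      R (s, t) \<le> (K + e1) * (t - s) + (\<Sum>p\<leftarrow>xs. R p)" for s t and xs :: "(real \<times> real) list"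
  have Rtri: "R (s, r) \<le> R (s, t) + R (t, r)" for s t r
  proof -
    have "f r - f s - (r - s) *\<^sub>R c = (f t - f s - (t - s) *\<^sub>R c) + (f r - f t - (r - t) *\<^sub>R c)"
      by (simp add: algebra_simps)
    then show ?thesis unfolding R_def fst_conv snd_conv by (metis norm_triangle_ineq)
  qed
  define P where "P s t \<longleftrightarrow> (s \<le> t \<and> a \<le> s \<and> t \<le> b \<longrightarrow> (\<exists>xs. ok s t xs))" for s t
  from ab(2) have "P a b"
  proof (induct rule: Bolzano)
    case (trans s t r)
    show ?case
      unfolding P_def
    proof
      assume "s \<le> r \<and> a \<le> s \<and> r \<le> b"
      with trans obtain xs ys where xy: "ok s t xs" "ok t r ys" by (auto simp: P_def)
      have "ok s r (xs @ ys)"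
        unfolding ok_def
      proof (intro conjI ballI)
        fix p assume "p \<in> set (xs @ ys)"
        then show "s \<le> fst p" "fst p \<le> snd p" "snd p \<le> r"
          using xy trans(3,4) unfolding ok_def by fastforce+
      next
        show "sorted_wrt (\<lambda>p q. snd p \<le> fst q) (xs @ ys)"
          using xy unfolding ok_def sorted_wrt_append by fastforce
        show "(\<Sum>p\<leftarrow>xs @ ys. snd p - fst p) \<le> m s r"
          using xy m_add[OF trans(3,4)] unfolding ok_def by simp
        have "R (s, r) \<le> R (s, t) + R (t, r)" by (rule Rtri)
        also have "\<dots> \<le> (K + e1) * (r - s) + (\<Sum>p\<leftarrow>xs @ ys. R p)"
          using xy unfolding ok_def by (simp add: algebra_simps)
        finally show "R (s, r) \<le> (K + e1) * (r - s) + (\<Sum>p\<leftarrow>xs @ ys. R p)" .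
      qed
      then show "\<exists>xs. ok s r xs" ..
    qed
  next
    case (local x)
    show ?case
    proof (cases "x \<in> N")
      case True
      then obtain d where d: "d > 0" "ball x d \<subseteq> U"
        using U(1,2) by (meson open_contains_ball subsetD)
      show ?thesis
      proof (intro exI[of _ d] conjI allI impI d(1))
        fix s t assume st1: "s \<le> x \<and> x \<le> t \<and> t - s < d"
        show "P s t"
          unfolding P_def
        proof
          assume "s \<le> t \<and> a \<le> s \<and> t \<le> b"
          note st = st1 this
          have "{s<..t} \<subseteq> ball x d" using st by (auto simp: dist_real_def)
          then have "U \<inter> {s<..t} = {s<..t}" using d by auto
          then have "m s t = t - s" using st by (simp add: m_def)
          then have "ok s t [(s, t)]" using st K \<open>0 < e1\<close> by (simp add: ok_def)
          then show "\<exists>xs. ok s t xs" ..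
        qed
      qed
    next
      case False
      then obtain f' where f': "(f has_vector_derivative f') (at x within {0..1})" "norm (f' - c) \<le> K"
        using der[of x] local by auto
      have "\<exists>d>0. \<forall>y\<in>{0..1}. norm (y - x) < d \<longrightarrow>
          norm (f y - f x - (y - x) *\<^sub>R f') \<le> e1 * norm (y - x)"
        using f'(1) \<open>0 < e1\<close> unfolding has_vector_derivative_def has_derivative_within_alt by blast
      then obtain d where d: "d > 0" "\<And>y. y \<in> {0..1} \<Longrightarrow> \<bar>y - x\<bar> < d \<Longrightarrow>
          norm (f y - f x - (y - x) *\<^sub>R f') \<le> e1 * \<bar>y - x\<bar>" by auto
      have d': "norm (f y - f x - (y - x) *\<^sub>R c) \<le> (K + e1) * \<bar>y - x\<bar>"
        if "y \<in> {0..1}" "\<bar>y - x\<bar> < d" for y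
      proof -
        have "f y - f x - (y - x) *\<^sub>R c = (f y - f x - (y - x) *\<^sub>R f') + (y - x) *\<^sub>R (f' - c)"
          by (simp add: algebra_simps)
        then have "norm (f y - f x - (y - x) *\<^sub>R c)
            \<le> norm (f y - f x - (y - x) *\<^sub>R f') + norm ((y - x) *\<^sub>R (f' - c))"
          by (simp only: norm_triangle_ineq)
        also have "\<dots> \<le> e1 * \<bar>y - x\<bar> + \<bar>y - x\<bar> * norm (f' - c)"
          using d(2)[OF that] by simp
        also have "\<bar>y - x\<bar> * norm (f' - c) \<le> \<bar>y - x\<bar> * K" using f'(2) by (intro mult_left_mono) auto
        finally show ?thesis by (simp add: algebra_simps)
      qed
      show ?thesis
      proof (intro exI[of _ d] conjI allI impI d(1))
        fix s t assume st1: "s \<le> x \<and> x \<le> t \<and> t - s < d"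
        show "P s t"
          unfolding P_def
        proof
          assume "s \<le> t \<and> a \<le> s \<and> t \<le> b"
          note st = st1 this
          have "R (s, x) \<le> (K + e1) * (x - s)"
          proof -
            have "norm (f s - f x - (s - x) *\<^sub>R c) \<le> (K + e1) * (x - s)"
              using d'[of s] st ab local by auto
            moreover have "f s - f x - (s - x) *\<^sub>R c = - (f x - f s - (x - s) *\<^sub>R c)"
              by (simp add: algebra_simps)
            ultimately show ?thesis unfolding R_def fst_conv snd_conv by (metis norm_minus_cancel)
        qed
        moreover have "R (x, t) \<le> (K + e1) * (t - x)"
          using d'[of t] st ab local by (auto simp: R_def)
        ultimately have "R (s, t) \<le> (K + e1) * (t - s)"
          using Rtri[of s t x] by (simp add: algebra_simps)
        then have "ok s t []" by (simp add: ok_def m_def)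
        then show "\<exists>xs. ok s t xs" ..
        qed
      qed
    qed
  qed
  then obtain xs where xs: "ok a b xs" using ab by (auto simp: P_def)
  have len: "(\<Sum>p\<leftarrow>xs. snd p - fst p) < \<delta>" using xs m_le unfolding ok_def by (meson order_le_less_trans)
  have "(\<Sum>p\<leftarrow>xs. R p) \<le> (\<Sum>p\<leftarrow>xs. norm (f (snd p) - f (fst p)) + (snd p - fst p) * norm c)"
  proof (rule sum_list_mono)
    fix p assume "p \<in> set xs"
    then have "fst p \<le> snd p" using xs by (simp add: ok_def)
    then show "R p \<le> norm (f (snd p) - f (fst p)) + (snd p - fst p) * norm c"
      using norm_triangle_ineq4[of "f (snd p) - f (fst p)" "(snd p - fst p) *\<^sub>R c"] by (simp add: R_def)
  qed
  also have "\<dots> = (\<Sum>p\<leftarrow>xs. norm (f (snd p) - f (fst p))) + (\<Sum>p\<leftarrow>xs. snd p - fst p) * norm c"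
    by (simp add: sum_list_addf sum_list_mult_const)
  also have "\<dots> \<le> e1 + \<delta> * norm c"
    using \<delta>0(2)[of xs] xs len ab
    by (intro add_mono mult_right_mono) (force simp: ok_def \<delta>_def)+
  also have "\<delta> * norm c \<le> (e1 / (norm c + 1)) * norm c"
    by (intro mult_right_mono) (auto simp: \<delta>_def)
  also have "\<dots> \<le> e1"
    using \<open>0 < e1\<close> \<open>norm c + 1 > 0\<close> by (simp add: field_simps)
  finally have "(\<Sum>p\<leftarrow>xs. R p) \<le> 2 * e1" by simp
  moreover have "e1 * (b - a) \<le> e1 * 1" using ab \<open>0 < e1\<close> by (intro mult_left_mono) auto
  moreover have "R (a, b) \<le> (K + e1) * (b - a) + (\<Sum>p\<leftarrow>xs. R p)" using xs by (simp add: ok_def)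
  ultimately have "R (a, b) \<le> K * (b - a) + 3 * e1" by (simp add: algebra_simps)
  then show "norm (f b - f a - (b - a) *\<^sub>R c) \<le> K * (b - a) + e"
    using \<open>0 < e\<close> by (simp add: R_def e1_def)
qed

text \<open>Continuity of the right-hand side along the solution upgrades a Caratheodory solution to a
  classical one.\<close>

lemma absolutely_continuous_curve_C1:
  fixes f :: "real \<Rightarrow> 'a::real_normed_vector"
  assumes ac: "absolutely_continuous_curve f" and g: "continuous_on {0..1} g"
    and ae: "AE t in lborel. t \<in> {0..1} \<longrightarrow> (f has_vector_derivative g t) (at t within {0..1})"
    and t: "t \<in> {0..1}"
  shows "(f has_vector_derivative g t) (at t within {0..1})"
  unfolding has_vector_derivative_def has_derivative_within_alt
proof (intro conjI allI impI bounded_linear_scaleR_left)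
  fix e :: real assume "0 < e"
  then obtain d where d: "d > 0" "\<And>s. s \<in> {0..1} \<Longrightarrow> dist s t < d \<Longrightarrow> dist (g s) (g t) < e"
    using g t unfolding continuous_on_iff by metis
  \<comment> \<open>Near \<open>t\<close> the derivative differs from \<open>g t\<close> by less
    than \<open>e\<close>, so the previous bound applies with slope \<open>g t\<close> and constant
    \<open>e\<close>.\<close>
  have "norm (f y - f x - (y - x) *\<^sub>R g t) \<le> e * (y - x)"
    if "x \<le> y" "x \<in> {0..1}" "y \<in> {0..1}" "\<And>s. s \<in> {x..y} \<Longrightarrow> dist s t < d" for x y
  proof (rule absolutely_continuous_curve_bound[OF ac])
    show "AE s in lborel. s \<in> {x..y} \<longrightarrow>
        (\<exists>f'. (f has_vector_derivative f') (at s within {0..1}) \<and> norm (f' - g t) \<le> e)"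
      using ae
    proof eventually_elim
      case (elim s)
      show ?case
      proof
        assume s: "s \<in> {x..y}"
        then have "s \<in> {0..1}" using that by auto
        moreover have "norm (g s - g t) \<le> e"
          using d(2)[of s] that(4)[OF s] \<open>s \<in> {0..1}\<close> by (simp add: dist_norm)
        ultimately show "\<exists>f'. (f has_vector_derivative f') (at s within {0..1}) \<and> norm (f' - g t) \<le> e"
          using elim by blast
      qed
    qed
  qed (use that \<open>0 < e\<close> in auto)
  note * = this
  have "norm (f y - f t - (y - t) *\<^sub>R g t) \<le> e * norm (y - t)" if y: "y \<in> {0..1}" "norm (y - t) < d" for y
  proof (cases "t \<le> y")
    case True
    then show ?thesis using *[of t y] t y by (force simp: dist_real_def)
  next
    case False
    then have "norm (f t - f y - (t - y) *\<^sub>R g t) \<le> e * (t - y)"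
      using *[of y t] t y by (force simp: dist_real_def)
    moreover have "f t - f y - (t - y) *\<^sub>R g t = - (f y - f t - (y - t) *\<^sub>R g t)" by (simp add: algebra_simps)
    ultimately have "norm (f y - f t - (y - t) *\<^sub>R g t) \<le> e * (t - y)" by (metis norm_minus_cancel)
    then show ?thesis using False by simp
  qed
  then show "\<exists>d>0. \<forall>y\<in>{0..1}. norm (y - t) < d \<longrightarrow>
      norm (f y - f t - (y - t) *\<^sub>R g t) \<le> e * norm (y - t)"
    using d(1) by blast
qed


section \<open>Couplings and the Wasserstein distance\<close>

lemma prob_measures_onD:
  assumes "\<mu> \<in> prob_measures_on \<Omega>"
  shows "sets \<mu> = sets borel" "space \<mu> = UNIV" "emeasure \<mu> (space \<mu>) = 1" "finite_measure \<mu>"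
    "measure \<mu> (space \<mu>) = 1"
proof -
  show 1: "sets \<mu> = sets borel" using assms by (simp add: prob_measures_on_def)
  then show 2: "space \<mu> = UNIV" using sets_eq_imp_space_eq[OF 1] by simp
  show 3: "emeasure \<mu> (space \<mu>) = 1" using assms 2 by (simp add: prob_measures_on_def)
  then show "finite_measure \<mu>" by (intro finite_measureI) simp
  show "measure \<mu> (space \<mu>) = 1" using 3 by (simp add: measure_def)
qed

lemma prob_measures_on_AE:
  assumes m: "\<mu> \<in> prob_measures_on \<Omega>" and "closed \<Omega>"
  shows "AE x in \<mu>. x \<in> \<Omega>"
proof -
  note D = prob_measures_onD[OF m]
  have O: "\<Omega> \<in> sets \<mu>" using \<open>closed \<Omega>\<close> D(1) by simp
  have "emeasure \<mu> (space \<mu> - \<Omega>) = emeasure \<mu> (space \<mu>) - emeasure \<mu> \<Omega>"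
    using m O D by (intro emeasure_compl) (auto simp: prob_measures_on_def)
  also have "\<dots> = 0" using m D by (simp add: prob_measures_on_def)
  finally show ?thesis
    using O by (intro AE_I[of _ _ "space \<mu> - \<Omega>"]) auto
qed

lemma integrable_continuous_prob_measures_on:
  fixes f :: "'x::euclidean_space \<Rightarrow> 'b::{banach, second_countable_topology}"
  assumes \<Omega>: "compact \<Omega>" and m: "\<mu> \<in> prob_measures_on \<Omega>" and f: "continuous_on UNIV f"
  shows "integrable \<mu> f"
proof -
  note D = prob_measures_onD[OF m]
  interpret finite_measure \<mu> by (rule D)
  obtain b where b: "\<And>x. x \<in> \<Omega> \<Longrightarrow> norm (f x) \<le> b"
    using compact_imp_bounded[OF compact_continuous_image[OF continuous_on_subset[OF f] \<Omega>]]
    by (auto simp: bounded_iff)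
  have "f \<in> borel_measurable borel" by (rule borel_measurable_continuous_onI[OF f])
  then have "f \<in> borel_measurable \<mu>" using D(1) measurable_cong_sets by blast
  moreover have "AE x in \<mu>. norm (f x) \<le> b"
    using prob_measures_on_AE[OF m compact_imp_closed[OF \<Omega>]] by eventually_elim (rule b)
  ultimately show ?thesis by (intro integrable_const_bound)
qed

text \<open>Jensen's inequality for the square, obtained as nonnegativity of the variance.\<close>

lemma square_integral_le:
  fixes f :: "'a \<Rightarrow> real"
  assumes "finite_measure M" "measure M (space M) = 1" "integrable M f" "integrable M (\<lambda>x. (f x)\<^sup>2)"
  shows "(\<integral>x. f x \<partial>M)\<^sup>2 \<le> (\<integral>x. (f x)\<^sup>2 \<partial>M)"
proof -
  interpret finite_measure M by fact
  define m where "m = (\<integral>x. f x \<partial>M)"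
  have "0 \<le> (\<integral>x. (f x - m)\<^sup>2 \<partial>M)" by simp
  also have "(\<lambda>x. (f x - m)\<^sup>2) = (\<lambda>x. (f x)\<^sup>2 - 2 * m * f x + m\<^sup>2)"
    by (simp add: power2_diff algebra_simps)
  also have "(\<integral>x. (f x)\<^sup>2 - 2 * m * f x + m\<^sup>2 \<partial>M) = (\<integral>x. (f x)\<^sup>2 \<partial>M) - 2 * m * m + m\<^sup>2"
    using assms(2-4) by (simp add: m_def[symmetric])
  finally show ?thesis by (simp add: m_def power2_eq_square)
qed

lemma integrable_norm_of_square:
  fixes f :: "'a \<Rightarrow> 'b::{banach, second_countable_topology}"
  assumes "finite_measure M" "f \<in> borel_measurable M" "integrable M (\<lambda>x. (norm (f x))\<^sup>2)"
  shows "integrable M (\<lambda>x. norm (f x))"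
proof -
  interpret finite_measure M by fact
  have "integrable M (\<lambda>x. 1 + (norm (f x))\<^sup>2)" using assms by simp
  then show ?thesis
  proof (rule Bochner_Integration.integrable_bound)
    have "norm (f x) \<le> 1 + (norm (f x))\<^sup>2" for x
      using sum_squares_bound[of "norm (f x)" 1] norm_ge_zero[of "f x"] by (simp del: norm_ge_zero)
    then show "AE x in M. norm (norm (f x)) \<le> norm (1 + (norm (f x))\<^sup>2)" by simp
  qed (use assms in measurable)
qed

text \<open>Minkowski's inequality for a perturbation bounded by a constant: after squaring, the
  cross term is controlled by the mean of |g|, which on a probability space is at most the L2 norm.
  Integrability is part of the conclusion because \<open>L2_norm_of\<close> would be 0 by convention
  without it.\<close>

lemma L2_norm_of_perturb:
  fixes f g :: "'a \<Rightarrow> 'b::{banach, second_countable_topology}"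
  assumes M: "finite_measure M" "measure M (space M) = 1" and f: "f \<in> borel_measurable M"
    and g: "g \<in> borel_measurable M" "integrable M (\<lambda>x. (norm (g x))\<^sup>2)"
    and fg: "AE x in M. norm (f x - g x) \<le> \<delta>" and "0 \<le> \<delta>"
  shows "integrable M (\<lambda>x. (norm (f x))\<^sup>2)" "L2_norm_of M f \<le> L2_norm_of M g + \<delta>"
proof -
  interpret finite_measure M by fact
  note gi = integrable_norm_of_square[OF M(1) g]
  have le: "AE x in M. (norm (f x))\<^sup>2 \<le> (norm (g x))\<^sup>2 + 2 * \<delta> * norm (g x) + \<delta>\<^sup>2"
    using fg
  proof eventually_elim
    case (elim x)
    have "norm (f x) \<le> norm (g x) + \<delta>" using elim norm_triangle_ineq2[of "f x" "g x"] by simp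
    then have "(norm (f x))\<^sup>2 \<le> (norm (g x) + \<delta>)\<^sup>2" by (intro power_mono) auto
    then show ?case by (simp add: power2_sum algebra_simps)
  qed
  have ri: "integrable M (\<lambda>x. (norm (g x))\<^sup>2 + 2 * \<delta> * norm (g x) + \<delta>\<^sup>2)"
    using g gi by simp
  show fi: "integrable M (\<lambda>x. (norm (f x))\<^sup>2)"
  proof (rule Bochner_Integration.integrable_bound[OF ri])
    show "AE x in M. norm ((norm (f x))\<^sup>2) \<le> norm ((norm (g x))\<^sup>2 + 2 * \<delta> * norm (g x) + \<delta>\<^sup>2)"
      using le by eventually_elim simp
  qed (use f in measurable)
  have "(\<integral>x. (norm (f x))\<^sup>2 \<partial>M) \<le> (\<integral>x. (norm (g x))\<^sup>2 + 2 * \<delta> * norm (g x) + \<delta>\<^sup>2 \<partial>M)"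
    by (rule integral_mono_AE[OF fi ri le])
  also have "\<dots> = (\<integral>x. (norm (g x))\<^sup>2 \<partial>M) + 2 * \<delta> * (\<integral>x. norm (g x) \<partial>M) + \<delta>\<^sup>2"
    using g gi M(2) by simp
  finally have 1: "(\<integral>x. (norm (f x))\<^sup>2 \<partial>M) \<le> (\<integral>x. (norm (g x))\<^sup>2 \<partial>M) + 2 * \<delta> * (\<integral>x. norm (g x) \<partial>M) + \<delta>\<^sup>2" .
  have "(\<integral>x. norm (g x) \<partial>M) \<le> L2_norm_of M g"
    unfolding L2_norm_of_def using square_integral_le[OF M gi] g(2) by (intro real_le_rsqrt) simp
  then have "2 * \<delta> * (\<integral>x. norm (g x) \<partial>M) \<le> 2 * \<delta> * L2_norm_of M g"
    using \<open>0 \<le> \<delta>\<close> by (intro mult_left_mono) auto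
  moreover have "(\<integral>x. (norm (g x))\<^sup>2 \<partial>M) = (L2_norm_of M g)\<^sup>2" by (simp add: L2_norm_of_def)
  moreover have "(L2_norm_of M g + \<delta>)\<^sup>2 = (L2_norm_of M g)\<^sup>2 + 2 * \<delta> * L2_norm_of M g + \<delta>\<^sup>2"
    by (simp add: power2_sum)
  ultimately have "(\<integral>x. (norm (f x))\<^sup>2 \<partial>M) \<le> (L2_norm_of M g + \<delta>)\<^sup>2"
    using 1 by simp
  moreover have "0 \<le> L2_norm_of M g" by (simp add: L2_norm_of_def)
  ultimately show "L2_norm_of M f \<le> L2_norm_of M g + \<delta>"
    unfolding L2_norm_of_def[of M f] using \<open>0 \<le> \<delta>\<close> by (intro real_le_lsqrt) auto
qed

section \<open>Transport costs and comparison with W2\<close>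

abbreviation transport_cost :: "('x::euclidean_space \<times> 'x) measure \<Rightarrow> ennreal" where
  "transport_cost \<pi> \<equiv> \<integral>\<^sup>+z. ennreal ((norm (fst z - snd z))\<^sup>2) \<partial>\<pi>"

lemma coupling_fst_snd_measurable:
  assumes "\<pi> \<in> couplings \<mu> \<nu>"
  shows "fst \<in> borel_measurable \<pi>" "snd \<in> borel_measurable \<pi>"
proof -
  have s: "sets \<pi> = sets borel" using assms by (simp add: couplings_def)
  have "(fst :: 'a \<times> 'a \<Rightarrow> 'a) \<in> borel_measurable borel" "(snd :: 'a \<times> 'a \<Rightarrow> 'a) \<in> borel_measurable borel"
    by (auto intro!: borel_measurable_continuous_onI continuous_intros)
  then show "fst \<in> borel_measurable \<pi>" "snd \<in> borel_measurable \<pi>"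
    using s measurable_cong_sets by blast+
qed

lemma coupling_of_maps:
  fixes X Y :: "'a \<Rightarrow> 'x::euclidean_space"
  assumes [measurable]: "X \<in> borel_measurable P" "Y \<in> borel_measurable P"
  shows "distr P borel (\<lambda>a. (X a, Y a)) \<in> couplings (distr P borel X) (distr P borel Y)"
proof -
  have [measurable]: "(fst :: 'x \<times> 'x \<Rightarrow> 'x) \<in> borel_measurable borel" "(snd :: 'x \<times> 'x \<Rightarrow> 'x) \<in> borel_measurable borel"
    by (auto intro!: borel_measurable_continuous_onI continuous_intros)
  show ?thesis by (simp add: couplings_def distr_distr comp_def)
qed

lemma transport_cost_of_maps:
  fixes X Y :: "'a \<Rightarrow> 'x::euclidean_space"
  assumes [measurable]: "X \<in> borel_measurable P" "Y \<in> borel_measurable P"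
  shows "transport_cost (distr P borel (\<lambda>a. (X a, Y a))) = (\<integral>\<^sup>+a. ennreal ((norm (X a - Y a))\<^sup>2) \<partial>P)"
proof -
  have "(\<lambda>z::'x \<times> 'x. ennreal ((norm (fst z - snd z))\<^sup>2)) \<in> borel_measurable borel"
    by (intro measurable_compose[OF _ measurable_ennreal] borel_measurable_continuous_onI continuous_intros)
  then show ?thesis by (subst nn_integral_distr) auto
qed

lemma W2_le_of_maps:
  fixes X Y :: "'a \<Rightarrow> 'x::euclidean_space"
  assumes XY: "X \<in> borel_measurable P" "Y \<in> borel_measurable P" and P: "emeasure P (space P) = 1"
    and d: "AE a in P. norm (X a - Y a) \<le> \<delta>" and "0 \<le> \<delta>"
  shows "W2 (distr P borel X) (distr P borel Y) \<le> \<delta>"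
proof -
  have "(INF \<pi>\<in>couplings (distr P borel X) (distr P borel Y). transport_cost \<pi>)
      \<le> transport_cost (distr P borel (\<lambda>a. (X a, Y a)))"
    by (intro INF_lower coupling_of_maps XY)
  also have "\<dots> \<le> (\<integral>\<^sup>+a. ennreal (\<delta>\<^sup>2) \<partial>P)"
    unfolding transport_cost_of_maps[OF XY]
    by (intro nn_integral_mono_AE) (use d in eventually_elim, auto intro!: ennreal_leI power_mono)
  also have "\<dots> = ennreal (\<delta>\<^sup>2)" using P by simp
  finally have "enn2real (INF \<pi>\<in>couplings (distr P borel X) (distr P borel Y). transport_cost \<pi>) \<le> \<delta>\<^sup>2"
    by (intro enn2real_leI) auto
  then show ?thesis
    unfolding W2_def using \<open>0 \<le> \<delta>\<close> by (simp add: real_le_lsqrt)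
qed

text \<open>The product coupling has bounded cost. Finiteness matters because \<open>W2\<close>
  passes through \<open>enn2real\<close>: an infinite infimum would give distance 0 and defeat every
  lower bound for \<open>W2\<close>.\<close>

lemma couplings_finite_cost:
  fixes \<Omega> :: "'x::euclidean_space set"
  assumes \<Omega>: "compact \<Omega>" and m: "\<mu> \<in> prob_measures_on \<Omega>" "\<nu> \<in> prob_measures_on \<Omega>"
  shows "(INF \<pi>\<in>couplings \<mu> \<nu>. transport_cost \<pi>) < \<infinity>"
proof -
  note D = prob_measures_onD[OF m(1)] and D' = prob_measures_onD[OF m(2)]
  interpret M: finite_measure \<mu> by (rule D)
  interpret N: finite_measure \<nu> by (rule D')
  interpret pair_sigma_finite \<mu> \<nu> ..
  have sets: "sets (\<mu> \<Otimes>\<^sub>M \<nu>) = sets borel"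
    by (rule trans[OF sets_pair_measure_cong[OF D(1) D'(1)] arg_cong[where f = sets, OF borel_prod]])
  have fm: "emeasure (\<mu> \<Otimes>\<^sub>M \<nu>) (space (\<mu> \<Otimes>\<^sub>M \<nu>)) = 1"
    using D D' by (simp add: space_pair_measure N.emeasure_pair_measure_Times flip: UNIV_Times_UNIV)
  have fst: "distr (\<mu> \<Otimes>\<^sub>M \<nu>) borel fst = \<mu>"
  proof (rule measure_eqI)
    fix A assume "A \<in> sets (distr (\<mu> \<Otimes>\<^sub>M \<nu>) borel fst)"
    then have A: "A \<in> sets borel" "A \<in> sets \<mu>" using D(1) by auto
    have f: "fst \<in> measurable (\<mu> \<Otimes>\<^sub>M \<nu>) borel"
      using measurable_fst[of \<mu> \<nu>] measurable_cong_sets[OF refl D(1)] by blast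
    have "fst -` A \<inter> space (\<mu> \<Otimes>\<^sub>M \<nu>) = A \<times> space \<nu>" by (auto simp: space_pair_measure D(2))
    then show "emeasure (distr (\<mu> \<Otimes>\<^sub>M \<nu>) borel fst) A = emeasure \<mu> A"
      using A D' by (simp add: emeasure_distr[OF f] N.emeasure_pair_measure_Times)
  qed (simp add: D)
  have snd: "distr (\<mu> \<Otimes>\<^sub>M \<nu>) borel snd = \<nu>"
  proof (rule measure_eqI)
    fix A assume "A \<in> sets (distr (\<mu> \<Otimes>\<^sub>M \<nu>) borel snd)"
    then have A: "A \<in> sets borel" "A \<in> sets \<nu>" using D'(1) by auto
    have f: "snd \<in> measurable (\<mu> \<Otimes>\<^sub>M \<nu>) borel"
      using measurable_snd[of \<mu> \<nu>] measurable_cong_sets[OF refl D'(1)] by blast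
    have "snd -` A \<inter> space (\<mu> \<Otimes>\<^sub>M \<nu>) = space \<mu> \<times> A" by (auto simp: space_pair_measure D'(2))
    then show "emeasure (distr (\<mu> \<Otimes>\<^sub>M \<nu>) borel snd) A = emeasure \<nu> A"
      using A D by (simp add: emeasure_distr[OF f] N.emeasure_pair_measure_Times)
  qed (simp add: D')
  have coup: "\<mu> \<Otimes>\<^sub>M \<nu> \<in> couplings \<mu> \<nu>" by (simp add: couplings_def sets fst snd)
  note meas = coupling_fst_snd_measurable[OF coup]
  obtain b where b: "\<And>x. x \<in> \<Omega> \<Longrightarrow> norm x \<le> b" using compact_imp_bounded[OF \<Omega>] by (auto simp: bounded_iff)
  have cl: "closed \<Omega>" by (rule compact_imp_closed[OF \<Omega>])
  have S: "{x \<in> space borel. x \<in> \<Omega>} \<in> sets borel" using cl by auto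
  have "AE z in \<mu> \<Otimes>\<^sub>M \<nu>. fst z \<in> \<Omega>"
    using AE_distr_iff[OF meas(1) S] prob_measures_on_AE[OF m(1) cl] unfolding fst by blast
  moreover have "AE z in \<mu> \<Otimes>\<^sub>M \<nu>. snd z \<in> \<Omega>"
    using AE_distr_iff[OF meas(2) S] prob_measures_on_AE[OF m(2) cl] unfolding snd by blast
  ultimately have "AE z in \<mu> \<Otimes>\<^sub>M \<nu>. ennreal ((norm (fst z - snd z))\<^sup>2) \<le> ennreal ((2 * b)\<^sup>2)"
  proof eventually_elim
    case (elim z)
    then have "norm (fst z - snd z) \<le> 2 * b"
      using b[of "fst z"] b[of "snd z"] norm_triangle_ineq4[of "fst z" "snd z"] by simp
    then show ?case by (intro ennreal_leI power_mono) auto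
  qed
  then have "transport_cost (\<mu> \<Otimes>\<^sub>M \<nu>) \<le> (\<integral>\<^sup>+z. ennreal ((2 * b)\<^sup>2) \<partial>(\<mu> \<Otimes>\<^sub>M \<nu>))"
    by (intro nn_integral_mono_AE)
  also have "\<dots> < \<infinity>" using fm by (simp add: ennreal_mult_less_top)
  finally show ?thesis using INF_lower[OF coup] by (rule le_less_trans[rotated])
qed

text \<open>The easy half of Kantorovich-Rubinstein duality: integrate the Lipschitz bound against
  an arbitrary coupling, then pass to the quadratic cost by Jensen.\<close>

lemma lipschitz_integral_diff_le_W2:
  fixes \<Omega> :: "'x::euclidean_space set" and q :: "'x \<Rightarrow> real"
  assumes \<Omega>: "compact \<Omega>" and m: "\<mu> \<in> prob_measures_on \<Omega>" "\<nu> \<in> prob_measures_on \<Omega>"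
    and "0 < L" and q: "\<And>x y. \<bar>q x - q y\<bar> \<le> L * norm (x - y)"
  shows "\<bar>(\<integral>x. q x \<partial>\<mu>) - (\<integral>x. q x \<partial>\<nu>)\<bar> \<le> L * W2 \<mu> \<nu>"
proof -
  define d where "d = \<bar>(\<integral>x. q x \<partial>\<mu>) - (\<integral>x. q x \<partial>\<nu>)\<bar> / L"
  have "continuous_on UNIV q"
  proof -
    have "L-lipschitz_on UNIV q"
      using q \<open>0 < L\<close> by (intro lipschitz_onI) (auto simp: dist_norm)
    then show ?thesis by (rule lipschitz_on_continuous_on)
  qed
  then have qm: "q \<in> borel_measurable borel" and qi: "integrable \<mu> q" "integrable \<nu> q"
    using integrable_continuous_prob_measures_on[OF \<Omega>] m by (auto intro: borel_measurable_continuous_onI)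
  have "ennreal (d\<^sup>2) \<le> transport_cost \<pi>" if pi: "\<pi> \<in> couplings \<mu> \<nu>" for \<pi>
  proof (cases "transport_cost \<pi> = \<infinity>")
    case False
    note [measurable] = coupling_fst_snd_measurable[OF pi]
    have e: "\<mu> = distr \<pi> borel fst" "\<nu> = distr \<pi> borel snd" using pi by (auto simp: couplings_def)
    have "emeasure \<pi> (space \<pi>) = emeasure (distr \<pi> borel fst) (space (distr \<pi> borel fst))"
      by (subst emeasure_distr) auto
    then have p1: "emeasure \<pi> (space \<pi>) = 1" using prob_measures_onD(3)[OF m(1)] e(1) by simp
    then have fm: "finite_measure \<pi>" "measure \<pi> (space \<pi>) = 1"
      by (auto intro!: finite_measureI simp: measure_def)
    have sq: "integrable \<pi> (\<lambda>z. (norm (fst z - snd z))\<^sup>2)"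
      using False by (intro integrableI_bounded) (auto simp: less_top)
    have n: "integrable \<pi> (\<lambda>z. norm (fst z - snd z))"
      by (rule integrable_norm_of_square[OF fm(1) _ sq]) measurable
    have q1: "integrable \<pi> (\<lambda>z. q (fst z))" "(\<integral>x. q x \<partial>\<mu>) = (\<integral>z. q (fst z) \<partial>\<pi>)"
      using qi(1) qm unfolding e(1) by (auto simp: integrable_distr_eq integral_distr)
    have q2: "integrable \<pi> (\<lambda>z. q (snd z))" "(\<integral>x. q x \<partial>\<nu>) = (\<integral>z. q (snd z) \<partial>\<pi>)"
      using qi(2) qm unfolding e(2) by (auto simp: integrable_distr_eq integral_distr)
    have "\<bar>(\<integral>x. q x \<partial>\<mu>) - (\<integral>x. q x \<partial>\<nu>)\<bar> = \<bar>\<integral>z. q (fst z) - q (snd z) \<partial>\<pi>\<bar>"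
      using q1 q2 by simp
    also have "\<dots> \<le> (\<integral>z. \<bar>q (fst z) - q (snd z)\<bar> \<partial>\<pi>)" by (rule integral_abs_bound)
    also have "\<dots> \<le> (\<integral>z. L * norm (fst z - snd z) \<partial>\<pi>)"
      using q1 q2 n q by (intro integral_mono) auto
    also have "\<dots> = L * (\<integral>z. norm (fst z - snd z) \<partial>\<pi>)" by simp
    finally have "d \<le> (\<integral>z. norm (fst z - snd z) \<partial>\<pi>)"
      using \<open>0 < L\<close> by (simp add: d_def field_simps)
    then have "d\<^sup>2 \<le> (\<integral>z. norm (fst z - snd z) \<partial>\<pi>)\<^sup>2"
      using \<open>0 < L\<close> by (intro power_mono) (auto simp: d_def)
    also have "\<dots> \<le> (\<integral>z. (norm (fst z - snd z))\<^sup>2 \<partial>\<pi>)" by (rule square_integral_le[OF fm n sq])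
    finally have "ennreal (d\<^sup>2) \<le> ennreal (\<integral>z. (norm (fst z - snd z))\<^sup>2 \<partial>\<pi>)" by (rule ennreal_leI)
    also have "\<dots> = transport_cost \<pi>" by (rule nn_integral_eq_integral[symmetric, OF sq]) simp
    finally show ?thesis .
  qed simp
  then have "ennreal (d\<^sup>2) \<le> (INF \<pi>\<in>couplings \<mu> \<nu>. transport_cost \<pi>)" by (intro INF_greatest)
  then have "d\<^sup>2 \<le> enn2real (INF \<pi>\<in>couplings \<mu> \<nu>. transport_cost \<pi>)"
    using enn2real_mono[of "ennreal (d\<^sup>2)"] couplings_finite_cost[OF \<Omega> m] by simp
  then have "d \<le> W2 \<mu> \<nu>" unfolding W2_def by (rule real_le_rsqrt)
  then show ?thesis using \<open>0 < L\<close> by (simp add: d_def field_simps)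
qed


section \<open>The flow along a geodesic\<close>

lemma Ck_on_1_UNIV_iff:
  "Ck_on 1 f UNIV \<longleftrightarrow>
    (\<forall>x. f differentiable (at x)) \<and> (\<forall>v. continuous_on UNIV (\<lambda>x. frechet_derivative f (at x) v))"
  by (simp add: One_nat_def)

lemma continuous_on_Ck_on_1: "Ck_on 1 f UNIV \<Longrightarrow> continuous_on UNIV f"
  by (simp add: Ck_on_1_UNIV_iff continuous_on_eq_continuous_at differentiable_imp_continuous_within)

lemma C1_norm_leD:
  fixes f :: "'x::euclidean_space \<Rightarrow> 'x"
  assumes "C1_norm f \<le> ennreal K" "0 \<le> K"
  shows "norm (f x) \<le> K" "onorm (frechet_derivative f (at x)) \<le> K"
proof -
  have "ennreal (max (norm (f x)) (onorm (frechet_derivative f (at x)))) \<le> ennreal K"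
    using assms(1) unfolding C1_norm_def by (rule order_trans[rotated]) (rule SUP_upper, simp)
  then show "norm (f x) \<le> K" "onorm (frechet_derivative f (at x)) \<le> K"
    using \<open>0 \<le> K\<close> by auto
qed

lemma C1_norm_lipschitz:
  fixes f :: "'x::euclidean_space \<Rightarrow> 'x"
  assumes "Ck_on 1 f UNIV" "C1_norm f \<le> ennreal K" "0 \<le> K"
  shows "norm (f x - f y) \<le> K * norm (x - y)"
proof (rule differentiable_bound[of UNIV f "\<lambda>x. frechet_derivative f (at x)"])
  show "(f has_derivative frechet_derivative f (at z)) (at z within UNIV)" for z
    using assms(1) frechet_derivative_works by (auto simp: Ck_on_1_UNIV_iff)
qed (use C1_norm_leD[OF assms(2,3)] in auto)

lemma absolutely_continuous_curve_continuous:
  assumes "absolutely_continuous_curve f"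
  shows "continuous_on {0..1} f"
  unfolding continuous_on_iff
proof (intro ballI allI impI)
  fix t e :: real assume t: "t \<in> {0..1}" and "0 < e"
  obtain d where "d > 0" and d: "\<forall>xs::(real \<times> real) list. (\<forall>p\<in>set xs. 0 \<le> fst p \<and> fst p \<le> snd p \<and> snd p \<le> 1) \<and>
    sorted_wrt (\<lambda>p q. snd p \<le> fst q) xs \<and> (\<Sum>p\<leftarrow>xs. snd p - fst p) < d
    \<longrightarrow> (\<Sum>p\<leftarrow>xs. norm (f (snd p) - f (fst p))) < e"
    using absolutely_continuous_curve_list[OF assms \<open>0 < e\<close>] by (elim exE conjE)
  have "dist (f s) (f t) < e" if s: "s \<in> {0..1}" "dist s t < d" for s
    using d[THEN spec, of "[(min s t, max s t)]"] s t
    by (auto simp: dist_norm min_def max_def abs_if norm_minus_commute split: if_splits)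
  then show "\<exists>d>0. \<forall>s\<in>{0..1}. dist s t < d \<longrightarrow> dist (f s) (f t) < e" using \<open>d > 0\<close> by blast
qed

text \<open>\<open>distr\<close> along a non-measurable map is a junk measure, but not one of total mass one: a set
  and its complement cannot both have non-measurable, hence null, preimages.\<close>

lemma measurable_if_distr_mass_one:
  fixes f :: "'a \<Rightarrow> 'x::topological_space"
  assumes P: "emeasure P (space P) = 1" and d: "emeasure (distr P borel f) UNIV = 1"
  shows "f \<in> borel_measurable P"
proof (rule measurableI)
  fix A :: "'x set" assume A: "A \<in> sets borel"
  let ?Q = "distr P borel f" and ?\<mu> = "\<lambda>A. emeasure P (f -` A \<inter> space P)"
  have em: "emeasure ?Q B = ?\<mu> B" if B: "B \<in> sets borel" for B
  proof -
    have *: "emeasure ?Q = (\<lambda>B. if B \<in> sigma_sets UNIV (sets borel) \<and>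
        measure_space UNIV (sigma_sets UNIV (sets (borel :: 'x measure))) ?\<mu> then ?\<mu> B else 0)"
      unfolding distr_def using emeasure_measure_of_conv[of UNIV "sets borel" ?\<mu>] by simp
    \<comment> \<open>\<open>distr\<close> falls back to the zero measure when the set function is
      not a measure. Mass one excludes this, so \<open>?\<mu>\<close> gives the value of
      \<open>?Q\<close> on every Borel set.\<close>
    have "measure_space UNIV (sigma_sets UNIV (sets (borel :: 'x measure))) ?\<mu>"
      using d * by (metis zero_neq_one)
    then show ?thesis using B by (simp add: * sigma_sets.Basic)
  qed
  show "f -` A \<inter> space P \<in> sets P"
  proof (rule ccontr)
    assume n: "f -` A \<inter> space P \<notin> sets P"
    have c: "f -` (- A) \<inter> space P = space P - (f -` A \<inter> space P)" by auto
    have "space P - (f -` A \<inter> space P) \<notin> sets P"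
    proof
      assume "space P - (f -` A \<inter> space P) \<in> sets P"
      then have "space P - (space P - (f -` A \<inter> space P)) \<in> sets P" by (rule sets.compl_sets)
      then show False using n by (simp add: Diff_Diff_Int inf_commute Int_absorb1)
    qed
    then have "?\<mu> A = 0" "?\<mu> (- A) = 0" using n c by (auto simp: emeasure_notin_sets)
    then have "emeasure ?Q A = 0" "emeasure ?Q (- A) = 0" using A em by auto
    moreover have "emeasure ?Q UNIV \<le> emeasure ?Q A + emeasure ?Q (- A)"
      using emeasure_subadditive[of A ?Q "- A"] A by (simp add: Un_commute)
    ultimately show False using d by simp
  qed
qed simp

text \<open>In \<open>tangent_model\<close> the constant is bound by an existential quantifier.
  Fixing one witness \<open>C0\<close> lets all later constants be explicit in it.\<close>

locale geodesic_restriction =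
  fixes \<Omega> :: "'x::euclidean_space set"
    and M :: "('i, 'm::{t2_space, second_countable_topology}, 'e::euclidean_space) riem_data"
    and S :: "'m set"
    and D :: "('m \<times> ('i, 'e) tangent) set"
    and E :: "'m \<Rightarrow> 'x measure"
    and B :: "'m \<Rightarrow> ('i, 'e) tangent \<Rightarrow> 'x \<Rightarrow> 'x"
    and C0 :: real
  assumes Om: "compact \<Omega>"
    and PM: "parameter_manifold M S D"
    and MP: "measure_parametrization M S \<Omega> E"
    and TM: "tangent_model M S D E B"
    and FC: "flow_compatible M S \<Omega> E B"
    and C0: "0 < C0"
    and C1_B: "\<And>\<theta> \<eta>. (\<theta>, \<eta>) \<in> D \<Longrightarrow> C1_norm (B \<theta> \<eta>) \<le> ennreal (C0 * tnorm M \<theta> \<eta>)"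
    and der_B: "\<And>\<theta> \<eta> x t. (\<theta>, \<eta>) \<in> D \<Longrightarrow> t \<in> {0..1} \<Longrightarrow> \<exists>u.
       ((\<lambda>s. B (exp_curve M \<theta> \<eta> s) (velocity M (exp_curve M \<theta> \<eta>) s) x) has_vector_derivative u)
         (at t within {0..1}) \<and> norm u \<le> C0 * (tnorm M \<theta> \<eta>)\<^sup>2"
begin

text \<open>Bounds the acceleration of a trajectory in units of the squared norm of \<eta>:
  \<open>C0\<close> from the change of the field in time, and \<open>2 * C0\<^sup>2\<close> from its
  spatial Lipschitz constant \<open>C0\<close> times the speed bound \<open>2 * C0\<close>.\<close>

definition Ct :: real where "Ct = C0 + 2 * C0\<^sup>2"

lemma Ct_nonneg: "0 \<le> Ct"
  using C0 by (simp add: Ct_def)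

lemma atlas: "smooth_atlas M" and riem: "riemannian_metric M"
  using PM by (auto simp: parameter_manifold_def riemannian_manifold_def)

lemma D_tangent:
  assumes "(\<theta>, \<eta>) \<in> D"
  shows "\<theta> \<in> S" "\<eta> \<in> tangent_space M \<theta>" "0 \<le> tnorm M \<theta> \<eta>"
proof -
  have "D \<subseteq> {(\<theta>, \<eta>). \<theta> \<in> S \<and> \<eta> \<in> tangent_space M \<theta>}" using PM by (simp add: parameter_manifold_def)
  then show "\<theta> \<in> S" "\<eta> \<in> tangent_space M \<theta>" using assms by auto
  then show "0 \<le> tnorm M \<theta> \<eta>" by (intro tnorm_nonneg[OF atlas riem])
qed

lemma exp_curve_D:
  assumes "(\<theta>, \<eta>) \<in> D"
  shows "geodesic M (exp_curve M \<theta> \<eta>)" "exp_curve M \<theta> \<eta> 0 = \<theta>"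
    "velocity M (exp_curve M \<theta> \<eta>) 0 = \<eta>" "exp_curve M \<theta> \<eta> ` {0..1} \<subseteq> S"
    "\<And>t. t \<in> {0..1} \<Longrightarrow>
      tnorm M (exp_curve M \<theta> \<eta> t) (velocity M (exp_curve M \<theta> \<eta>) t) = tnorm M \<theta> \<eta>"
    "tnorm M \<theta> \<eta> = riem_dist M S \<theta> (riem_exp M \<theta> \<eta>)"
proof -
  have "\<forall>(\<theta>, \<eta>)\<in>D. let \<gamma> = exp_curve M \<theta> \<eta> in
        geodesic_from M \<theta> \<eta> \<gamma> \<and> \<gamma> ` {0..1} \<subseteq> S \<and>
        (\<forall>t\<in>{0..1}. tnorm M (\<gamma> t) (velocity M \<gamma> t) = tnorm M \<theta> \<eta>) \<and>
        tnorm M \<theta> \<eta> = riem_dist M S \<theta> (riem_exp M \<theta> \<eta>)"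
    using PM unfolding parameter_manifold_def by (elim conjE)
  from bspec[OF this assms] show "geodesic M (exp_curve M \<theta> \<eta>)" "exp_curve M \<theta> \<eta> 0 = \<theta>"
    "velocity M (exp_curve M \<theta> \<eta>) 0 = \<eta>" "exp_curve M \<theta> \<eta> ` {0..1} \<subseteq> S"
    "\<And>t. t \<in> {0..1} \<Longrightarrow>
      tnorm M (exp_curve M \<theta> \<eta> t) (velocity M (exp_curve M \<theta> \<eta>) t) = tnorm M \<theta> \<eta>"
    "tnorm M \<theta> \<eta> = riem_dist M S \<theta> (riem_exp M \<theta> \<eta>)"
    by (simp_all add: Let_def geodesic_from_def)
qed

lemma exp_curve_tangent:
  assumes "(\<theta>, \<eta>) \<in> D" "t \<in> {0..1}"
  shows "exp_curve M \<theta> \<eta> t \<in> S"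
    "velocity M (exp_curve M \<theta> \<eta>) t \<in> tangent_space M (exp_curve M \<theta> \<eta> t)"
  using exp_curve_D[OF assms(1)] assms(2) geodesic_velocity_tangent[OF atlas] by auto

lemma exp_curve_dist:
  assumes "(\<theta>, \<eta>) \<in> D" "s \<in> {0..1}" "t \<in> {0..1}"
  shows "riem_dist M S (exp_curve M \<theta> \<eta> s) (exp_curve M \<theta> \<eta> t) \<le> tnorm M \<theta> \<eta> * \<bar>s - t\<bar>"
  using exp_curve_D[OF assms(1)] assms(2,3) by (intro riem_dist_geodesic_le[OF atlas riem]) auto

lemma exp_curve_lipschitz:
  assumes "(\<theta>, \<eta>) \<in> D"
  shows "lipschitz_curve (riem_dist M S) S (exp_curve M \<theta> \<eta>)"
  unfolding lipschitz_curve_def using exp_curve_D(4)[OF assms] exp_curve_dist[OF assms] by blast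

lemma B_C1: "\<theta> \<in> S \<Longrightarrow> \<eta> \<in> tangent_space M \<theta> \<Longrightarrow> Ck_on 1 (B \<theta> \<eta>) UNIV"
  and B_gradient: "\<theta> \<in> S \<Longrightarrow> \<eta> \<in> tangent_space M \<theta> \<Longrightarrow> gradient_field (B \<theta> \<eta>)"
  using TM by (auto simp: tangent_model_def)

lemma B_diff:
  assumes "\<theta> \<in> S" "\<eta> \<in> tangent_space M \<theta>" "\<zeta> \<in> tangent_space M \<theta>"
  shows "B \<theta> (\<lambda>i. \<eta> i - \<zeta> i) x = B \<theta> \<eta> x - B \<theta> \<zeta> x"
proof -
  have "\<forall>\<theta>\<in>S. \<forall>\<eta>\<in>tangent_space M \<theta>. \<forall>\<zeta>\<in>tangent_space M \<theta>. \<forall>a b x.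
        B \<theta> (\<lambda>i. a *\<^sub>R \<eta> i + b *\<^sub>R \<zeta> i) x = a *\<^sub>R B \<theta> \<eta> x + b *\<^sub>R B \<theta> \<zeta> x"
    using TM by (simp add: tangent_model_def)
  then have "B \<theta> (\<lambda>i. 1 *\<^sub>R \<eta> i + (-1) *\<^sub>R \<zeta> i) x = 1 *\<^sub>R B \<theta> \<eta> x + (-1) *\<^sub>R B \<theta> \<zeta> x"
    using assms by blast
  then show ?thesis by simp
qed

lemma B_bounds:
  assumes "(\<theta>, \<eta>) \<in> D"
  shows "norm (B \<theta> \<eta> x) \<le> C0 * tnorm M \<theta> \<eta>"
    "norm (B \<theta> \<eta> x - B \<theta> \<eta> y) \<le> C0 * tnorm M \<theta> \<eta> * norm (x - y)"
proof -
  note d = D_tangent[OF assms]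
  have n: "0 \<le> C0 * tnorm M \<theta> \<eta>" using C0 d by simp
  show "norm (B \<theta> \<eta> x) \<le> C0 * tnorm M \<theta> \<eta>" by (rule C1_norm_leD[OF C1_B[OF assms] n])
  show "norm (B \<theta> \<eta> x - B \<theta> \<eta> y) \<le> C0 * tnorm M \<theta> \<eta> * norm (x - y)"
    by (rule C1_norm_lipschitz[OF B_C1[OF d(1,2)] C1_B[OF assms] n])
qed

definition vel :: "'m \<Rightarrow> ('i, 'e) tangent \<Rightarrow> real \<Rightarrow> 'x \<Rightarrow> 'x" where
  "vel \<theta> \<eta> t = B (exp_curve M \<theta> \<eta> t) (velocity M (exp_curve M \<theta> \<eta>) t)"

lemma vel_0: "(\<theta>, \<eta>) \<in> D \<Longrightarrow> vel \<theta> \<eta> 0 = B \<theta> \<eta>"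
  using exp_curve_D(2,3) by (simp add: vel_def)

lemma vel_time_lipschitz:
  assumes "(\<theta>, \<eta>) \<in> D" "s \<in> {0..1}" "t \<in> {0..1}"
  shows "norm (vel \<theta> \<eta> s x - vel \<theta> \<eta> t x) \<le> C0 * (tnorm M \<theta> \<eta>)\<^sup>2 * \<bar>s - t\<bar>"
proof -
  have "\<forall>t\<in>{0..1}. \<exists>u. ((\<lambda>s. vel \<theta> \<eta> s x) has_vector_derivative u) (at t within {0..1})
      \<and> norm u \<le> C0 * (tnorm M \<theta> \<eta>)\<^sup>2"
    using der_B[OF assms(1)] by (auto simp: vel_def)
  then obtain u where u: "\<And>t. t \<in> {0..1} \<Longrightarrow>
      ((\<lambda>s. vel \<theta> \<eta> s x) has_vector_derivative u t) (at t within {0..1}) \<and> norm (u t) \<le> C0 * (tnorm M \<theta> \<eta>)\<^sup>2"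
    by (metis (no_types, lifting))
  have "norm (vel \<theta> \<eta> s x - vel \<theta> \<eta> t x) \<le> C0 * (tnorm M \<theta> \<eta>)\<^sup>2 * norm (s - t)"
  proof (rule differentiable_bound[of "{0..1}" _ "\<lambda>t h. h *\<^sub>R u t"])
    show "onorm (\<lambda>h. h *\<^sub>R u r) \<le> C0 * (tnorm M \<theta> \<eta>)\<^sup>2" if "r \<in> {0..1}" for r
      using u[OF that] C0 by (intro onorm_bound) (auto simp: mult.commute intro: mult_left_mono)
  qed (use u assms in \<open>auto simp: has_vector_derivative_def\<close>)
  then show ?thesis by simp
qed

lemma vel_norm:
  assumes "(\<theta>, \<eta>) \<in> D" "s \<in> {0..1}"
  shows "norm (vel \<theta> \<eta> s x) \<le> C0 * tnorm M \<theta> \<eta> + C0 * (tnorm M \<theta> \<eta>)\<^sup>2 * s"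
proof -
  have "norm (vel \<theta> \<eta> s x) \<le> norm (vel \<theta> \<eta> 0 x) + norm (vel \<theta> \<eta> s x - vel \<theta> \<eta> 0 x)"
    by (rule norm_triangle_sub)
  then show ?thesis
    using vel_time_lipschitz[OF assms(1) assms(2), of 0 x] B_bounds(1)[OF assms(1), of x] vel_0[OF assms(1)] assms(2)
    by simp
qed

text \<open>Continuity in space at each fixed time combines with a Lipschitz bound in time that is
  uniform in space.\<close>

lemma vel_continuous:
  assumes "(\<theta>, \<eta>) \<in> D"
  shows "continuous_on ({0..1} \<times> UNIV) (\<lambda>z. vel \<theta> \<eta> (fst z) (snd z))"
  unfolding continuous_on_iff
proof (intro ballI allI impI)
  fix z :: "real \<times> 'x" and e :: real assume z: "z \<in> {0..1} \<times> UNIV" and "0 < e"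
  obtain t x where tx: "z = (t, x)" "t \<in> {0..1}" using z by auto
  define K where "K = C0 * (tnorm M \<theta> \<eta>)\<^sup>2 + 1"
  have "K > 0" using C0 by (simp add: K_def add_nonneg_pos)
  have "continuous_on UNIV (vel \<theta> \<eta> t)"
    unfolding vel_def using exp_curve_tangent[OF assms tx(2)] by (intro continuous_on_Ck_on_1 B_C1)
  then obtain d where d: "d > 0" "\<And>y. dist y x < d \<Longrightarrow> dist (vel \<theta> \<eta> t y) (vel \<theta> \<eta> t x) < e / 2"
    unfolding continuous_on_iff using \<open>0 < e\<close> by (metis UNIV_I half_gt_zero)
  define d' where "d' = min d (e / (2 * K))"
  have "d' > 0" using d \<open>0 < e\<close> \<open>K > 0\<close> by (simp add: d'_def)
  moreover have "dist (vel \<theta> \<eta> (fst y) (snd y)) (vel \<theta> \<eta> (fst z) (snd z)) < e"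
    if y: "y \<in> {0..1} \<times> UNIV" "dist y z < d'" for y
  proof -
    have "dist (fst y) t < d'" "dist (snd y) x < d'"
      using y(2) dist_fst_le[of y z] dist_snd_le[of y z] tx(1) by auto
    then have 1: "\<bar>fst y - t\<bar> < e / (2 * K)" and 2: "dist (snd y) x < d" by (auto simp: d'_def dist_real_def)
    have "dist (vel \<theta> \<eta> (fst y) (snd y)) (vel \<theta> \<eta> t (snd y)) \<le> C0 * (tnorm M \<theta> \<eta>)\<^sup>2 * \<bar>fst y - t\<bar>"
      using vel_time_lipschitz[OF assms _ tx(2), of "fst y" "snd y"] y(1) by (auto simp: dist_norm)
    also have "\<dots> \<le> K * \<bar>fst y - t\<bar>" by (intro mult_right_mono) (auto simp: K_def)
    also have "\<dots> < e / 2" using 1 \<open>K > 0\<close> by (simp add: field_simps)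
    finally have "dist (vel \<theta> \<eta> (fst y) (snd y)) (vel \<theta> \<eta> t (snd y)) < e / 2" .
    then show ?thesis using d(2)[OF 2] tx(1)
      by (metis dist_triangle_half_r dist_commute fst_conv snd_conv)
  qed
  ultimately show "\<exists>d>0. \<forall>y\<in>{0..1} \<times> UNIV. dist y z < d \<longrightarrow>
      dist (vel \<theta> \<eta> (fst y) (snd y)) (vel \<theta> \<eta> (fst z) (snd z)) < e" by blast
qed

text \<open>Which solution is chosen is immaterial, since \<open>flow_compatible\<close> describes
  the push-forward by every solution. Solutions are constrained only for starting points in
  \<Omega>.\<close>

definition flow :: "'m \<Rightarrow> ('i, 'e) tangent \<Rightarrow> real \<Rightarrow> 'x \<Rightarrow> 'x" where
  "flow \<theta> \<eta> = (SOME \<phi>. flow_solution \<Omega> (vel \<theta> \<eta>) \<phi>)"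

text \<open>A common sample space for all flows out of \<theta>. Its points lie in \<Omega> without
  exception, so pointwise flow estimates hold everywhere on it.\<close>

definition base :: "'m \<Rightarrow> 'x measure" where
  "base \<theta> = restrict_space (E \<theta>) \<Omega>"

lemma E_prob: "\<theta> \<in> S \<Longrightarrow> E \<theta> \<in> prob_measures_on \<Omega>"
  using MP by (auto simp: measure_parametrization_def)

lemma closed_Om: "closed \<Omega>" by (rule compact_imp_closed[OF Om])

lemma base_prob:
  assumes "\<theta> \<in> S"
  shows "space (base \<theta>) = \<Omega>" "emeasure (base \<theta>) (space (base \<theta>)) = 1" "finite_measure (base \<theta>)"
    "measure (base \<theta>) (space (base \<theta>)) = 1"
proof -
  note e = E_prob[OF assms] and p = prob_measures_onD[OF E_prob[OF assms]]
  show 1: "space (base \<theta>) = \<Omega>" using p by (simp add: base_def space_restrict_space)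
  have "emeasure (base \<theta>) \<Omega> = emeasure (E \<theta>) \<Omega>"
    unfolding base_def using p closed_Om by (intro emeasure_restrict_space) auto
  then show 2: "emeasure (base \<theta>) (space (base \<theta>)) = 1" using e 1 by (simp add: prob_measures_on_def)
  then show "finite_measure (base \<theta>)" by (intro finite_measureI) simp
  show "measure (base \<theta>) (space (base \<theta>)) = 1" using 2 by (simp add: measure_def)
qed

lemma flow_solution_flow:
  assumes "(\<theta>, \<eta>) \<in> D"
  shows "flow_solution \<Omega> (vel \<theta> \<eta>) (flow \<theta> \<eta>)"
    "t \<in> {0..1} \<Longrightarrow> E (exp_curve M \<theta> \<eta> t) = distr (base \<theta>) borel (flow \<theta> \<eta> t)"
proof -
  have *: "(\<exists>\<phi>. flow_solution \<Omega> (vel \<theta> \<eta>) \<phi>) \<and> (\<forall>\<phi>. flow_solution \<Omega> (vel \<theta> \<eta>) \<phi> \<longrightarrow>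
              (\<forall>t\<in>{0..1}. E (exp_curve M \<theta> \<eta> t) = distr (base \<theta>) borel (\<phi> t)))"
    using FC[unfolded flow_compatible_def, THEN spec, THEN mp, OF exp_curve_lipschitz[OF assms]]
    unfolding Let_def vel_def[abs_def] base_def exp_curve_D(2)[OF assms] .
  show sol: "flow_solution \<Omega> (vel \<theta> \<eta>) (flow \<theta> \<eta>)"
    unfolding flow_def by (rule someI_ex[OF conjunct1[OF *]])
  show "E (exp_curve M \<theta> \<eta> t) = distr (base \<theta>) borel (flow \<theta> \<eta> t)" if "t \<in> {0..1}"
    using conjunct2[OF *, THEN spec, THEN mp, OF sol] that by blast
qed

text \<open>Measurability in the starting point is not part of \<open>flow_solution\<close>; it is
  recovered from the fact that the push-forward has mass one.\<close>

lemma flow_measurable: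
  assumes "(\<theta>, \<eta>) \<in> D" "t \<in> {0..1}"
  shows "flow \<theta> \<eta> t \<in> borel_measurable (base \<theta>)"
proof (rule measurable_if_distr_mass_one)
  show "emeasure (base \<theta>) (space (base \<theta>)) = 1" using base_prob D_tangent assms by blast
  have "E (exp_curve M \<theta> \<eta> t) \<in> prob_measures_on \<Omega>" using exp_curve_tangent assms by (intro E_prob) blast
  then show "emeasure (distr (base \<theta>) borel (flow \<theta> \<eta> t)) UNIV = 1"
    using flow_solution_flow(2)[OF assms] by (simp add: prob_measures_on_def)
qed

lemma flow_0: "(\<theta>, \<eta>) \<in> D \<Longrightarrow> x \<in> \<Omega> \<Longrightarrow> flow \<theta> \<eta> 0 x = x"
  using flow_solution_flow(1) by (auto simp: flow_solution_def)

lemma flow_AC: "(\<theta>, \<eta>) \<in> D \<Longrightarrow> x \<in> \<Omega> \<Longrightarrow> absolutely_continuous_curve (\<lambda>t. flow \<theta> \<eta> t x)"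
  using flow_solution_flow(1) by (auto simp: flow_solution_def)

text \<open>The field is jointly continuous and the trajectory is continuous, so the right-hand side
  is continuous in time and the equation holds at every time, not just almost every one.\<close>

lemma flow_derivative:
  assumes "(\<theta>, \<eta>) \<in> D" "x \<in> \<Omega>"
  shows "t \<in> {0..1} \<Longrightarrow>
      ((\<lambda>s. flow \<theta> \<eta> s x) has_vector_derivative vel \<theta> \<eta> t (flow \<theta> \<eta> t x)) (at t within {0..1})"
    "continuous_on {0..1} (\<lambda>s. flow \<theta> \<eta> s x)"
    "continuous_on {0..1} (\<lambda>s. vel \<theta> \<eta> s (flow \<theta> \<eta> s x))"
proof -
  note ac = flow_AC[OF assms]
  show c: "continuous_on {0..1} (\<lambda>s. flow \<theta> \<eta> s x)" by (rule absolutely_continuous_curve_continuous[OF ac])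
  have "continuous_on {0..1} (\<lambda>s. (s, flow \<theta> \<eta> s x))" by (intro continuous_intros c)
  from continuous_on_compose2[OF vel_continuous[OF assms(1)] this]
  show cv: "continuous_on {0..1} (\<lambda>s. vel \<theta> \<eta> s (flow \<theta> \<eta> s x))" by auto
  show "((\<lambda>s. flow \<theta> \<eta> s x) has_vector_derivative vel \<theta> \<eta> t (flow \<theta> \<eta> t x)) (at t within {0..1})"
    if "t \<in> {0..1}"
  proof (rule absolutely_continuous_curve_C1[OF ac cv _ that])
    show "AE t in lborel. t \<in> {0..1} \<longrightarrow>
        ((\<lambda>t. flow \<theta> \<eta> t x) has_vector_derivative vel \<theta> \<eta> t (flow \<theta> \<eta> t x)) (at t within {0..1})"
      using flow_solution_flow(1)[OF assms(1)] assms(2) unfolding flow_solution_def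
      by (elim conjE) (auto elim!: eventually_mono)
  qed
qed

text \<open>Each bound feeds the next: the speed bounds the displacement, the displacement bounds
  the drift of the velocity from its initial value, and the drift, integrated once more, bounds the
  deviation from the straight motion.\<close>

lemma flow_taylor:
  assumes d: "(\<theta>, \<eta>) \<in> D" and x: "x \<in> \<Omega>" and t: "t \<in> {0..1}" and small: "t * tnorm M \<theta> \<eta> \<le> 1"
  shows "norm (flow \<theta> \<eta> t x - x) \<le> 2 * C0 * tnorm M \<theta> \<eta> * t"
    "norm (vel \<theta> \<eta> t (flow \<theta> \<eta> t x) - B \<theta> \<eta> x) \<le> Ct * (tnorm M \<theta> \<eta>)\<^sup>2 * t"
    "norm (flow \<theta> \<eta> t x - x - t *\<^sub>R B \<theta> \<eta> x) \<le> Ct * (tnorm M \<theta> \<eta>)\<^sup>2 * t\<^sup>2"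
proof -
  define n where "n = tnorm M \<theta> \<eta>"
  have n: "0 \<le> n" using D_tangent[OF d] by (simp add: n_def)
  have first: "norm (flow \<theta> \<eta> s x - x) \<le> 2 * C0 * n * s" if s: "0 \<le> s" "s \<le> t" for s
  proof -
    have "norm (flow \<theta> \<eta> s x - flow \<theta> \<eta> 0 x - (s - 0) *\<^sub>R 0) \<le> 2 * C0 * n * (s - 0)"
    proof (rule absolutely_continuous_curve_bound[OF flow_AC[OF d x]])
      have "norm (vel \<theta> \<eta> r y) \<le> 2 * C0 * n" if r: "r \<in> {0..s}" for r y
      proof -
        \<comment> \<open>Smallness of \<open>t * n\<close> absorbs the quadratic term of the speed
          bound into the linear one, which costs the factor 2.\<close>
        have "n * r \<le> 1" using r s small n mult_right_mono[of r t n] by (simp add: n_def mult.commute)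
        then have "C0 * n * (n * r) \<le> C0 * n * 1" using C0 n by (intro mult_left_mono) auto
        then show ?thesis using vel_norm[OF d, of r y] r s t by (simp add: n_def power2_eq_square mult_ac)
      qed
      then show "AE r in lborel. r \<in> {0..s} \<longrightarrow> (\<exists>f'. ((\<lambda>t. flow \<theta> \<eta> t x) has_vector_derivative f')
            (at r within {0..1}) \<and> norm (f' - 0) \<le> 2 * C0 * n)"
        using flow_derivative(1)[OF d x] s t by (intro AE_I2) force
    qed (use s t C0 n in auto)
    then show ?thesis using flow_0[OF d x] by simp
  qed
  from first[of t] t show "norm (flow \<theta> \<eta> t x - x) \<le> 2 * C0 * tnorm M \<theta> \<eta> * t" by (simp add: n_def)
  have second: "norm (vel \<theta> \<eta> s (flow \<theta> \<eta> s x) - B \<theta> \<eta> x) \<le> Ct * n\<^sup>2 * s"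
    if s: "0 \<le> s" "s \<le> t" for s
  proof -
    have "norm (vel \<theta> \<eta> s (flow \<theta> \<eta> s x) - B \<theta> \<eta> x)
        \<le> norm (vel \<theta> \<eta> s (flow \<theta> \<eta> s x) - vel \<theta> \<eta> 0 (flow \<theta> \<eta> s x)) + norm (B \<theta> \<eta> (flow \<theta> \<eta> s x) - B \<theta> \<eta> x)"
      unfolding vel_0[OF d]
      using norm_triangle_ineq[of "vel \<theta> \<eta> s (flow \<theta> \<eta> s x) - B \<theta> \<eta> (flow \<theta> \<eta> s x)"
          "B \<theta> \<eta> (flow \<theta> \<eta> s x) - B \<theta> \<eta> x"] by simp
    also have "norm (vel \<theta> \<eta> s (flow \<theta> \<eta> s x) - vel \<theta> \<eta> 0 (flow \<theta> \<eta> s x)) \<le> C0 * n\<^sup>2 * s"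
      using vel_time_lipschitz[OF d, of s 0 "flow \<theta> \<eta> s x"] s t by (simp add: n_def)
    also have "norm (B \<theta> \<eta> (flow \<theta> \<eta> s x) - B \<theta> \<eta> x) \<le> C0 * n * norm (flow \<theta> \<eta> s x - x)"
      unfolding n_def by (rule B_bounds(2)[OF d])
    also have "\<dots> \<le> C0 * n * (2 * C0 * n * s)"
      using first[OF s] C0 n by (intro mult_left_mono) auto
    finally show ?thesis by (simp add: Ct_def algebra_simps power2_eq_square)
  qed
  from second[of t] t
  show "norm (vel \<theta> \<eta> t (flow \<theta> \<eta> t x) - B \<theta> \<eta> x) \<le> Ct * (tnorm M \<theta> \<eta>)\<^sup>2 * t"
    by (simp add: n_def)
  have "norm (flow \<theta> \<eta> t x - flow \<theta> \<eta> 0 x - (t - 0) *\<^sub>R B \<theta> \<eta> x) \<le> Ct * n\<^sup>2 * t * (t - 0)"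
  proof (rule absolutely_continuous_curve_bound[OF flow_AC[OF d x]])
    have "norm (vel \<theta> \<eta> r (flow \<theta> \<eta> r x) - B \<theta> \<eta> x) \<le> Ct * n\<^sup>2 * t" if r: "r \<in> {0..t}" for r
      using second[of r] r mult_left_mono[of r t "Ct * n\<^sup>2"] Ct_nonneg by force
    then show "AE r in lborel. r \<in> {0..t} \<longrightarrow> (\<exists>f'. ((\<lambda>t. flow \<theta> \<eta> t x) has_vector_derivative f')
          (at r within {0..1}) \<and> norm (f' - B \<theta> \<eta> x) \<le> Ct * n\<^sup>2 * t)"
      using flow_derivative(1)[OF d x] t by (intro AE_I2) force
  qed (use t Ct_nonneg in auto)
  then show "norm (flow \<theta> \<eta> t x - x - t *\<^sub>R B \<theta> \<eta> x) \<le> Ct * (tnorm M \<theta> \<eta>)\<^sup>2 * t\<^sup>2"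
    using flow_0[OF d x] by (simp add: n_def power2_eq_square mult_ac)
qed

lemma integral_flow:
  fixes f :: "'x \<Rightarrow> 'c::{banach, second_countable_topology}"
  assumes "(\<theta>, \<eta>) \<in> D" "t \<in> {0..1}" "f \<in> borel_measurable borel"
  shows "(\<integral>x. f x \<partial>E (exp_curve M \<theta> \<eta> t)) = (\<integral>x. f (flow \<theta> \<eta> t x) \<partial>base \<theta>)"
  unfolding flow_solution_flow(2)[OF assms(1,2)] by (rule integral_distr[OF flow_measurable[OF assms(1,2)] assms(3)])

lemma integral_base:
  fixes f :: "'x \<Rightarrow> 'c::{banach, second_countable_topology}"
  assumes "\<theta> \<in> S" "f \<in> borel_measurable borel"
  shows "(\<integral>x. f x \<partial>E \<theta>) = (\<integral>x. f x \<partial>base \<theta>)"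
proof -
  have p: "sets (E \<theta>) = sets borel" "space (E \<theta>) = UNIV" using prob_measures_onD[OF E_prob[OF assms(1)]] by auto
  have "(\<integral>x. f x \<partial>base \<theta>) = (\<integral>x. indicator \<Omega> x *\<^sub>R f x \<partial>E \<theta>)"
    unfolding base_def by (rule integral_restrict_space) (use p closed_Om in auto)
  also have "\<dots> = (\<integral>x. f x \<partial>E \<theta>)"
  proof (rule integral_cong_AE)
    have f: "f \<in> borel_measurable (E \<theta>)" using assms(2) p(1) measurable_cong_sets by blast
    then show "f \<in> borel_measurable (E \<theta>)" .
    have "indicator \<Omega> \<in> borel_measurable (E \<theta>)" using p closed_Om by (intro borel_measurable_indicator) auto
    then show "(\<lambda>x. indicator \<Omega> x *\<^sub>R f x) \<in> borel_measurable (E \<theta>)" using f by measurable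
    show "AE x in E \<theta>. indicator \<Omega> x *\<^sub>R f x = f x"
      using prob_measures_on_AE[OF E_prob[OF assms(1)] closed_Om] by eventually_elim simp
  qed
  finally show ?thesis ..
qed

lemma integrable_flow:
  fixes f :: "'x \<Rightarrow> 'c::{banach, second_countable_topology}"
  assumes "(\<theta>, \<eta>) \<in> D" "t \<in> {0..1}" "continuous_on UNIV f"
  shows "integrable (base \<theta>) (\<lambda>x. f (flow \<theta> \<eta> t x))"
proof -
  have "integrable (E (exp_curve M \<theta> \<eta> t)) f"
    using exp_curve_tangent[OF assms(1,2)] by (intro integrable_continuous_prob_measures_on[OF Om E_prob assms(3)])
  then show ?thesis
    unfolding flow_solution_flow(2)[OF assms(1,2)]
    using integrable_distr_eq[OF flow_measurable[OF assms(1,2)] borel_measurable_continuous_onI[OF assms(3)]] by blast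
qed

lemma flow_AE_in: 
  assumes "(\<theta>, \<eta>) \<in> D" "t \<in> {0..1}"
  shows "AE x in base \<theta>. flow \<theta> \<eta> t x \<in> \<Omega>"
proof -
  have "AE x in distr (base \<theta>) borel (flow \<theta> \<eta> t). x \<in> \<Omega>"
    using prob_measures_on_AE[OF E_prob[OF exp_curve_tangent(1)[OF assms]] closed_Om]
    unfolding flow_solution_flow(2)[OF assms] .
  moreover have "{x \<in> space borel. x \<in> \<Omega>} \<in> sets borel" using closed_Om by auto
  ultimately show ?thesis using AE_distr_iff[OF flow_measurable[OF assms], where P = "\<lambda>x. x \<in> \<Omega>"] by blast
qed

end


section \<open>Lower bounds for the energy\<close>

lemma set_integral_prob_measures_on:
  fixes f :: "'x::euclidean_space \<Rightarrow> 'c::{banach, second_countable_topology}"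
  assumes m: "\<mu> \<in> prob_measures_on \<Omega>" and "closed \<Omega>" and f: "f \<in> borel_measurable borel"
  shows "(LINT x:\<Omega>|\<mu>. f x) = (\<integral>x. f x \<partial>\<mu>)"
  unfolding set_lebesgue_integral_def
proof (rule integral_cong_AE)
  note p = prob_measures_onD[OF m]
  have fm: "f \<in> borel_measurable \<mu>" using f p(1) measurable_cong_sets by blast
  then show "f \<in> borel_measurable \<mu>" .
  have "indicator \<Omega> \<in> borel_measurable \<mu>" using p \<open>closed \<Omega>\<close> by (intro borel_measurable_indicator) auto
  then show "(\<lambda>x. indicator \<Omega> x *\<^sub>R f x) \<in> borel_measurable \<mu>" using fm by measurable
  show "AE x in \<mu>. indicator \<Omega> x *\<^sub>R f x = f x"
    using prob_measures_on_AE[OF m \<open>closed \<Omega>\<close>] by eventually_elim simp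
qed

lemma set_integrable_continuous_prob_measures_on:
  fixes f :: "'x::euclidean_space \<Rightarrow> 'c::{banach, second_countable_topology}"
  assumes m: "\<mu> \<in> prob_measures_on \<Omega>" and \<Omega>: "compact \<Omega>" and f: "continuous_on \<Omega> f"
  shows "set_integrable \<mu> \<Omega> f"
  unfolding set_integrable_def
proof -
  note D = prob_measures_onD[OF m]
  interpret finite_measure \<mu> by (rule D)
  have "(\<lambda>x. indicator \<Omega> x *\<^sub>R f x) \<in> borel_measurable borel"
    using f compact_imp_closed[OF \<Omega>] by (intro borel_measurable_continuous_on_indicator) auto
  then have meas: "(\<lambda>x. indicator \<Omega> x *\<^sub>R f x) \<in> borel_measurable \<mu>" using D(1) measurable_cong_sets by blast
  obtain b where b: "\<And>x. x \<in> \<Omega> \<Longrightarrow> norm (f x) \<le> b"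
    using compact_imp_bounded[OF compact_continuous_image[OF f \<Omega>]] by (auto simp: bounded_iff)
  show "integrable \<mu> (\<lambda>x. indicator \<Omega> x *\<^sub>R f x)"
  proof (rule integrable_const_bound[OF _ meas])
    show "AE x in \<mu>. norm (indicator \<Omega> x *\<^sub>R f x) \<le> \<bar>b\<bar>"
      using b by (intro AE_I2) (force simp: indicator_def)
  qed
qed

lemma integral_nonpos_real:
  fixes f :: "'a \<Rightarrow> real"
  assumes "\<And>x. f x \<le> 0"
  shows "(\<integral>x. f x \<partial>M) \<le> 0"
  using integral_mono'[of M "\<lambda>_. 0" f] assms by simp

lemma ennreal_integral_le_nn_integral:
  fixes f :: "'a \<Rightarrow> real"
  assumes f: "integrable M f" and le: "\<And>x. ennreal (f x) \<le> g x"
  shows "ennreal (\<integral>x. f x \<partial>M) \<le> (\<integral>\<^sup>+x. g x \<partial>M)"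
proof -
  \<comment> \<open>\<open>f\<close> may be negative where \<open>ennreal\<close> gives 0; the
    positive part bridges the two kinds of integral.\<close>
  have "(\<integral>x. f x \<partial>M) \<le> (\<integral>x. max 0 (f x) \<partial>M)" using f by (intro integral_mono) auto
  then have "ennreal (\<integral>x. f x \<partial>M) \<le> ennreal (\<integral>x. max 0 (f x) \<partial>M)" by (rule ennreal_leI)
  also have "\<dots> = (\<integral>\<^sup>+x. ennreal (max 0 (f x)) \<partial>M)"
    using f by (intro nn_integral_eq_integral[symmetric]) auto
  also have "\<dots> \<le> (\<integral>\<^sup>+x. g x \<partial>M)"
    using le by (intro nn_integral_mono) (simp add: max_def ennreal_neg)
  finally show ?thesis .
qed

text \<open>If the momentum term is not integrable in time, its integral is \<open>0\<close> by convention. The bound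
  survives because the other term is nonpositive.\<close>

lemma hamilton_jacobi_lower_bound:
  fixes \<Omega> :: "'x::euclidean_space set"
  assumes \<Omega>: "compact \<Omega>" and \<phi>: "C1_test_function \<Omega> \<phi> \<phi>t \<phi>x"
    and HJ: "\<And>t x. t \<in> {0..1} \<Longrightarrow> x \<in> \<Omega> \<Longrightarrow> \<phi>t (t, x) + (norm (\<phi>x (t, x)))\<^sup>2 / 2 \<le> 0"
    and \<rho>: "\<And>t. t \<in> {0..1} \<Longrightarrow> \<rho> t \<in> prob_measures_on \<Omega>"
    and int: "set_integrable lborel {0..1} (\<lambda>t. LINT x:\<Omega>|\<rho> t. \<phi>t (t, x))"
  shows "ennreal (2 * ((LINT x:\<Omega>|\<rho> 1. \<phi> (1, x)) - (LINT x:\<Omega>|\<rho> 0. \<phi> (0, x)))) \<le> energy \<Omega> \<rho>"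
  unfolding energy_def
proof (rule INF_greatest)
  fix v assume v: "v \<in> CE \<Omega> \<rho>"
  define a where "a t = (LINT x:\<Omega>|\<rho> t. \<phi>t (t, x))" for t
  define b where "b t = (LINT x:\<Omega>|\<rho> t. \<phi>x (t, x) \<bullet> v t x)" for t
  define N where "N t = (L2_norm_of (\<rho> t) (v t))\<^sup>2" for t
  have eq: "(LINT t:{0..1}|lborel. a t) + (LINT t:{0..1}|lborel. b t)
      = (LINT x:\<Omega>|\<rho> 1. \<phi> (1, x)) - (LINT x:\<Omega>|\<rho> 0. \<phi> (0, x))"
    using v[unfolded CE_def mem_Collect_eq, THEN conjunct2, THEN conjunct2, THEN spec, THEN spec, THEN spec, THEN mp, OF \<phi>]
    unfolding a_def b_def .
  have vi: "integrable (\<rho> t) (\<lambda>x. (norm (v t x))\<^sup>2)" if "t \<in> {0..1}" for t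
    by (rule bspec[OF v[unfolded CE_def mem_Collect_eq, THEN conjunct2, THEN conjunct1] that])
  have ct: "continuous_on \<Omega> (\<lambda>x. \<phi>t (t, x))" if "t \<in> {0..1}" for t
  proof -
    have "continuous_on ({0..1} \<times> \<Omega>) \<phi>t" using \<phi> by (simp add: C1_test_function_def)
    then show ?thesis
      by (rule continuous_on_compose2) (use that in \<open>auto intro!: continuous_intros\<close>)
  qed
  have a0: "a t \<le> 0" if t: "t \<in> {0..1}" for t
  proof -
    have "\<phi>t (t, x) \<le> 0" if "x \<in> \<Omega>" for x
      using HJ[OF t that] zero_le_power2[of "norm (\<phi>x (t, x))"] by linarith
    then show ?thesis unfolding a_def set_lebesgue_integral_def
      by (intro integral_nonpos_real) (auto simp: indicator_def)
  qed
  \<comment> \<open>Young's inequality for \<open>\<phi>x \<bullet> v\<close>, followed by the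
    Hamilton-Jacobi inequality.\<close>
  have ab: "2 * (a t + b t) \<le> N t" if t: "t \<in> {0..1}" for t
  proof -
    have i1: "integrable (\<rho> t) (\<lambda>x. indicator \<Omega> x *\<^sub>R \<phi>t (t, x))"
      using set_integrable_continuous_prob_measures_on[OF \<rho>[OF t] \<Omega> ct[OF t]] by (simp add: set_integrable_def)
    have "b t \<le> (\<integral>x. - (indicator \<Omega> x *\<^sub>R \<phi>t (t, x)) + (norm (v t x))\<^sup>2 / 2 \<partial>\<rho> t)"
      unfolding b_def set_lebesgue_integral_def
    \<comment> \<open>This rule asks for integrability of the majorant alone, and in exchange for
      its nonnegativity, which the sign of \<open>\<phi>t\<close> provides.\<close>
    proof (rule integral_mono')
      show "integrable (\<rho> t) (\<lambda>x. - (indicator \<Omega> x *\<^sub>R \<phi>t (t, x)) + (norm (v t x))\<^sup>2 / 2)"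
        using i1 vi[OF t] by (intro Bochner_Integration.integrable_add integrable_minus integrable_divide)
      fix x
      have *: "0 \<le> - \<phi>t (t, x)" "\<phi>x (t, x) \<bullet> v t x \<le> - \<phi>t (t, x) + (norm (v t x))\<^sup>2 / 2" if "x \<in> \<Omega>"
      proof -
        have "0 \<le> (norm (\<phi>x (t, x) - v t x))\<^sup>2" by simp
        also have "\<dots> = (norm (\<phi>x (t, x)))\<^sup>2 + (norm (v t x))\<^sup>2 - 2 * (\<phi>x (t, x) \<bullet> v t x)"
          by (simp add: power2_norm_eq_inner inner_diff inner_commute)
        finally show "\<phi>x (t, x) \<bullet> v t x \<le> - \<phi>t (t, x) + (norm (v t x))\<^sup>2 / 2" "0 \<le> - \<phi>t (t, x)"
          using HJ[OF t that] zero_le_power2[of "norm (\<phi>x (t, x))"] by linarith+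
      qed
      show "indicator \<Omega> x *\<^sub>R (\<phi>x (t, x) \<bullet> v t x) \<le> - (indicator \<Omega> x *\<^sub>R \<phi>t (t, x)) + (norm (v t x))\<^sup>2 / 2"
        "0 \<le> - (indicator \<Omega> x *\<^sub>R \<phi>t (t, x)) + (norm (v t x))\<^sup>2 / 2"
      proof -
        have 0: "0 \<le> (norm (v t x))\<^sup>2 / 2" by simp
        show "indicator \<Omega> x *\<^sub>R (\<phi>x (t, x) \<bullet> v t x) \<le> - (indicator \<Omega> x *\<^sub>R \<phi>t (t, x)) + (norm (v t x))\<^sup>2 / 2"
          using * 0 by (cases "x \<in> \<Omega>") simp_all
        have "0 \<le> - (indicator \<Omega> x *\<^sub>R \<phi>t (t, x))" using *(1) by (cases "x \<in> \<Omega>") simp_all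
        then show "0 \<le> - (indicator \<Omega> x *\<^sub>R \<phi>t (t, x)) + (norm (v t x))\<^sup>2 / 2"
          using 0 by (rule add_nonneg_nonneg)
      qed
    qed
    also have "\<dots> = - a t + N t / 2"
      using i1 vi[OF t] unfolding a_def N_def set_lebesgue_integral_def L2_norm_of_def by simp
    finally show ?thesis by simp
  qed
  show "ennreal (2 * ((LINT x:\<Omega>|\<rho> 1. \<phi> (1, x)) - (LINT x:\<Omega>|\<rho> 0. \<phi> (0, x))))
      \<le> (\<integral>\<^sup>+t\<in>{0..1}. ennreal ((L2_norm_of (\<rho> t) (v t))\<^sup>2) \<partial>lborel)"
  proof (cases "set_integrable lborel {0..1} b")
    case True
    have i: "integrable lborel (\<lambda>t. indicator {0..1} t *\<^sub>R (2 * (a t + b t)))"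
    proof -
      have "integrable lborel (\<lambda>t. 2 * (indicator {0..1} t *\<^sub>R a t) + 2 * (indicator {0..1} t *\<^sub>R b t))"
        using True int unfolding set_integrable_def a_def[symmetric]
        by (intro Bochner_Integration.integrable_add integrable_mult_right)
      then show ?thesis by (simp add: algebra_simps)
    qed
    have "ennreal (\<integral>t. indicator {0..1} t *\<^sub>R (2 * (a t + b t)) \<partial>lborel)
        \<le> (\<integral>\<^sup>+t. ennreal (N t) * indicator {0..1} t \<partial>lborel)"
      using ab by (intro ennreal_integral_le_nn_integral i) (auto simp: indicator_def intro: ennreal_leI)
    moreover have "(\<integral>t. indicator {0..1} t *\<^sub>R (2 * (a t + b t)) \<partial>lborel)
        = 2 * ((LINT t:{0..1}|lborel. a t) + (LINT t:{0..1}|lborel. b t))"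
    proof -
      have "(\<integral>t. indicator {0..1} t *\<^sub>R a t + indicator {0..1} t *\<^sub>R b t \<partial>lborel)
          = (\<integral>t. indicator {0..1} t *\<^sub>R a t \<partial>lborel) + (\<integral>t. indicator {0..1} t *\<^sub>R b t \<partial>lborel)"
        using True int unfolding set_integrable_def a_def[symmetric] by (intro Bochner_Integration.integral_add)
      moreover have "(\<integral>t. indicator {0..1} t *\<^sub>R (2 * (a t + b t)) \<partial>lborel)
          = 2 * (\<integral>t. indicator {0..1} t *\<^sub>R a t + indicator {0..1} t *\<^sub>R b t \<partial>lborel)"
        by (subst integral_mult_right_zero[symmetric]) (simp add: algebra_simps)
      ultimately show ?thesis by (simp add: set_lebesgue_integral_def)
    qed
    ultimately show ?thesis by (simp add: eq N_def)
  next
    case False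
    then have "(LINT t:{0..1}|lborel. b t) = 0"
      unfolding set_integrable_def set_lebesgue_integral_def by (rule not_integrable_integral_eq)
    moreover have "(LINT t:{0..1}|lborel. a t) \<le> 0"
      using a0 unfolding set_lebesgue_integral_def
      by (intro integral_nonpos_real) (auto simp: indicator_def)
    ultimately show ?thesis using eq by (simp add: ennreal_neg)
  qed
qed

lemma GDERIV_has_derivative:
  assumes "GDERIV \<psi> x :> d"
  shows "(\<psi> has_derivative (\<bullet>) d) (at x)"
proof -
  have "(\<bullet>) d = (\<lambda>h. h \<bullet> d)" by (rule ext) (rule inner_commute)
  then show ?thesis using assms by (simp add: gderiv_def)
qed

text \<open>A mean value estimate along the segment. Integrating along it would give K / 2; the
  cruder K only affects later constants.\<close>

lemma gradient_taylor:
  fixes w :: "'x::euclidean_space \<Rightarrow> 'x"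
  assumes g: "\<And>x. GDERIV \<psi> x :> w x" and L: "\<And>x y. norm (w x - w y) \<le> K * norm (x - y)" and "0 \<le> K"
  shows "\<bar>\<psi> y - \<psi> x - w x \<bullet> (y - x)\<bar> \<le> K * (norm (y - x))\<^sup>2"
proof -
  have "norm (\<psi> y - \<psi> x - w x \<bullet> (y - x)) \<le> norm (y - x) * (K * norm (y - x))"
  proof (rule differentiable_bound_linearization[of x y "closed_segment x y" \<psi> "\<lambda>x h. w x \<bullet> h" x])
    show "(\<psi> has_derivative (\<bullet>) (w z)) (at z within closed_segment x y)" for z
      by (rule has_derivative_at_withinI[OF GDERIV_has_derivative[OF g]])
    show "x + s *\<^sub>R (y - x) \<in> closed_segment x y" if "s \<in> {0..1}" for s
    proof -
      have *: "x + s *\<^sub>R (y - x) = (1 - s) *\<^sub>R x + s *\<^sub>R y" by (simp add: algebra_simps)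
      show ?thesis unfolding * in_segment using that by (intro exI[of _ s] conjI refl) simp_all
    qed
    fix z assume "z \<in> closed_segment x y"
    then have "norm (z - x) \<le> norm (y - x)" by (rule segment_bound1)
    then have "K * norm (z - x) \<le> K * norm (y - x)" using \<open>0 \<le> K\<close> by (rule mult_left_mono)
    then have le: "norm (w z - w x) \<le> K * norm (y - x)" using L[of z x] by linarith
    have "onorm (\<lambda>h. w z \<bullet> h - w x \<bullet> h) \<le> K * norm (y - x)"
    proof (rule onorm_bound)
      fix h
      have "norm (w z \<bullet> h - w x \<bullet> h) = \<bar>(w z - w x) \<bullet> h\<bar>"
        by (simp add: inner_diff_left)
      also have "\<dots> \<le> norm (w z - w x) * norm h" by (rule Cauchy_Schwarz_ineq2)
      also have "\<dots> \<le> K * norm (y - x) * norm h" using le by (rule mult_right_mono) simp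
      finally show "norm (w z \<bullet> h - w x \<bullet> h) \<le> K * norm (y - x) * norm h" .
    qed (use \<open>0 \<le> K\<close> in simp)
    then show "onorm ((\<bullet>) (w z) - (\<bullet>) (w x)) \<le> K * norm (y - x)" by (simp add: fun_diff_def)
  qed simp
  then show ?thesis by (simp add: power2_eq_square mult_ac)
qed

lemma GDERIV_continuous_on:
  assumes "\<And>x. GDERIV \<psi> x :> w x"
  shows "continuous_on UNIV \<psi>"
  using assms by (auto simp: continuous_on_eq_continuous_at gderiv_def intro: has_derivative_continuous)

text \<open>Supplies the integrability in time that the Hamilton-Jacobi bound demands: Lipschitz
  functions have integrals that are Lipschitz along a W2-Lipschitz curve.\<close>

lemma continuous_on_integral_W2_lipschitz_curve:
  fixes q :: "'x::euclidean_space \<Rightarrow> real"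
  assumes \<Omega>: "compact \<Omega>" and L: "\<Lambda> \<subseteq> prob_measures_on \<Omega>" and \<rho>: "lipschitz_curve W2 \<Lambda> \<rho>"
    and "0 < K" and q: "\<And>x y. \<bar>q x - q y\<bar> \<le> K * norm (x - y)"
  shows "continuous_on {0..1} (\<lambda>t. \<integral>x. q x \<partial>\<rho> t)"
proof -
  obtain l where l: "\<And>s t. s \<in> {0..1} \<Longrightarrow> t \<in> {0..1} \<Longrightarrow> W2 (\<rho> s) (\<rho> t) \<le> l * \<bar>s - t\<bar>"
    and sub: "\<rho> ` {0..1} \<subseteq> \<Lambda>" using \<rho> unfolding lipschitz_curve_def by blast
  have "(K * \<bar>l\<bar>)-lipschitz_on {0..1} (\<lambda>t. \<integral>x. q x \<partial>\<rho> t)"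
  proof (rule lipschitz_onI)
    fix s t :: real assume st: "s \<in> {0..1}" "t \<in> {0..1}"
    have "\<bar>(\<integral>x. q x \<partial>\<rho> s) - (\<integral>x. q x \<partial>\<rho> t)\<bar> \<le> K * W2 (\<rho> s) (\<rho> t)"
      using st sub L by (intro lipschitz_integral_diff_le_W2[OF \<Omega> _ _ \<open>0 < K\<close> q]) blast+
    also have "W2 (\<rho> s) (\<rho> t) \<le> \<bar>l\<bar> * \<bar>s - t\<bar>"
      using l[OF st] by (meson abs_ge_self abs_ge_zero mult_right_mono order_trans)
    finally show "dist (\<integral>x. q x \<partial>\<rho> s) (\<integral>x. q x \<partial>\<rho> t) \<le> K * \<bar>l\<bar> * dist s t"
      using \<open>0 < K\<close> by (simp add: dist_real_def mult.assoc)
  qed (use \<open>0 < K\<close> in simp)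
  then show ?thesis by (rule lipschitz_on_continuous_on)
qed

text \<open>The test function is the subsolution \<open>t \<psi> - s c t\<^sup>2 |w|\<^sup>2 / 2\<close> of the Hamilton-Jacobi equation
  in the time \<open>s\<close>. The factor \<open>c = 1 + 4 t K\<close> absorbs the change of \<open>w\<close> along characteristics
  with an error proportional to \<open>|w|\<^sup>2\<close>.\<close>

lemma energy_lower_bound_gradient:
  fixes w :: "'x::euclidean_space \<Rightarrow> 'x"
  assumes \<Omega>: "compact \<Omega>" and \<Lambda>: "\<Lambda> \<subseteq> prob_measures_on \<Omega>" and \<rho>: "lipschitz_curve W2 \<Lambda> \<rho>"
    and g: "\<And>x. GDERIV \<psi> x :> w x" and C1: "\<And>x. w differentiable (at x)"
      "\<And>h. continuous_on UNIV (\<lambda>x. frechet_derivative w (at x) h)"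
    and w: "\<And>x. norm (w x) \<le> K" "\<And>x. onorm (frechet_derivative w (at x)) \<le> K"
      "\<And>x y. norm (w x - w y) \<le> K * norm (x - y)"
    and "0 \<le> t" and u: "t * K \<le> 1 / 10" and c_def: "c = 1 + 4 * (t * K)"
  shows "ennreal (2 * ((\<integral>x. t * \<psi> x - c * t\<^sup>2 * (norm (w x))\<^sup>2 / 2 \<partial>\<rho> 1) - (\<integral>x. t * \<psi> x \<partial>\<rho> 0)))
    \<le> energy \<Omega> \<rho>"
proof -
  have K: "0 \<le> K" using w(1) by (meson norm_ge_zero order_trans)
  have tK: "0 \<le> t * K" using \<open>0 \<le> t\<close> K by simp
  have c: "1 \<le> c" using tK c_def by simp
  \<comment> \<open>\<open>g'\<close> is the gradient of |w|^2 / 2, that is, the transposed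
    derivative of \<open>w\<close> applied to \<open>w\<close>.\<close>
  define g' where "g' x = (\<Sum>b\<in>Basis. (w x \<bullet> frechet_derivative w (at x) b) *\<^sub>R b)" for x
  define \<phi> where "\<phi> z = t * \<psi> (snd z) - fst z * (c * t\<^sup>2 * (norm (w (snd z)))\<^sup>2 / 2)" for z
  define \<phi>t where "\<phi>t z = - (c * t\<^sup>2 * (norm (w (snd z)))\<^sup>2 / 2)" for z :: "real \<times> 'x"
  define \<phi>x where "\<phi>x z = t *\<^sub>R w (snd z) - (fst z * c * t\<^sup>2) *\<^sub>R g' (snd z)" for z
  have Dw: "(w has_derivative frechet_derivative w (at x)) (at x)" for x
    using C1(1) frechet_derivative_works by blast
  have g': "g' x \<bullet> h = w x \<bullet> frechet_derivative w (at x) h" for x h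
  proof -
    interpret linear "frechet_derivative w (at x)" by (rule linear_frechet_derivative[OF C1(1)])
    have "frechet_derivative w (at x) h = (\<Sum>b\<in>Basis. (h \<bullet> b) *\<^sub>R frechet_derivative w (at x) b)"
      by (subst euclidean_representation[of h, symmetric]) (simp only: sum scale)
    then show ?thesis by (simp add: g'_def inner_sum_left inner_sum_right inner_commute mult.commute)
  qed
  have g'_le: "norm (g' x) \<le> K * norm (w x)" for x
  proof -
    \<comment> \<open>Testing the identity for \<open>g'\<close> with \<open>g'\<close> itself
      bounds the transpose by the operator norm of the derivative.\<close>
    have "(norm (g' x))\<^sup>2 = w x \<bullet> frechet_derivative w (at x) (g' x)"
      by (simp add: power2_norm_eq_inner g')
    also have "\<dots> \<le> norm (w x) * norm (frechet_derivative w (at x) (g' x))" by (rule norm_cauchy_schwarz)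
    also have "\<dots> \<le> norm (w x) * (K * norm (g' x))"
    proof (rule mult_left_mono)
      have "norm (frechet_derivative w (at x) (g' x)) \<le> onorm (frechet_derivative w (at x)) * norm (g' x)"
      by (rule onorm[OF has_derivative_bounded_linear[OF Dw]])
      also have "\<dots> \<le> K * norm (g' x)" by (rule mult_right_mono[OF w(2)]) simp
      finally show "norm (frechet_derivative w (at x) (g' x)) \<le> K * norm (g' x)" .
    qed simp
    finally have "norm (g' x) * norm (g' x) \<le> K * norm (w x) * norm (g' x)"
      by (simp add: power2_eq_square mult_ac)
    then show ?thesis using K by (cases "norm (g' x) = 0") (auto dest: mult_right_le_imp_le)
  qed
  have cw: "continuous_on UNIV w"
    using C1(1) by (auto simp: continuous_on_eq_continuous_at differentiable_imp_continuous_within)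
  have cg: "continuous_on UNIV g'" unfolding g'_def by (intro continuous_intros cw C1(2))
  have c\<psi>: "continuous_on UNIV \<psi>" by (rule GDERIV_continuous_on[OF g])
  have test: "C1_test_function \<Omega> \<phi> \<phi>t \<phi>x"
    unfolding C1_test_function_def
  proof (intro conjI ballI)
    have s: "continuous_on X (\<lambda>z::real\<times>'x. w (snd z))" "continuous_on X (\<lambda>z::real\<times>'x. g' (snd z))" for X
      by (auto intro!: continuous_on_compose2[OF cw] continuous_on_compose2[OF cg] continuous_intros)
    show "continuous_on ({0..1} \<times> \<Omega>) \<phi>t" unfolding \<phi>t_def by (intro continuous_intros s) auto
    show "continuous_on ({0..1} \<times> \<Omega>) \<phi>x" unfolding \<phi>x_def by (intro continuous_intros s)
    fix z :: "real \<times> 'x"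
    have 0: "((\<lambda>z::real \<times> 'x. snd z) has_derivative snd) (at z within {0..1} \<times> \<Omega>)"
      by (rule has_derivative_snd[OF has_derivative_ident])
    have "(\<psi> has_derivative (\<bullet>) (w (snd z))) (at (snd z))"
      by (rule GDERIV_has_derivative[OF g])
    from has_derivative_compose[OF 0 this]
    have 1: "((\<lambda>z. \<psi> (snd z)) has_derivative (\<lambda>h. w (snd z) \<bullet> snd h)) (at z within {0..1} \<times> \<Omega>)" .
    have 2: "((\<lambda>z. w (snd z)) has_derivative (\<lambda>h. frechet_derivative w (at (snd z)) (snd h))) (at z within {0..1} \<times> \<Omega>)"
      by (rule has_derivative_compose[OF 0 Dw])
    have 3: "((\<lambda>z::real \<times> 'x. fst z) has_derivative fst) (at z within {0..1} \<times> \<Omega>)"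
      by (rule has_derivative_fst[OF has_derivative_ident])
    let ?k = "c * t\<^sup>2 / 2" and ?w = "w (snd z)"
    let ?D = "\<lambda>h. frechet_derivative w (at (snd z)) (snd h)"
    have "((\<lambda>z::real \<times> 'x. t * \<psi> (snd z) - fst z * (?k * (w (snd z) \<bullet> w (snd z)))) has_derivative
        (\<lambda>h. t * (?w \<bullet> snd h) - (fst z * (?k * (?w \<bullet> ?D h + ?D h \<bullet> ?w)) + fst h * (?k * (?w \<bullet> ?w)))))
        (at z within {0..1} \<times> \<Omega>)"
      by (rule has_derivative_diff[OF has_derivative_mult_right[OF 1]
            has_derivative_mult[OF 3 has_derivative_mult_right[OF has_derivative_inner[OF 2 2]]]])
    moreover have "(\<lambda>z::real \<times> 'x. t * \<psi> (snd z) - fst z * (?k * (w (snd z) \<bullet> w (snd z)))) = \<phi>"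
      by (simp add: fun_eq_iff \<phi>_def power2_norm_eq_inner)
    moreover have "(\<lambda>h. t * (?w \<bullet> snd h) - (fst z * (?k * (?w \<bullet> ?D h + ?D h \<bullet> ?w)) + fst h * (?k * (?w \<bullet> ?w))))
        = (\<lambda>(s, h). \<phi>t z * s + \<phi>x z \<bullet> h)"
      by (auto simp: fun_eq_iff \<phi>t_def \<phi>x_def g' inner_diff_left power2_norm_eq_inner
          inner_commute[of "frechet_derivative w (at (snd z)) _"])
    ultimately show "(\<phi> has_derivative (\<lambda>(s, h). \<phi>t z * s + \<phi>x z \<bullet> h)) (at z within {0..1} \<times> \<Omega>)"
      by simp
  qed
  have HJ: "\<phi>t (s, x) + (norm (\<phi>x (s, x)))\<^sup>2 / 2 \<le> 0" if s: "s \<in> {0..1}" for s x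
  proof -
    have "norm (\<phi>x (s, x)) \<le> norm (t *\<^sub>R w x) + norm ((s * c * t\<^sup>2) *\<^sub>R g' x)"
      unfolding \<phi>x_def fst_conv snd_conv by (rule norm_triangle_ineq4)
    also have "\<dots> = t * norm (w x) + s * (c * t\<^sup>2 * norm (g' x))"
      using s c \<open>0 \<le> t\<close> by (simp add: abs_mult)
    also have "s * (c * t\<^sup>2 * norm (g' x)) \<le> 1 * (c * t\<^sup>2 * norm (g' x))"
      using s c by (intro mult_right_mono) auto
    also have "1 * (c * t\<^sup>2 * norm (g' x)) \<le> c * t\<^sup>2 * (K * norm (w x))"
      using c g'_le[of x] by (simp add: mult_left_mono)
    finally have "norm (\<phi>x (s, x)) \<le> (1 + c * (t * K)) * (t * norm (w x))"
      by (simp add: algebra_simps power2_eq_square)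
    then have "(norm (\<phi>x (s, x)))\<^sup>2 \<le> (1 + c * (t * K))\<^sup>2 * (t * norm (w x))\<^sup>2"
      using power_mono[of "norm (\<phi>x (s, x))" "(1 + c * (t * K)) * (t * norm (w x))" 2] by (simp add: power_mult_distrib)
    \<comment> \<open>With \<open>r = t * K\<close> the square is 1 + 2 r plus terms in r^2, r^3 and
      r^4. For r \<le> 1/10 these total less than r, so \<open>c = 1 + 4 * r\<close> leaves
      room.\<close>
    also have "(1 + c * (t * K))\<^sup>2 \<le> c"
    proof -
      define r where "r = t * K"
      have r: "0 \<le> r" "r \<le> 1 / 10" using tK u by (auto simp: r_def)
      have "r * r \<le> r * (1/10)" "r * r * r \<le> r * (1/10) * (1/10)" "r*r*r*r \<le> r * (1/10) * (1/10) * (1/10)"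
        using r by (intro mult_mono; simp)+
      moreover have "(1 + c * r)\<^sup>2 = 1 + 2 * r + 9 * (r*r) + 8 * (r*r*r) + 16 * (r*r*r*r)"
        unfolding c_def r_def[symmetric] by (simp add: power2_eq_square algebra_simps)
      ultimately have "(1 + c * r)\<^sup>2 \<le> 1 + 4 * r" using r by simp
      then show ?thesis by (simp add: c_def r_def)
    qed
    finally show ?thesis using c by (simp add: \<phi>t_def mult_right_mono power_mult_distrib)
  qed
  have \<rho>p: "\<rho> s \<in> prob_measures_on \<Omega>" if "s \<in> {0..1}" for s
    using \<rho> \<Lambda> that unfolding lipschitz_curve_def by blast
  have cl: "closed \<Omega>" by (rule compact_imp_closed[OF \<Omega>])
  have le: "ennreal (2 * ((LINT x:\<Omega>|\<rho> 1. \<phi> (1, x)) - (LINT x:\<Omega>|\<rho> 0. \<phi> (0, x)))) \<le> energy \<Omega> \<rho>"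
  proof (rule hamilton_jacobi_lower_bound[OF \<Omega> test HJ \<rho>p])
    \<comment> \<open>The summand 1 keeps the Lipschitz constant positive when
      \<open>K = 0\<close>.\<close>
    have q: "\<bar>(norm (w x))\<^sup>2 - (norm (w y))\<^sup>2\<bar> \<le> (2 * K\<^sup>2 + 1) * norm (x - y)" for x y
    proof -
      have "\<bar>(norm (w x))\<^sup>2 - (norm (w y))\<^sup>2\<bar> = \<bar>norm (w x) - norm (w y)\<bar> * (norm (w x) + norm (w y))"
        by (simp add: power2_eq_square square_diff_square_factored abs_mult mult.commute)
      also have "\<dots> \<le> (K * norm (x - y)) * (K + K)"
        using w(1)[of x] w(1)[of y] w(3)[of x y] K norm_triangle_ineq3[of "w x" "w y"]
        by (intro mult_mono add_mono) auto
      also have "\<dots> \<le> (2 * K\<^sup>2 + 1) * norm (x - y)" by (simp add: algebra_simps power2_eq_square)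
      finally show ?thesis .
    qed
    have "continuous_on {0..1} (\<lambda>s. \<integral>x. (norm (w x))\<^sup>2 \<partial>\<rho> s)"
      by (rule continuous_on_integral_W2_lipschitz_curve[OF \<Omega> \<Lambda> \<rho> _ q]) (simp add: add_nonneg_pos)
    then have cont: "continuous_on {0..1} (\<lambda>s. - (c * t\<^sup>2 / 2) * (\<integral>x. (norm (w x))\<^sup>2 \<partial>\<rho> s))"
      by (intro continuous_intros)
    have eq: "(LINT x:\<Omega>|\<rho> s. \<phi>t (s, x)) = - (c * t\<^sup>2 / 2) * (\<integral>x. (norm (w x))\<^sup>2 \<partial>\<rho> s)"
      if "s \<in> {0..1}" for s
    proof -
      have "(\<lambda>x. \<phi>t (s, x)) \<in> borel_measurable borel"
        unfolding \<phi>t_def by (auto intro!: borel_measurable_continuous_onI continuous_intros cw)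
      from set_integral_prob_measures_on[OF \<rho>p[OF that] cl this]
      have "(LINT x:\<Omega>|\<rho> s. \<phi>t (s, x)) = (\<integral>x. - (c * t\<^sup>2 / 2) * (norm (w x))\<^sup>2 \<partial>\<rho> s)" by (simp add: \<phi>t_def)
      then show ?thesis by (simp only: integral_mult_right_zero)
    qed
    have "continuous_on {0..1} (\<lambda>s. LINT x:\<Omega>|\<rho> s. \<phi>t (s, x))"
      by (rule continuous_on_eq[OF cont]) (rule eq[symmetric])
    then show "set_integrable lborel {0..1} (\<lambda>s. LINT x:\<Omega>|\<rho> s. \<phi>t (s, x))"
      by (rule borel_integrable_atLeastAtMost')
  qed
  have eq: "(LINT x:\<Omega>|\<rho> s. \<phi> (s, x)) = (\<integral>x. \<phi> (s, x) \<partial>\<rho> s)" if "s \<in> {0..1}" for s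
    by (rule set_integral_prob_measures_on[OF \<rho>p[OF that] cl])
      (auto simp: \<phi>_def intro!: borel_measurable_continuous_onI continuous_intros cw c\<psi>)
  have "(LINT x:\<Omega>|\<rho> 1. \<phi> (1, x)) = (\<integral>x. \<phi> (1, x) \<partial>\<rho> 1)" by (rule eq) simp
  moreover have "(LINT x:\<Omega>|\<rho> 0. \<phi> (0, x)) = (\<integral>x. \<phi> (0, x) \<partial>\<rho> 0)" by (rule eq) simp
  ultimately show ?thesis using le by (simp only:) (simp add: \<phi>_def)
qed

text \<open>The pointwise counterpart of the near optimality of the map \<open>x \<mapsto> x + t w\<close>.\<close>

lemma gradient_cost_lower_bound:
  fixes w :: "'x::euclidean_space \<Rightarrow> 'x"
  assumes g: "\<And>x. GDERIV \<psi> x :> w x" and L: "\<And>x y. norm (w x - w y) \<le> K * norm (x - y)" and "0 \<le> K"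
    and "0 \<le> t" and u: "t * K \<le> 1 / 10" and c_def: "c = 1 + 4 * (t * K)" and "norm (y - x - t *\<^sub>R w y) \<le> \<epsilon>"
  shows "(1 - 10 * (t * K)) * (norm (y - x))\<^sup>2 - 2 * \<epsilon>\<^sup>2
    \<le> 2 * (t * \<psi> y - c * t\<^sup>2 * (norm (w y))\<^sup>2 / 2 - t * \<psi> x)"
proof -
  define d e r where "d = y - x" and "e = y - x - t *\<^sub>R w y" and "r = t * K"
  have r: "0 \<le> r" "r \<le> 1 / 10" using assms by (auto simp: r_def)
  \<comment> \<open>The expansion is at the arrival point \<open>y\<close>, because the |w|^2 term
    of the test function at the final time is evaluated there.\<close>
  have "\<bar>\<psi> x - \<psi> y - w y \<bullet> (x - y)\<bar> \<le> K * (norm (x - y))\<^sup>2"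
    by (rule gradient_taylor[OF g L \<open>0 \<le> K\<close>])
  then have "w y \<bullet> d - K * (norm d)\<^sup>2 \<le> \<psi> y - \<psi> x"
    by (simp add: d_def norm_minus_commute inner_diff_right)
  then have "t * (w y \<bullet> d - K * (norm d)\<^sup>2) \<le> t * (\<psi> y - \<psi> x)"
    using \<open>0 \<le> t\<close> by (rule mult_left_mono)
  then have 1: "(t *\<^sub>R w y) \<bullet> d - r * (norm d)\<^sup>2 \<le> t * \<psi> y - t * \<psi> x"
    by (simp add: r_def algebra_simps)
  have tw: "t *\<^sub>R w y = d - e" by (simp add: d_def e_def)
  have nw: "t\<^sup>2 * (norm (w y))\<^sup>2 = (norm d)\<^sup>2 - 2 * (d \<bullet> e) + (norm e)\<^sup>2"
  proof -
    have "t\<^sup>2 * (norm (w y))\<^sup>2 = (norm (t *\<^sub>R w y))\<^sup>2" by (simp add: power_mult_distrib)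
    then show ?thesis unfolding tw by (simp add: power2_norm_eq_inner inner_diff inner_commute)
  qed
  have wd: "(t *\<^sub>R w y) \<bullet> d = (norm d)\<^sup>2 - d \<bullet> e" unfolding tw
    by (simp add: power2_norm_eq_inner inner_diff inner_commute)
  \<comment> \<open>At leading order the products \<open>d \<bullet> e\<close> cancel between the
    potential difference and the |w|^2 term. What is left is \<open>8 * r * (d \<bullet> e)\<close>,
    which this inequality absorbs. The factor 10 = 2 + 4 + 4 collects the Taylor error, the excess
    of \<open>c\<close> over 1, and this absorption.\<close>
  have de: "- (2 * (d \<bullet> e)) \<le> (norm d)\<^sup>2 + (norm e)\<^sup>2"
  proof -
    have "0 \<le> (norm (d + e))\<^sup>2" by simp
    then show ?thesis by (simp add: power2_norm_eq_inner inner_add inner_commute)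
  qed
  have "(norm e)\<^sup>2 \<le> \<epsilon>\<^sup>2" using assms(7) by (intro power_mono) (auto simp: e_def)
  have "4 * r * (- (2 * (d \<bullet> e))) \<le> 4 * r * ((norm d)\<^sup>2 + (norm e)\<^sup>2)"
    using de r by (intro mult_left_mono) auto
  then have "- (8 * (r * (d \<bullet> e))) \<le> 4 * (r * (norm d)\<^sup>2) + 4 * (r * (norm e)\<^sup>2)" by (simp add: algebra_simps)
  moreover have "r * (norm e)\<^sup>2 \<le> 1/10 * (norm e)\<^sup>2" using r by (intro mult_right_mono) auto
  moreover have c_r: "c = 1 + 4 * r" by (simp add: c_def r_def)
  then have "c * t\<^sup>2 * (norm (w y))\<^sup>2 = (norm d)\<^sup>2 - 2 * (d \<bullet> e) + (norm e)\<^sup>2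
      + 4 * (r * (norm d)\<^sup>2) - 8 * (r * (d \<bullet> e)) + 4 * (r * (norm e)\<^sup>2)"
    unfolding mult.assoc nw by (simp add: c_r algebra_simps)
  \<comment> \<open>The products are generalized to variables, which leaves a purely linear
    inequality.\<close>
  moreover have "nd - 10 * R1 - 2 * es \<le> 2 * P - A"
    if "- (8 * R2) \<le> 4 * R1 + 4 * R3" "R3 \<le> 1 / 10 * ne" "A = nd - 2 * de + ne + 4 * R1 - 8 * R2 + 4 * R3"
      "q - R1 \<le> P" "q = nd - de" "ne \<le> es" "0 \<le> ne" for nd ne de R1 R2 R3 es P A q :: real
    using that by linarith
  ultimately have "(norm d)\<^sup>2 - 10 * (r * (norm d)\<^sup>2) - 2 * \<epsilon>\<^sup>2 \<le> 2 * (t * \<psi> y - t * \<psi> x) - c * t\<^sup>2 * (norm (w y))\<^sup>2"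
    using 1 wd \<open>(norm e)\<^sup>2 \<le> \<epsilon>\<^sup>2\<close> zero_le_power2[of "norm e"] by blast
  then have "(1 - 10 * r) * (norm d)\<^sup>2 - 2 * \<epsilon>\<^sup>2 \<le> 2 * (t * \<psi> y - c * t\<^sup>2 * (norm (w y))\<^sup>2 / 2 - t * \<psi> x)"
    by (simp add: left_diff_distrib right_diff_distrib)
  then show ?thesis by (simp add: d_def r_def)
qed


section \<open>The continuity equation along a geodesic\<close>

text \<open>A countable supply of times: multiples of 1 / (n + 1), clamped so that every integer
  index gives a time in \<open>{0..1}\<close>. Only countably many null sets and time slices then
  have to be handled.\<close>

definition grid :: "nat \<Rightarrow> int \<Rightarrow> real" where
  "grid n i = max 0 (min 1 (of_int i / real (Suc n)))"

lemma grid_in: "grid n i \<in> {0..1}"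
  by (simp add: grid_def)

lemma grid_tendsto:
  assumes t: "t \<in> {0..1}"
  shows "(\<lambda>n. grid n \<lfloor>real (Suc n) * t\<rfloor>) \<longlonglongrightarrow> t"
proof -
  have "(\<lambda>n. of_int \<lfloor>real (Suc n) * t\<rfloor> / real (Suc n)) \<longlonglongrightarrow> t"
  proof (rule LIM_zero_cancel, rule Lim_null_comparison)
    show "\<forall>\<^sub>F n in sequentially. norm (of_int \<lfloor>real (Suc n) * t\<rfloor> / real (Suc n) - t) \<le> inverse (real (Suc n))"
    proof (rule always_eventually, rule allI)
      fix n
      have "of_int \<lfloor>real (Suc n) * t\<rfloor> / real (Suc n) - t = (of_int \<lfloor>real (Suc n) * t\<rfloor> - real (Suc n) * t) / real (Suc n)"
        by (simp add: diff_divide_distrib del: of_nat_Suc)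
      moreover have "\<bar>of_int \<lfloor>real (Suc n) * t\<rfloor> - real (Suc n) * t\<bar> \<le> 1" by linarith
      then have "\<bar>of_int \<lfloor>real (Suc n) * t\<rfloor> - real (Suc n) * t\<bar> / real (Suc n) \<le> 1 / real (Suc n)"
        by (rule divide_right_mono) simp
      ultimately show "norm (of_int \<lfloor>real (Suc n) * t\<rfloor> / real (Suc n) - t) \<le> inverse (real (Suc n))"
        by (simp only: real_norm_def abs_divide abs_of_nat inverse_eq_divide)
    qed
    show "(\<lambda>n. inverse (real (Suc n))) \<longlonglongrightarrow> 0" by (rule LIMSEQ_inverse_real_of_nat)
  qed
  then have "(\<lambda>n. max 0 (min 1 (of_int \<lfloor>real (Suc n) * t\<rfloor> / real (Suc n)))) \<longlonglongrightarrow> max 0 (min 1 t)"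
    by (intro tendsto_intros)
  moreover have "max 0 (min 1 t) = t" using t by auto
  ultimately show ?thesis by (simp only: grid_def)
qed

context geodesic_restriction
begin

lemma flow_grid_tendsto:
  assumes "(\<theta>, \<eta>) \<in> D" "x \<in> \<Omega>" "t \<in> {0..1}"
  shows "(\<lambda>n. flow \<theta> \<eta> (grid n \<lfloor>real (Suc n) * t\<rfloor>) x) \<longlonglongrightarrow> flow \<theta> \<eta> t x"
  using continuous_on_tendsto_compose[OF flow_derivative(2)[OF assms(1,2)] grid_tendsto[OF assms(3)] assms(3)]
  using grid_in by simp

text \<open>Moves the quantifier over time inside the almost-everywhere statement: the grid times
  cost countably many null sets, and the other times follow by continuity in time because \<Omega>
  is closed.\<close>

lemma flow_AE_all_in:
  assumes "(\<theta>, \<eta>) \<in> D"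
  shows "AE x in base \<theta>. \<forall>t\<in>{0..1}. flow \<theta> \<eta> t x \<in> \<Omega>"
proof -
  have "AE x in base \<theta>. \<forall>n i. flow \<theta> \<eta> (grid n i) x \<in> \<Omega>"
    using flow_AE_in[OF assms grid_in] by (simp add: AE_all_countable)
  moreover have "AE x in base \<theta>. x \<in> \<Omega>"
    using base_prob(1)[OF D_tangent(1)[OF assms]] by (intro AE_I2) simp
  ultimately show ?thesis
  proof eventually_elim
    case (elim x)
    show ?case
    proof
      fix t :: real assume "t \<in> {0..1}"
      from flow_grid_tendsto[OF assms elim(2) this] show "flow \<theta> \<eta> t x \<in> \<Omega>"
        by (rule closed_sequentially[OF closed_Om, rotated]) (use elim(1) in blast)
    qed
  qed
qed

text \<open>A map that is continuous in time and measurable in the starting point is a limit of maps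
  that are piecewise constant in time. Clamping keeps the time in \<open>{0..1}\<close>, where these
  properties of the flow are known.\<close>

lemma flow_jointly_measurable:
  assumes "(\<theta>, \<eta>) \<in> D"
  shows "(\<lambda>z. flow \<theta> \<eta> (max 0 (min 1 (fst z))) (snd z)) \<in> borel_measurable (lborel \<Otimes>\<^sub>M base \<theta>)"
    (is "_ \<in> borel_measurable ?M")
proof (rule borel_measurable_LIMSEQ_metric)
  fix n
  show "(\<lambda>z. flow \<theta> \<eta> (grid n \<lfloor>real (Suc n) * max 0 (min 1 (fst z))\<rfloor>) (snd z)) \<in> borel_measurable ?M"
  proof (rule measurable_compose_countable[where f = "\<lambda>i z. flow \<theta> \<eta> (grid n i) (snd z)"])
    show "(\<lambda>z. flow \<theta> \<eta> (grid n i) (snd z)) \<in> borel_measurable ?M" for i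
      by (rule measurable_compose[OF measurable_snd flow_measurable[OF assms grid_in]])
    have "fst \<in> borel_measurable ?M"
      using measurable_fst[of lborel "base \<theta>"] by (simp add: measurable_cong_sets[OF refl sets_lborel])
    moreover have "(\<lambda>s::real. real (Suc n) * max 0 (min 1 s)) \<in> borel_measurable borel"
      by (intro borel_measurable_continuous_onI continuous_intros)
    ultimately have "(\<lambda>z. real (Suc n) * max 0 (min 1 (fst z))) \<in> borel_measurable ?M"
      by (rule measurable_compose)
    then show "(\<lambda>z. \<lfloor>real (Suc n) * max 0 (min 1 (fst z))\<rfloor>) \<in> measurable ?M (count_space UNIV)"
      by (rule measurable_compose[OF _ measurable_real_floor])
  qed
next
  fix z :: "real \<times> 'x" assume "z \<in> space ?M"
  then have "snd z \<in> \<Omega>" using base_prob(1)[OF D_tangent(1)[OF assms]] by (simp add: space_pair_measure mem_Times_iff)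
  then show "(\<lambda>n. flow \<theta> \<eta> (grid n \<lfloor>real (Suc n) * max 0 (min 1 (fst z))\<rfloor>) (snd z))
      \<longlonglongrightarrow> flow \<theta> \<eta> (max 0 (min 1 (fst z))) (snd z)"
    by (rule flow_grid_tendsto[OF assms]) simp
qed

lemma flow_Fubini:
  fixes h :: "real \<times> 'x \<Rightarrow> real"
  assumes d: "(\<theta>, \<eta>) \<in> D" and h: "h \<in> borel_measurable borel" and b: "\<And>z. \<bar>h z\<bar> \<le> b"
  shows "(LINT t:{0..1}|lborel. \<integral>x. h (t, flow \<theta> \<eta> t x) \<partial>base \<theta>)
      = (\<integral>x. (LINT t:{0..1}|lborel. h (t, flow \<theta> \<eta> t x)) \<partial>base \<theta>)"
    "integrable (base \<theta>) (\<lambda>x. LINT t:{0..1}|lborel. h (t, flow \<theta> \<eta> t x))"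
proof -
  note p = base_prob[OF D_tangent(1)[OF d]]
  interpret Q: finite_measure "base \<theta>" by (rule p)
  interpret pair_sigma_finite "lborel :: real measure" "base \<theta>" ..
  let ?M = "(lborel :: real measure) \<Otimes>\<^sub>M base \<theta>"
  \<comment> \<open>Clamped, the integrand is measurable on the whole product; the indicator makes
    it agree with the unclamped one.\<close>
  define F where "F = (\<lambda>t x. indicator {0..1} t * h (t, flow \<theta> \<eta> (max 0 (min 1 t)) x))"
  have F: "F t x = indicator {0..1} t *\<^sub>R h (t, flow \<theta> \<eta> t x)" for t x
    by (simp add: F_def indicator_def max_def min_def)
  have f: "fst \<in> borel_measurable ?M"
    using measurable_fst[of lborel "base \<theta>"] by (simp add: measurable_cong_sets[OF refl sets_lborel])
  have int: "integrable ?M (case_prod F)"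
  proof (rule Bochner_Integration.integrable_bound)
    have "emeasure ?M ({0..1::real} \<times> space (base \<theta>)) = 1"
    proof -
      have "emeasure ?M ({0..1} \<times> space (base \<theta>))
          = emeasure lborel {0..1::real} * emeasure (base \<theta>) (space (base \<theta>))"
        by (rule Q.emeasure_pair_measure_Times) auto
      then show ?thesis using p(2) by simp
    qed
    then show "integrable ?M (\<lambda>z. b * indicator ({0..1::real} \<times> space (base \<theta>)) z)"
      by (intro integrable_mult_right integrable_real_indicator) auto
    have "(\<lambda>z. (fst z, flow \<theta> \<eta> (max 0 (min 1 (fst z))) (snd z))) \<in> borel_measurable ?M"
      using f flow_jointly_measurable[OF d] by (rule borel_measurable_Pair)
    then have "(\<lambda>z. h (fst z, flow \<theta> \<eta> (max 0 (min 1 (fst z))) (snd z))) \<in> borel_measurable ?M"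
      by (rule measurable_compose) (rule h)
    moreover have "(\<lambda>z. indicator {0..1::real} (fst z) :: real) \<in> borel_measurable ?M"
      by (rule measurable_compose[OF f borel_measurable_indicator]) simp
    ultimately show "case_prod F \<in> borel_measurable ?M"
      unfolding F_def case_prod_unfold by (intro borel_measurable_times)
    show "AE z in ?M. norm (case_prod F z) \<le> norm (b * indicator ({0..1} \<times> space (base \<theta>)) z)"
    proof (rule AE_I2)
      fix z :: "real \<times> 'x" assume "z \<in> space ?M"
      moreover have "\<bar>h y\<bar> \<le> \<bar>b\<bar>" for y using b[of y] by simp
      ultimately show "norm (case_prod F z) \<le> norm (b * indicator ({0..1} \<times> space (base \<theta>)) z)"
        by (auto simp: F space_pair_measure indicator_def split: prod.split)
    qed
  qed
  show "(LINT t:{0..1}|lborel. \<integral>x. h (t, flow \<theta> \<eta> t x) \<partial>base \<theta>)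
      = (\<integral>x. (LINT t:{0..1}|lborel. h (t, flow \<theta> \<eta> t x)) \<partial>base \<theta>)"
    using Fubini_integral[OF int] by (simp add: F set_lebesgue_integral_def)
  show "integrable (base \<theta>) (\<lambda>x. LINT t:{0..1}|lborel. h (t, flow \<theta> \<eta> t x))"
    using integrable_snd[OF int] by (simp add: F set_lebesgue_integral_def)
qed

lemma vel_slice_continuous:
  assumes "(\<theta>, \<eta>) \<in> D" "t \<in> {0..1}"
  shows "continuous_on UNIV (vel \<theta> \<eta> t)"
  unfolding vel_def using exp_curve_tangent[OF assms] by (intro continuous_on_Ck_on_1 B_C1)

text \<open>The fundamental theorem of calculus along one trajectory. The trajectory has to stay in
  \<Omega>, because a test function is differentiable only within
  \<open>{0..1} \<times> \<Omega>\<close>.\<close>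

lemma flow_test_function:
  assumes d: "(\<theta>, \<eta>) \<in> D" and \<phi>: "C1_test_function \<Omega> \<phi> \<phi>t \<phi>x"
    and x: "x \<in> \<Omega>" and inO: "\<And>t. t \<in> {0..1} \<Longrightarrow> flow \<theta> \<eta> t x \<in> \<Omega>"
  shows "(LINT t:{0..1}|lborel. \<phi>t (t, flow \<theta> \<eta> t x))
      + (LINT t:{0..1}|lborel. \<phi>x (t, flow \<theta> \<eta> t x) \<bullet> vel \<theta> \<eta> t (flow \<theta> \<eta> t x))
      = \<phi> (1, flow \<theta> \<eta> 1 x) - \<phi> (0, x)"
proof -
  let ?f = "\<lambda>t. flow \<theta> \<eta> t x" and ?v = "\<lambda>t. vel \<theta> \<eta> t (flow \<theta> \<eta> t x)"
  note fd = flow_derivative[OF d x]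
  have c: "continuous_on {0..1} (\<lambda>t. (t, ?f t))" by (intro continuous_intros fd(2))
  have im: "(\<lambda>t. (t, ?f t)) ` {0..1} \<subseteq> {0..1} \<times> \<Omega>" using inO by auto
  have ct: "continuous_on {0..1} (\<lambda>t. \<phi>t (t, ?f t))"
    using \<phi> im unfolding C1_test_function_def by (intro continuous_on_compose2[OF _ c]) auto
  have "continuous_on {0..1} (\<lambda>t. \<phi>x (t, ?f t))"
    using \<phi> im unfolding C1_test_function_def by (intro continuous_on_compose2[OF _ c]) auto
  then have cx: "continuous_on {0..1} (\<lambda>t. \<phi>x (t, ?f t) \<bullet> ?v t)" by (intro continuous_intros fd(3))
  have "integral\<^sup>L lborel (\<lambda>t. indicator {0..1} t *\<^sub>R (\<phi>t (t, ?f t) + \<phi>x (t, ?f t) \<bullet> ?v t))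
      = (\<phi> \<circ> (\<lambda>t. (t, ?f t))) 1 - (\<phi> \<circ> (\<lambda>t. (t, ?f t))) 0"
  proof (rule integral_FTC_atLeastAtMost)
    show "continuous_on {0..1} (\<lambda>t. \<phi>t (t, ?f t) + \<phi>x (t, ?f t) \<bullet> ?v t)" by (intro continuous_intros ct cx)
    fix t :: real assume "0 \<le> t" "t \<le> 1"
    then have t: "t \<in> {0..1}" by simp
    have "((\<lambda>t. (t, ?f t)) has_vector_derivative (1, ?v t)) (at t within {0..1})"
      by (intro has_vector_derivative_Pair has_vector_derivative_id fd(1)[OF t])
    moreover have "(\<phi> has_derivative (\<lambda>(s, h). \<phi>t (t, ?f t) * s + \<phi>x (t, ?f t) \<bullet> h))
        (at (t, ?f t) within (\<lambda>t. (t, ?f t)) ` {0..1})"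
      using \<phi> t inO[OF t] unfolding C1_test_function_def by (blast intro: has_derivative_subset[OF _ im])
    ultimately have "((\<phi> \<circ> (\<lambda>t. (t, ?f t))) has_vector_derivative
        (\<lambda>(s, h). \<phi>t (t, ?f t) * s + \<phi>x (t, ?f t) \<bullet> h) (1, ?v t)) (at t within {0..1})"
      by (rule vector_derivative_diff_chain_within)
    then show "((\<phi> \<circ> (\<lambda>t. (t, ?f t))) has_vector_derivative \<phi>t (t, ?f t) + \<phi>x (t, ?f t) \<bullet> ?v t) (at t within {0..1})"
      by simp
  qed simp
  moreover have "integral\<^sup>L lborel (\<lambda>t. indicator {0..1} t *\<^sub>R (\<phi>t (t, ?f t) + \<phi>x (t, ?f t) \<bullet> ?v t))
      = (LINT t:{0..1}|lborel. \<phi>t (t, ?f t)) + (LINT t:{0..1}|lborel. \<phi>x (t, ?f t) \<bullet> ?v t)"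
    using set_integral_add(2)[OF borel_integrable_atLeastAtMost'[OF ct] borel_integrable_atLeastAtMost'[OF cx]] by (simp add: set_lebesgue_integral_def)
  ultimately show ?thesis using flow_0[OF d x] by simp
qed

text \<open>Pull the space integrals back by the flow, exchange them with the time integral, and
  apply the fundamental theorem of calculus along almost every trajectory. The field is cut off
  outside \<open>{0..1}\<close> because \<open>CE\<close> asks for a Borel map on all times.\<close>

lemma exp_curve_vel_CE:
  assumes d: "(\<theta>, \<eta>) \<in> D"
  shows "(\<lambda>t x. if t \<in> {0..1} then vel \<theta> \<eta> t x else 0) \<in> CE \<Omega> (\<lambda>t. E (exp_curve M \<theta> \<eta> t))" (is "?v \<in> _")
  unfolding CE_def mem_Collect_eq
proof (intro conjI ballI allI impI)
  let ?\<rho> = "\<lambda>t. E (exp_curve M \<theta> \<eta> t)"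
  note p = base_prob[OF D_tangent(1)[OF d]]
  have "(\<lambda>z. indicator ({0..1} \<times> UNIV) z *\<^sub>R vel \<theta> \<eta> (fst z) (snd z)) \<in> borel_measurable borel"
    by (rule borel_measurable_continuous_on_indicator[OF _ vel_continuous[OF d]]) (auto intro!: borel_closed closed_Times)
  moreover have "(\<lambda>z. indicator ({0..1} \<times> UNIV) z *\<^sub>R vel \<theta> \<eta> (fst z) (snd z)) = (\<lambda>(t, x). ?v t x)"
    by (auto simp: fun_eq_iff indicator_def)
  ultimately show "(\<lambda>(t, x). ?v t x) \<in> borel_measurable borel" by simp
  show "integrable (?\<rho> t) (\<lambda>x. (norm (?v t x))\<^sup>2)" if t: "t \<in> {0..1}" for t
    using exp_curve_tangent[OF d t] t
    by (intro integrable_continuous_prob_measures_on[OF Om E_prob]) (auto intro!: continuous_intros vel_slice_continuous[OF d t])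
  fix \<phi> \<phi>t \<phi>x assume \<phi>: "C1_test_function \<Omega> \<phi> \<phi>t \<phi>x"
  let ?K = "{0..1::real} \<times> \<Omega>"
  have K: "compact ?K" by (intro compact_Times Om compact_Icc)
  have Kb: "?K \<in> sets borel" using K by (intro borel_closed compact_imp_closed)
  \<comment> \<open>Test functions are controlled on \<open>{0..1} \<times> \<Omega>\<close> only.
    Extension by zero gives bounded Borel functions for \<open>flow_Fubini\<close>; almost every
    trajectory stays in \<Omega> and never meets the extension.\<close>
  define h1 where "h1 z = indicator ?K z *\<^sub>R \<phi>t z" for z
  define h2 where "h2 z = indicator ?K z *\<^sub>R (\<phi>x z \<bullet> vel \<theta> \<eta> (fst z) (snd z))" for z
  have bm: "(\<lambda>z. indicator ?K z *\<^sub>R g z) \<in> borel_measurable borel"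
    "\<exists>b. \<forall>z. \<bar>indicator ?K z *\<^sub>R g z\<bar> \<le> b" if g: "continuous_on ?K g" for g :: "real \<times> 'x \<Rightarrow> real"
  proof -
    show "(\<lambda>z. indicator ?K z *\<^sub>R g z) \<in> borel_measurable borel"
      by (rule borel_measurable_continuous_on_indicator[OF Kb g])
    obtain b where "\<And>z. z \<in> ?K \<Longrightarrow> \<bar>g z\<bar> \<le> b"
      using compact_imp_bounded[OF compact_continuous_image[OF g K]] by (auto simp: bounded_iff)
    then have "\<bar>indicator ?K z *\<^sub>R g z\<bar> \<le> \<bar>b\<bar>" for z by (cases "z \<in> ?K") force+
    then show "\<exists>b. \<forall>z. \<bar>indicator ?K z *\<^sub>R g z\<bar> \<le> b" by blast
  qed
  have ct: "continuous_on ?K \<phi>t" and cx: "continuous_on ?K \<phi>x" using \<phi> by (auto simp: C1_test_function_def)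
  have cv: "continuous_on ?K (\<lambda>z. \<phi>x z \<bullet> vel \<theta> \<eta> (fst z) (snd z))"
    by (intro continuous_intros cx continuous_on_subset[OF vel_continuous[OF d]]) auto
  obtain b1 where b1: "\<And>z. \<bar>h1 z\<bar> \<le> b1" using bm(2)[OF ct] unfolding h1_def by blast
  obtain b2 where b2: "\<And>z. \<bar>h2 z\<bar> \<le> b2" using bm(2)[OF cv] unfolding h2_def by blast
  have m1: "h1 \<in> borel_measurable borel" and m2: "h2 \<in> borel_measurable borel"
    unfolding h1_def[abs_def] h2_def[abs_def] by (rule bm(1)[OF ct], rule bm(1)[OF cv])
  have slice: "(\<lambda>x. h (t, x)) \<in> borel_measurable borel" if "h \<in> borel_measurable borel"
    for h :: "real \<times> 'x \<Rightarrow> real" and t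
    by (rule measurable_compose[OF _ that]) (auto intro!: borel_measurable_continuous_onI continuous_intros)
  have "(LINT t:{0..1}|lborel. (LINT x:\<Omega>|?\<rho> t. \<phi>t (t, x)))
      = (LINT t:{0..1}|lborel. \<integral>x. h1 (t, flow \<theta> \<eta> t x) \<partial>base \<theta>)"
  proof (rule set_lebesgue_integral_cong)
    show "\<forall>t. t \<in> {0..1} \<longrightarrow> (LINT x:\<Omega>|?\<rho> t. \<phi>t (t, x)) = (\<integral>x. h1 (t, flow \<theta> \<eta> t x) \<partial>base \<theta>)"
    proof (intro allI impI)
      fix t :: real assume t: "t \<in> {0..1}"
      have "(LINT x:\<Omega>|?\<rho> t. \<phi>t (t, x)) = (\<integral>x. h1 (t, x) \<partial>?\<rho> t)"
        unfolding set_lebesgue_integral_def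
        by (rule Bochner_Integration.integral_cong) (use t in \<open>auto simp: h1_def indicator_def\<close>)
      then show "(LINT x:\<Omega>|?\<rho> t. \<phi>t (t, x)) = (\<integral>x. h1 (t, flow \<theta> \<eta> t x) \<partial>base \<theta>)"
        using integral_flow[OF d t slice[OF m1]] by simp
    qed
  qed simp
  also have "\<dots> = (\<integral>x. (LINT t:{0..1}|lborel. h1 (t, flow \<theta> \<eta> t x)) \<partial>base \<theta>)"
    by (rule flow_Fubini(1)[OF d m1 b1])
  finally have 1: "(LINT t:{0..1}|lborel. (LINT x:\<Omega>|?\<rho> t. \<phi>t (t, x))) = \<dots>" .
  have "(LINT t:{0..1}|lborel. (LINT x:\<Omega>|?\<rho> t. \<phi>x (t, x) \<bullet> ?v t x))
      = (LINT t:{0..1}|lborel. \<integral>x. h2 (t, flow \<theta> \<eta> t x) \<partial>base \<theta>)"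
  proof (rule set_lebesgue_integral_cong)
    show "\<forall>t. t \<in> {0..1} \<longrightarrow> (LINT x:\<Omega>|?\<rho> t. \<phi>x (t, x) \<bullet> ?v t x) = (\<integral>x. h2 (t, flow \<theta> \<eta> t x) \<partial>base \<theta>)"
    proof (intro allI impI)
      fix t :: real assume t: "t \<in> {0..1}"
      have "(LINT x:\<Omega>|?\<rho> t. \<phi>x (t, x) \<bullet> ?v t x) = (\<integral>x. h2 (t, x) \<partial>?\<rho> t)"
        unfolding set_lebesgue_integral_def
        by (rule Bochner_Integration.integral_cong) (use t in \<open>auto simp: h2_def indicator_def\<close>)
      then show "(LINT x:\<Omega>|?\<rho> t. \<phi>x (t, x) \<bullet> ?v t x) = (\<integral>x. h2 (t, flow \<theta> \<eta> t x) \<partial>base \<theta>)"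
        using integral_flow[OF d t slice[OF m2]] by simp
    qed
  qed simp
  also have "\<dots> = (\<integral>x. (LINT t:{0..1}|lborel. h2 (t, flow \<theta> \<eta> t x)) \<partial>base \<theta>)"
    by (rule flow_Fubini(1)[OF d m2 b2])
  finally have 2: "(LINT t:{0..1}|lborel. (LINT x:\<Omega>|?\<rho> t. \<phi>x (t, x) \<bullet> ?v t x)) = \<dots>" .
  define f where "f s x = indicator \<Omega> x *\<^sub>R \<phi> (s, x)" for s x
  have "continuous_on ?K \<phi>"
    using \<phi> unfolding C1_test_function_def continuous_on_eq_continuous_within by (blast intro: has_derivative_continuous)
  then have fm: "f s \<in> borel_measurable borel" "integrable (?\<rho> s) (f s)" if s: "s \<in> {0..1}" for s
  proof -
    have c: "continuous_on \<Omega> (\<lambda>x. \<phi> (s, x))"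
      by (rule continuous_on_compose2[OF \<open>continuous_on ?K \<phi>\<close>]) (use s in \<open>auto intro!: continuous_intros\<close>)
    show "f s \<in> borel_measurable borel" unfolding f_def[abs_def]
      using closed_Om by (intro borel_measurable_continuous_on_indicator[OF _ c]) auto
    show "integrable (?\<rho> s) (f s)"
      using set_integrable_continuous_prob_measures_on[OF E_prob[OF exp_curve_tangent(1)[OF d s]] Om c]
      by (simp add: set_integrable_def f_def[abs_def])
  qed
  have fi: "integrable (base \<theta>) (\<lambda>x. f s (flow \<theta> \<eta> s x))" if s: "s \<in> {0..1}" for s
    using fm(2)[OF s] unfolding flow_solution_flow(2)[OF d s]
    using integrable_distr_eq[OF flow_measurable[OF d s] fm(1)[OF s]] by blast
  have "(\<integral>x. (LINT t:{0..1}|lborel. h1 (t, flow \<theta> \<eta> t x)) \<partial>base \<theta>)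
      + (\<integral>x. (LINT t:{0..1}|lborel. h2 (t, flow \<theta> \<eta> t x)) \<partial>base \<theta>)
      = (\<integral>x. (LINT t:{0..1}|lborel. h1 (t, flow \<theta> \<eta> t x)) + (LINT t:{0..1}|lborel. h2 (t, flow \<theta> \<eta> t x)) \<partial>base \<theta>)"
    by (intro Bochner_Integration.integral_add[symmetric] flow_Fubini(2)[OF d m1 b1] flow_Fubini(2)[OF d m2 b2])
  also have "\<dots> = (\<integral>x. f 1 (flow \<theta> \<eta> 1 x) - f 0 (flow \<theta> \<eta> 0 x) \<partial>base \<theta>)"
  proof (rule integral_cong_AE)
    show "(\<lambda>x. (LINT t:{0..1}|lborel. h1 (t, flow \<theta> \<eta> t x)) + (LINT t:{0..1}|lborel. h2 (t, flow \<theta> \<eta> t x)))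
        \<in> borel_measurable (base \<theta>)"
      using flow_Fubini(2)[OF d m1 b1] flow_Fubini(2)[OF d m2 b2]
      by (intro borel_measurable_add borel_measurable_integrable)
    show "(\<lambda>x. f 1 (flow \<theta> \<eta> 1 x) - f 0 (flow \<theta> \<eta> 0 x)) \<in> borel_measurable (base \<theta>)"
      by (intro borel_measurable_diff borel_measurable_integrable fi) auto
    have "AE x in base \<theta>. x \<in> \<Omega>" using p(1) by (intro AE_I2) simp
    with flow_AE_all_in[OF d]
    show "AE x in base \<theta>. (LINT t:{0..1}|lborel. h1 (t, flow \<theta> \<eta> t x)) + (LINT t:{0..1}|lborel. h2 (t, flow \<theta> \<eta> t x))
        = f 1 (flow \<theta> \<eta> 1 x) - f 0 (flow \<theta> \<eta> 0 x)"
    proof eventually_elim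
      case (elim x)
      then have i: "\<And>t. t \<in> {0..1} \<Longrightarrow> flow \<theta> \<eta> t x \<in> \<Omega>" by blast
      have "(LINT t:{0..1}|lborel. h1 (t, flow \<theta> \<eta> t x)) = (LINT t:{0..1}|lborel. \<phi>t (t, flow \<theta> \<eta> t x))"
        by (rule set_lebesgue_integral_cong) (use i in \<open>auto simp: h1_def\<close>)
      moreover have "(LINT t:{0..1}|lborel. h2 (t, flow \<theta> \<eta> t x))
          = (LINT t:{0..1}|lborel. \<phi>x (t, flow \<theta> \<eta> t x) \<bullet> vel \<theta> \<eta> t (flow \<theta> \<eta> t x))"
        by (rule set_lebesgue_integral_cong) (use i in \<open>auto simp: h2_def\<close>)
      ultimately show ?case
        using flow_test_function[OF d \<phi> elim(2) i] flow_0[OF d elim(2)] i[of 1] elim(2) by (simp add: f_def)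
    qed
  qed
  also have "\<dots> = (\<integral>x. f 1 (flow \<theta> \<eta> 1 x) \<partial>base \<theta>) - (\<integral>x. f 0 (flow \<theta> \<eta> 0 x) \<partial>base \<theta>)"
    by (intro Bochner_Integration.integral_diff fi) auto
  also have "\<dots> = (LINT x:\<Omega>|?\<rho> 1. \<phi> (1, x)) - (LINT x:\<Omega>|?\<rho> 0. \<phi> (0, x))"
    using integral_flow[OF d _ fm(1), of 1 1] integral_flow[OF d _ fm(1), of 0 0]
    by (simp add: set_lebesgue_integral_def f_def)
  finally show "(LINT t:{0..1}|lborel. (LINT x:\<Omega>|?\<rho> t. \<phi>t (t, x)))
        + (LINT t:{0..1}|lborel. (LINT x:\<Omega>|?\<rho> t. \<phi>x (t, x) \<bullet> ?v t x))
        = (LINT x:\<Omega>|?\<rho> 1. \<phi> (1, x)) - (LINT x:\<Omega>|?\<rho> 0. \<phi> (0, x))"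
    unfolding 1 2 .
qed

lemma E_exp_curve_lipschitz:
  assumes d: "(\<theta>, \<eta>) \<in> D"
  shows "lipschitz_curve W2 (E ` S) (\<lambda>t. E (exp_curve M \<theta> \<eta> t))"
proof -
  obtain C where C: "0 < C" "\<And>\<theta> \<theta>'. \<theta> \<in> S \<Longrightarrow> \<theta>' \<in> S \<Longrightarrow> W2 (E \<theta>) (E \<theta>') \<le> C * riem_dist M S \<theta> \<theta>'"
    using MP unfolding measure_parametrization_def by blast
  have "W2 (E (exp_curve M \<theta> \<eta> s)) (E (exp_curve M \<theta> \<eta> t)) \<le> C * tnorm M \<theta> \<eta> * \<bar>s - t\<bar>"
    if "s \<in> {0..1}" "t \<in> {0..1}" for s t
    using order_trans[OF C(2)[OF exp_curve_tangent(1)[OF d that(1)] exp_curve_tangent(1)[OF d that(2)]]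
      mult_left_mono[OF exp_curve_dist[OF d that], of C]] C(1) by (simp add: mult.assoc)
  then show ?thesis
    unfolding lipschitz_curve_def using exp_curve_tangent(1)[OF d] by blast
qed

text \<open>Seen from the starting points, the velocity stays within \<open>Ct\<close> times the
  squared norm of \<eta> of its initial value, uniformly in time. The geodesic is therefore a
  competitor whose speed never exceeds the right-hand side.\<close>

lemma W_restricted_exp_curve_le:
  assumes d: "(\<theta>, \<eta>) \<in> D" and small: "tnorm M \<theta> \<eta> \<le> 1"
  shows "W_restricted \<Omega> (E ` S) (E \<theta>) (E (exp_curve M \<theta> \<eta> 1))
    \<le> ennreal (L2_norm_of (base \<theta>) (B \<theta> \<eta>) + Ct * (tnorm M \<theta> \<eta>)\<^sup>2)"
proof -
  let ?\<rho> = "\<lambda>t. E (exp_curve M \<theta> \<eta> t)"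
  let ?v = "\<lambda>t x. if t \<in> {0..1} then vel \<theta> \<eta> t x else 0"
  define A where "A = L2_norm_of (base \<theta>) (B \<theta> \<eta>) + Ct * (tnorm M \<theta> \<eta>)\<^sup>2"
  note p = base_prob[OF D_tangent(1)[OF d]]
  have A0: "0 \<le> A" using Ct_nonneg by (simp add: A_def L2_norm_of_def)
  have cB: "continuous_on UNIV (B \<theta> \<eta>)" using vel_slice_continuous[OF d, of 0] vel_0[OF d] by simp
  have Bi: "B \<theta> \<eta> \<in> borel_measurable (base \<theta>)"
    using borel_measurable_continuous_onI[OF cB] prob_measures_onD(1)[OF E_prob[OF D_tangent(1)[OF d]]]
    unfolding base_def by (intro measurable_restrict_space1) (simp cong: measurable_cong_sets)
  have Bs: "integrable (base \<theta>) (\<lambda>x. (norm (B \<theta> \<eta> x))\<^sup>2)"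
  proof -
    interpret finite_measure "base \<theta>" by (rule p)
    show ?thesis
    proof (rule integrable_const_bound)
      show "AE x in base \<theta>. norm ((norm (B \<theta> \<eta> x))\<^sup>2) \<le> (C0 * tnorm M \<theta> \<eta>)\<^sup>2"
        using B_bounds(1)[OF d] by (intro AE_I2) (simp add: power_mono)
    qed (use Bi in measurable)
  qed
  have le: "L2_norm_of (?\<rho> t) (?v t) \<le> A" if t: "t \<in> {0..1}" for t
  proof -
    have m: "(\<lambda>x. vel \<theta> \<eta> t (flow \<theta> \<eta> t x)) \<in> borel_measurable (base \<theta>)"
      by (rule measurable_compose[OF flow_measurable[OF d t] borel_measurable_continuous_onI[OF vel_slice_continuous[OF d t]]])
    have "L2_norm_of (?\<rho> t) (?v t) = L2_norm_of (base \<theta>) (\<lambda>x. vel \<theta> \<eta> t (flow \<theta> \<eta> t x))"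
      using t unfolding L2_norm_of_def
      by (subst integral_flow[OF d t])
        (auto intro!: borel_measurable_continuous_onI continuous_intros vel_slice_continuous[OF d t])
    also have "\<dots> \<le> L2_norm_of (base \<theta>) (B \<theta> \<eta>) + Ct * (tnorm M \<theta> \<eta>)\<^sup>2"
    proof (rule L2_norm_of_perturb(2)[OF p(3,4) m Bi Bs])
      show "AE x in base \<theta>. norm (vel \<theta> \<eta> t (flow \<theta> \<eta> t x) - B \<theta> \<eta> x) \<le> Ct * (tnorm M \<theta> \<eta>)\<^sup>2"
      proof (rule AE_I2)
        fix x assume "x \<in> space (base \<theta>)"
        then have x: "x \<in> \<Omega>" using p(1) by simp
        have n: "0 \<le> tnorm M \<theta> \<eta>" by (rule D_tangent(3)[OF d])
        have "t * tnorm M \<theta> \<eta> \<le> 1" using t small n mult_mono[of t 1 "tnorm M \<theta> \<eta>" 1] by simp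
        from flow_taylor(2)[OF d x t this]
        have "norm (vel \<theta> \<eta> t (flow \<theta> \<eta> t x) - B \<theta> \<eta> x) \<le> Ct * (tnorm M \<theta> \<eta>)\<^sup>2 * t" .
        also have "\<dots> \<le> Ct * (tnorm M \<theta> \<eta>)\<^sup>2 * 1" using t Ct_nonneg by (intro mult_left_mono) auto
        finally show "norm (vel \<theta> \<eta> t (flow \<theta> \<eta> t x) - B \<theta> \<eta> x) \<le> Ct * (tnorm M \<theta> \<eta>)\<^sup>2" by simp
      qed
    qed (use Ct_nonneg in simp)
    finally show ?thesis by (simp add: A_def)
  qed
  have "energy \<Omega> ?\<rho> \<le> (\<integral>\<^sup>+t\<in>{0..1}. ennreal ((L2_norm_of (?\<rho> t) (?v t))\<^sup>2) \<partial>lborel)"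
    unfolding energy_def by (rule INF_lower[OF exp_curve_vel_CE[OF d]])
  also have "\<dots> \<le> (\<integral>\<^sup>+t\<in>{0..1::real}. ennreal (A\<^sup>2) \<partial>lborel)"
  proof (rule nn_integral_mono)
    fix t :: real
    have "0 \<le> L2_norm_of (?\<rho> t) (?v t)" by (simp add: L2_norm_of_def)
    then show "ennreal ((L2_norm_of (?\<rho> t) (?v t))\<^sup>2) * indicator {0..1} t \<le> ennreal (A\<^sup>2) * indicator {0..1} t"
      using le[of t] by (cases "t \<in> {0..1}") (auto intro!: ennreal_leI power_mono)
  qed
  also have "\<dots> = ennreal (A\<^sup>2)" by (subst nn_integral_cmult_indicator) auto
  finally have en: "energy \<Omega> ?\<rho> \<le> ennreal (A\<^sup>2)" .
  have "W_restricted \<Omega> (E ` S) (E \<theta>) (E (exp_curve M \<theta> \<eta> 1)) \<le> ennsqrt (energy \<Omega> ?\<rho>)"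
    unfolding W_restricted_def
    by (rule INF_lower) (use E_exp_curve_lipschitz[OF d] exp_curve_D(2)[OF d] in auto)
  also have "\<dots> \<le> ennreal A"
  proof -
    have "energy \<Omega> ?\<rho> \<noteq> \<infinity>" using en by (auto simp: top_unique)
    moreover have "enn2real (energy \<Omega> ?\<rho>) \<le> A\<^sup>2" by (rule enn2real_leI[OF _ en]) simp
    then have "sqrt (enn2real (energy \<Omega> ?\<rho>)) \<le> A" using A0 by (rule real_le_lsqrt[rotated])
    ultimately show ?thesis by (simp add: ennsqrt_def ennreal_leI)
  qed
  finally show ?thesis by (simp add: A_def)
qed

end


section \<open>The expansion of the restricted distance\<close>

lemma ennreal_le_ennsqrt:
  assumes le: "ennreal x \<le> en" and A: "A \<le> 0 \<or> A\<^sup>2 \<le> x"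
  shows "ennreal A \<le> ennsqrt en"
proof (cases "A \<le> 0 \<or> en = \<infinity>")
  case True
  then show ?thesis
  proof
    \<comment> \<open>\<open>ennreal\<close> maps negative numbers to 0. The case does occur: the
      lower bound for the distance is a main term minus an error.\<close>
    assume "A \<le> 0"
    then show ?thesis by (simp only: ennreal_neg) simp
  qed (simp add: ennsqrt_def)
next
  case False
  then have A2: "A\<^sup>2 \<le> x" "0 \<le> A" using A by auto
  then have "0 \<le> x" using zero_le_power2 order_trans by blast
  have "A\<^sup>2 \<le> enn2real en"
    using enn2real_mono[OF le] False A2 \<open>0 \<le> x\<close> by (simp add: less_top)
  then have "A \<le> sqrt (enn2real en)" by (rule real_le_rsqrt)
  then show ?thesis using False by (simp add: ennsqrt_def ennreal_leI)
qed

text \<open>Passes from a bound on squares to one on distances. It rests on s^2 \<le> s and on 2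
  \<epsilon> \<le> s T, which lets the cross term outweigh all terms in \<epsilon>^2.\<close>

lemma shifted_square_le:
  fixes s T \<epsilon> :: real
  assumes "0 \<le> s" "s \<le> 1" "0 \<le> T" "0 \<le> \<epsilon>" "0 \<le> s * T - 2 * \<epsilon>"
  shows "(s * T - 2 * \<epsilon>)\<^sup>2 \<le> s * T\<^sup>2 - 2 * \<epsilon>\<^sup>2"
proof -
  have "s * T * (s * T) \<le> s * T * (1 * T)" using assms by (intro mult_left_mono mult_right_mono) auto
  moreover have "2 * (\<epsilon> * \<epsilon>) \<le> \<epsilon> * (s * T)"
    using mult_left_mono[of "2 * \<epsilon>" "s * T" \<epsilon>] assms by simp
  moreover have "(s * T - 2 * \<epsilon>)\<^sup>2 = s * T * (s * T) - 4 * (\<epsilon> * (s * T)) + 4 * (\<epsilon> * \<epsilon>)"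
    by (simp add: power2_eq_square algebra_simps)
  moreover have "s * T\<^sup>2 = s * T * (1 * T)" "\<epsilon>\<^sup>2 = \<epsilon> * \<epsilon>" "0 \<le> \<epsilon> * \<epsilon>"
    by (simp_all add: power2_eq_square)
  ultimately show ?thesis by linarith
qed

text \<open>Unless \<open>b\<close> is at most \<open>T\<close> or \<open>m\<close>, both
  \<open>T\<close> and \<open>m\<close> can be replaced by \<open>b\<close> in the errors, which
  then all carry a factor \<open>b\<close>; the root is taken by dividing b^2 - T^2 by
  \<open>b\<close>. The constant is 10 = 4 + 2 + 4, and \<open>b \<le> k\<close> turns
  \<open>k * b\<close> into k^2.\<close>

lemma le_of_perturbed_square_le:
  fixes b T k m :: real
  assumes "0 \<le> b" "0 \<le> T" "0 \<le> k" "0 \<le> m" "b \<le> k"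
    and le: "b\<^sup>2 * (1 - 4 * k) \<le> (1 + 2 * k) * T\<^sup>2 + 2 * m * b + 4 * k * m\<^sup>2"
  shows "b \<le> T + (10 * k\<^sup>2 + 2 * m)"
proof (cases "b \<le> T \<or> b \<le> m")
  case True
  then show ?thesis using assms zero_le_power2[of k] by linarith
next
  case False
  then have T: "T < b" "m < b" by auto
  have Tb: "k * T\<^sup>2 \<le> k * b\<^sup>2" using assms T by (intro mult_left_mono power_mono) auto
  have mb: "k * m\<^sup>2 \<le> k * b\<^sup>2" using assms T by (intro mult_left_mono power_mono) auto
  have 1: "b\<^sup>2 - T\<^sup>2 \<le> 10 * (k * b\<^sup>2) + 2 * (m * b)"
    using le Tb mb by (simp add: algebra_simps)
  have "(b - T) * b \<le> (b - T) * (b + T)" using assms T by (intro mult_left_mono) auto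
  also have "\<dots> = b\<^sup>2 - T\<^sup>2" by (simp add: power2_eq_square algebra_simps)
  also have "\<dots> \<le> (10 * (k * b) + 2 * m) * b" using 1 by (simp add: power2_eq_square algebra_simps)
  finally have "b - T \<le> 10 * (k * b) + 2 * m" using T assms by (auto dest: mult_right_le_imp_le)
  moreover have "k * b \<le> k * k" using assms by (intro mult_left_mono) auto
  ultimately show ?thesis by (simp add: power2_eq_square)
qed

lemma has_real_derivative_of_quadratic_bound:
  fixes f :: "real \<Rightarrow> real"
  assumes "0 < \<delta>" "f 0 = 0" and le: "\<And>t. 0 \<le> t \<Longrightarrow> t < \<delta> \<Longrightarrow> \<bar>f t - t * L\<bar> \<le> t\<^sup>2 * K"
  shows "(f has_real_derivative L) (at 0 within {0..1})"
  unfolding has_field_derivative_def has_derivative_within_alt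
proof (intro conjI allI impI bounded_linear_mult_right)
  fix e :: real assume "0 < e"
  define d where "d = min \<delta> (e / (\<bar>K\<bar> + 1))"
  have "0 < d" using \<open>0 < \<delta>\<close> \<open>0 < e\<close> by (simp add: d_def add_nonneg_pos)
  moreover have "norm (f y - f 0 - L * (y - 0)) \<le> e * norm (y - 0)" if y: "y \<in> {0..1}" "norm (y - 0) < d" for y
  proof -
    have y0: "0 \<le> y" "y < \<delta>" "y < e / (\<bar>K\<bar> + 1)" using y by (auto simp: d_def)
    have "y * \<bar>K\<bar> \<le> y * (\<bar>K\<bar> + 1)" using y0 by (simp add: mult_left_mono)
    also have "\<dots> \<le> e" using y0(3) by (simp add: field_simps add_nonneg_pos)
    finally have "y * (y * \<bar>K\<bar>) \<le> y * e" using y0 by (intro mult_left_mono) auto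
    moreover have "\<bar>f y - y * L\<bar> \<le> y * (y * \<bar>K\<bar>)"
    proof -
      have "y\<^sup>2 * K \<le> y\<^sup>2 * \<bar>K\<bar>" by (rule mult_left_mono) auto
      then show ?thesis using le[OF y0(1,2)] by (simp only: power2_eq_square mult.assoc)
    qed
    ultimately show ?thesis using y0 \<open>f 0 = 0\<close> by (simp add: mult.commute)
  qed
  ultimately show "\<exists>d>0. \<forall>y\<in>{0..1}. norm (y - 0) < d \<longrightarrow> norm (f y - f 0 - L * (y - 0)) \<le> e * norm (y - 0)"
    by blast
qed

text \<open>For \<open>r = 0\<close> both sides hold, in accordance with the convention that 1 / 0
  is infinite.\<close>

lemma ereal_less_inverse_iff:
  assumes "0 \<le> r"
  shows "ereal t < 1 / ereal r \<longleftrightarrow> t * r < 1"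
proof (cases "r = 0")
  case False
  then have "0 < r" using assms by simp
  have "1 / ereal r = ereal (1 / r)" using False by (simp add: one_ereal_def)
  then show ?thesis using \<open>0 < r\<close> by (simp add: field_simps)
qed (simp add: divide_ereal_def)

text \<open>The upper bound rules out the value infinity, so both conversions agree with a real
  number. Truncation of a negative lower bound is harmless, since \<open>w\<close> is
  nonnegative.\<close>

lemma abs_enn2ereal_diff_le:
  assumes "ennreal (a - r) \<le> w" "w \<le> ennreal (a + r)" "0 \<le> a + r"
  shows "\<bar>enn2ereal w - ereal a\<bar> \<le> ereal r" "\<bar>enn2real w - a\<bar> \<le> r"
proof -
  obtain v where v: "w = ennreal v" "0 \<le> v"
    using assms(2) by (cases w rule: ennreal_cases) (auto simp: top_unique)
  have "v \<le> a + r" using assms(2,3) v by (simp add: ennreal_le_iff)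
  moreover have "a - r \<le> v"
  proof (cases "0 \<le> a - r")
    case True
    then show ?thesis using assms(1) v by (simp add: ennreal_le_iff)
  next
    case False
    then show ?thesis using v by simp
  qed
  ultimately show "\<bar>enn2ereal w - ereal a\<bar> \<le> ereal r" "\<bar>enn2real w - a\<bar> \<le> r"
    using v by (simp_all add: abs_le_iff)
qed

context geodesic_restriction
begin

section \<open>Two geodesics issuing from a common point\<close>

lemma base_continuous_measurable:
  fixes f :: "'x \<Rightarrow> 'c::{banach, second_countable_topology}"
  assumes "\<theta> \<in> S" "continuous_on UNIV f"
  shows "f \<in> borel_measurable (base \<theta>)"
proof -
  have "f \<in> borel_measurable (E \<theta>)"
    using borel_measurable_continuous_onI[OF assms(2)] prob_measures_onD(1)[OF E_prob[OF assms(1)]]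
      measurable_cong_sets by blast
  then show ?thesis unfolding base_def by (rule measurable_restrict_space1)
qed

lemma base_integrable_bounded:
  fixes f :: "'x \<Rightarrow> 'c::{banach, second_countable_topology}"
  assumes "\<theta> \<in> S" "f \<in> borel_measurable (base \<theta>)" "\<And>x. x \<in> \<Omega> \<Longrightarrow> norm (f x) \<le> b"
  shows "integrable (base \<theta>) f"
proof -
  note p = base_prob[OF assms(1)]
  interpret finite_measure "base \<theta>" by (rule p)
  show ?thesis by (rule integrable_const_bound[OF AE_I2 assms(2)]) (use assms(3) p(1) in auto)
qed

lemma base_continuous_integrable:
  fixes f :: "'x \<Rightarrow> 'c::{banach, second_countable_topology}"
  assumes "\<theta> \<in> S" "continuous_on UNIV f"
  shows "integrable (base \<theta>) f"
proof -
  obtain b where "\<And>x. x \<in> \<Omega> \<Longrightarrow> norm (f x) \<le> b"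
    using compact_imp_bounded[OF compact_continuous_image[OF continuous_on_subset[OF assms(2)] Om]]
    by (auto simp: bounded_iff)
  then show ?thesis by (rule base_integrable_bounded[OF assms(1) base_continuous_measurable[OF assms]])
qed

lemma B_onorm:
  assumes "(\<theta>, \<eta>) \<in> D"
  shows "onorm (frechet_derivative (B \<theta> \<eta>) (at x)) \<le> C0 * tnorm M \<theta> \<eta>"
  using C1_norm_leD(2)[OF C1_B[OF assms]] C0 D_tangent(3)[OF assms] by simp

lemma B_continuous: "\<theta> \<in> S \<Longrightarrow> \<eta> \<in> tangent_space M \<theta> \<Longrightarrow> continuous_on UNIV (B \<theta> \<eta>)"
  by (rule continuous_on_Ck_on_1[OF B_C1])

text \<open>A difference of two elements of the fibre of \<open>D\<close> need not lie in it, so the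
  bounds on \<open>B\<close> do not apply to it directly. They are inherited by linearity, which is
  why the sum of the two norms appears here and in all error terms.\<close>

lemma B_diff_bounds:
  assumes d1: "(\<theta>, \<eta>1) \<in> D" and d2: "(\<theta>, \<eta>2) \<in> D"
  defines "w \<equiv> B \<theta> (\<lambda>i. \<eta>2 i - \<eta>1 i)"
  shows "w x = B \<theta> \<eta>2 x - B \<theta> \<eta>1 x"
    "norm (w x) \<le> C0 * (tnorm M \<theta> \<eta>1 + tnorm M \<theta> \<eta>2)"
    "norm (w x - w y) \<le> C0 * (tnorm M \<theta> \<eta>1 + tnorm M \<theta> \<eta>2) * norm (x - y)"
    "onorm (frechet_derivative w (at x)) \<le> C0 * (tnorm M \<theta> \<eta>1 + tnorm M \<theta> \<eta>2)"
    "Ck_on 1 w UNIV" "gradient_field w"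
proof -
  note t1 = D_tangent[OF d1] and t2 = D_tangent[OF d2]
  have w: "w x = B \<theta> \<eta>2 x - B \<theta> \<eta>1 x" for x unfolding w_def by (rule B_diff[OF t1(1) t2(2) t1(2)])
  then show "w x = B \<theta> \<eta>2 x - B \<theta> \<eta>1 x" .
  show "norm (w x) \<le> C0 * (tnorm M \<theta> \<eta>1 + tnorm M \<theta> \<eta>2)"
    using norm_triangle_ineq4[of "B \<theta> \<eta>2 x" "B \<theta> \<eta>1 x"] B_bounds(1)[OF d1, of x] B_bounds(1)[OF d2, of x]
    by (simp add: w algebra_simps)
  have "w x - w y = (B \<theta> \<eta>2 x - B \<theta> \<eta>2 y) - (B \<theta> \<eta>1 x - B \<theta> \<eta>1 y)" by (simp add: w)
  then have "norm (w x - w y) \<le> norm (B \<theta> \<eta>2 x - B \<theta> \<eta>2 y) + norm (B \<theta> \<eta>1 x - B \<theta> \<eta>1 y)"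
    by (simp only: norm_triangle_ineq4)
  then show "norm (w x - w y) \<le> C0 * (tnorm M \<theta> \<eta>1 + tnorm M \<theta> \<eta>2) * norm (x - y)"
    using B_bounds(2)[OF d1, of x y] B_bounds(2)[OF d2, of x y] by (simp add: algebra_simps)
  have "(\<lambda>i. \<eta>2 i - \<eta>1 i) \<in> tangent_space M \<theta>" by (rule tangent_space_diff[OF atlas t2(2) t1(2)])
  then show "Ck_on 1 w UNIV" "gradient_field w" unfolding w_def by (rule B_C1[OF t1(1)], rule B_gradient[OF t1(1)])
  let ?D1 = "frechet_derivative (B \<theta> \<eta>1) (at x)" and ?D2 = "frechet_derivative (B \<theta> \<eta>2) (at x)"
  have h1: "(B \<theta> \<eta>1 has_derivative ?D1) (at x)" and h2: "(B \<theta> \<eta>2 has_derivative ?D2) (at x)"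
    using B_C1[OF t1(1,2)] B_C1[OF t2(1,2)] by (simp_all add: Ck_on_1_UNIV_iff flip: frechet_derivative_works)
  have "(w has_derivative (\<lambda>h. ?D2 h - ?D1 h)) (at x)"
    using has_derivative_diff[OF h2 h1] w by presburger
  then have fw: "frechet_derivative w (at x) = (\<lambda>h. ?D2 h - ?D1 h)" by (rule frechet_derivative_at[symmetric])
  show "onorm (frechet_derivative w (at x)) \<le> C0 * (tnorm M \<theta> \<eta>1 + tnorm M \<theta> \<eta>2)"
    unfolding fw
  proof (rule onorm_bound)
    show "0 \<le> C0 * (tnorm M \<theta> \<eta>1 + tnorm M \<theta> \<eta>2)" using C0 t1 t2 by simp
    fix h
    have "norm (?D1 h) \<le> C0 * tnorm M \<theta> \<eta>1 * norm h"
      using onorm[OF has_derivative_bounded_linear[OF h1], of h] mult_right_mono[OF B_onorm[OF d1, of x], of "norm h"] by simp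
    moreover have "norm (?D2 h) \<le> C0 * tnorm M \<theta> \<eta>2 * norm h"
      using onorm[OF has_derivative_bounded_linear[OF h2], of h] mult_right_mono[OF B_onorm[OF d2, of x], of "norm h"] by simp
    ultimately show "norm (?D2 h - ?D1 h) \<le> C0 * (tnorm M \<theta> \<eta>1 + tnorm M \<theta> \<eta>2) * norm h"
      using norm_triangle_ineq4[of "?D2 h" "?D1 h"] by (simp add: algebra_simps)
  qed
qed

text \<open>The field \<open>w\<close> is needed at two points: at \<open>x\<close> for the
  comparison with the claimed linear term, and at the arrival point \<open>Y\<close> for the
  pointwise cost bound. Its Lipschitz constant and the displacement \<open>Y - x\<close> are each of
  first order, so moving between the points costs second order.\<close>

lemma flow_pair_taylor:
  assumes d1: "(\<theta>, \<eta>1) \<in> D" and d2: "(\<theta>, \<eta>2) \<in> D" and t: "t \<in> {0..1}"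
    and s1: "t * tnorm M \<theta> \<eta>1 \<le> 1" and s2: "t * tnorm M \<theta> \<eta>2 \<le> 1" and x: "x \<in> \<Omega>"
  defines "w \<equiv> B \<theta> (\<lambda>i. \<eta>2 i - \<eta>1 i)" and "N \<equiv> tnorm M \<theta> \<eta>1 + tnorm M \<theta> \<eta>2"
    and "X \<equiv> flow \<theta> \<eta>1 t x" and "Y \<equiv> flow \<theta> \<eta>2 t x"
  shows "norm (Y - X - t *\<^sub>R w x) \<le> Ct * (t * N)\<^sup>2"
    "norm (Y - X) \<le> 2 * C0 * (t * N)"
    "norm (Y - X - t *\<^sub>R w Y) \<le> (Ct + 2 * C0\<^sup>2) * (t * N)\<^sup>2"
proof -
  define n1 n2 where "n1 = tnorm M \<theta> \<eta>1" and "n2 = tnorm M \<theta> \<eta>2"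
  have n: "0 \<le> n1" "0 \<le> n2" "N = n1 + n2" using D_tangent d1 d2 by (auto simp: n1_def n2_def N_def)
  note f1 = flow_taylor[OF d1 x t s1, folded X_def n1_def]
  note f2 = flow_taylor[OF d2 x t s2, folded Y_def n2_def]
  have t0: "0 \<le> t" using t by simp
  have w: "w x = B \<theta> \<eta>2 x - B \<theta> \<eta>1 x" unfolding w_def by (rule B_diff_bounds(1)[OF d1 d2])
  have "Y - X - t *\<^sub>R w x = (Y - x - t *\<^sub>R B \<theta> \<eta>2 x) - (X - x - t *\<^sub>R B \<theta> \<eta>1 x)"
    by (simp add: w algebra_simps)
  then have "norm (Y - X - t *\<^sub>R w x) \<le> norm (Y - x - t *\<^sub>R B \<theta> \<eta>2 x) + norm (X - x - t *\<^sub>R B \<theta> \<eta>1 x)"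
    by (simp only: norm_triangle_ineq4)
  also have "\<dots> \<le> Ct * n2\<^sup>2 * t\<^sup>2 + Ct * n1\<^sup>2 * t\<^sup>2" using f1(3) f2(3) by (rule add_mono[rotated])
  also have "\<dots> = Ct * t\<^sup>2 * (n1\<^sup>2 + n2\<^sup>2)" by (simp add: algebra_simps)
  also have "\<dots> \<le> Ct * t\<^sup>2 * N\<^sup>2"
    using n Ct_nonneg by (intro mult_left_mono) (auto simp: power2_sum)
  finally show a: "norm (Y - X - t *\<^sub>R w x) \<le> Ct * (t * N)\<^sup>2" by (simp add: power_mult_distrib mult.assoc)
  have "Y - X = (Y - x) - (X - x)" by simp
  then have "norm (Y - X) \<le> norm (Y - x) + norm (X - x)" by (simp only: norm_triangle_ineq4)
  then show "norm (Y - X) \<le> 2 * C0 * (t * N)"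
    using f1(1) f2(1) by (simp add: n algebra_simps)
  have "norm (w Y - w x) \<le> C0 * N * norm (Y - x)"
    unfolding w_def N_def by (rule B_diff_bounds(3)[OF d1 d2])
  also have "\<dots> \<le> C0 * N * (2 * C0 * N * t)"
  proof (rule mult_left_mono)
    have "2 * C0 * n2 * t \<le> 2 * C0 * N * t" using n C0 t0 by (intro mult_right_mono mult_left_mono) auto
    then show "norm (Y - x) \<le> 2 * C0 * N * t" using f2(1) by linarith
  qed (use C0 n in auto)
  finally have "t * norm (w Y - w x) \<le> t * (C0 * N * (2 * C0 * N * t))" using t0 by (rule mult_left_mono)
  then have b: "norm (t *\<^sub>R (w Y - w x)) \<le> 2 * C0\<^sup>2 * (t * N)\<^sup>2"
    using t0 by (simp add: power2_eq_square mult_ac)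
  have "Y - X - t *\<^sub>R w Y = (Y - X - t *\<^sub>R w x) - t *\<^sub>R (w Y - w x)" by (simp add: algebra_simps)
  then have "norm (Y - X - t *\<^sub>R w Y) \<le> norm (Y - X - t *\<^sub>R w x) + norm (t *\<^sub>R (w Y - w x))"
    by (simp only: norm_triangle_ineq4)
  then show "norm (Y - X - t *\<^sub>R w Y) \<le> (Ct + 2 * C0\<^sup>2) * (t * N)\<^sup>2"
    using a b by (simp add: distrib_right)
qed

lemma flow_pair_L2:
  assumes d1: "(\<theta>, \<eta>1) \<in> D" and d2: "(\<theta>, \<eta>2) \<in> D" and t: "t \<in> {0..1}"
    and s1: "t * tnorm M \<theta> \<eta>1 \<le> 1" and s2: "t * tnorm M \<theta> \<eta>2 \<le> 1"
  defines "w \<equiv> B \<theta> (\<lambda>i. \<eta>2 i - \<eta>1 i)" and "N \<equiv> tnorm M \<theta> \<eta>1 + tnorm M \<theta> \<eta>2"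
    and "T \<equiv> L2_norm_of (base \<theta>) (\<lambda>x. flow \<theta> \<eta>2 t x - flow \<theta> \<eta>1 t x)"
  shows "\<bar>T - t * L2_norm_of (base \<theta>) w\<bar> \<le> Ct * (t * N)\<^sup>2" "T \<le> 2 * C0 * (t * N)"
    "integrable (base \<theta>) (\<lambda>x. (norm (flow \<theta> \<eta>2 t x - flow \<theta> \<eta>1 t x))\<^sup>2)"
proof -
  note p = base_prob[OF D_tangent(1)[OF d1]]
  note f = flow_pair_taylor[OF d1 d2 t s1 s2, folded w_def N_def]
  have t0: "0 \<le> t" using t by simp
  have N: "0 \<le> N" using D_tangent d1 d2 by (auto simp: N_def)
  have dm: "(\<lambda>x. flow \<theta> \<eta>2 t x - flow \<theta> \<eta>1 t x) \<in> borel_measurable (base \<theta>)"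
    using flow_measurable[OF d1 t] flow_measurable[OF d2 t] by measurable
  have wm: "(\<lambda>x. t *\<^sub>R w x) \<in> borel_measurable (base \<theta>)"
    unfolding w_def by (intro base_continuous_measurable D_tangent(1)[OF d1] continuous_intros
        continuous_on_Ck_on_1 B_diff_bounds(5)[OF d1 d2])
  have wi: "integrable (base \<theta>) (\<lambda>x. (norm (t *\<^sub>R w x))\<^sup>2)"
    unfolding w_def by (intro base_continuous_integrable D_tangent(1)[OF d1] continuous_intros
        continuous_on_Ck_on_1 B_diff_bounds(5)[OF d1 d2])
  \<comment> \<open>Comparison with the zero field yields square integrability and the crude bound
    on \<open>T\<close> at once.\<close>
  have zm: "(\<lambda>x. 0 :: 'x) \<in> borel_measurable (base \<theta>)" "integrable (base \<theta>) (\<lambda>x. (norm (0 :: 'x))\<^sup>2)" by auto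
  have tw: "L2_norm_of (base \<theta>) (\<lambda>x. t *\<^sub>R w x) = t * L2_norm_of (base \<theta>) w"
    using t0 by (simp add: L2_norm_of_def power_mult_distrib real_sqrt_mult)
  have AE1: "AE x in base \<theta>. norm (flow \<theta> \<eta>2 t x - flow \<theta> \<eta>1 t x - t *\<^sub>R w x) \<le> Ct * (t * N)\<^sup>2"
    using f(1) p(1) by (intro AE_I2) simp
  then have AE2: "AE x in base \<theta>. norm (t *\<^sub>R w x - (flow \<theta> \<eta>2 t x - flow \<theta> \<eta>1 t x)) \<le> Ct * (t * N)\<^sup>2"
    by eventually_elim (metis norm_minus_commute)
  have AE3: "AE x in base \<theta>. norm (flow \<theta> \<eta>2 t x - flow \<theta> \<eta>1 t x - 0) \<le> 2 * C0 * (t * N)"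
    using f(2) p(1) by (intro AE_I2) simp
  have e0: "0 \<le> Ct * (t * N)\<^sup>2" using Ct_nonneg by simp
  have e1: "0 \<le> 2 * C0 * (t * N)" using C0 t0 N by simp
  show di: "integrable (base \<theta>) (\<lambda>x. (norm (flow \<theta> \<eta>2 t x - flow \<theta> \<eta>1 t x))\<^sup>2)"
    by (rule L2_norm_of_perturb(1)[OF p(3,4) dm zm AE3 e1])
  show "T \<le> 2 * C0 * (t * N)"
    using L2_norm_of_perturb(2)[OF p(3,4) dm zm AE3 e1] by (simp add: T_def L2_norm_of_def)
  have "T \<le> t * L2_norm_of (base \<theta>) w + Ct * (t * N)\<^sup>2"
    using L2_norm_of_perturb(2)[OF p(3,4) dm wm wi AE1 e0] by (simp add: T_def tw)
  moreover have "t * L2_norm_of (base \<theta>) w \<le> T + Ct * (t * N)\<^sup>2"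
    using L2_norm_of_perturb(2)[OF p(3,4) wm dm di AE2 e0] by (simp add: T_def tw)
  ultimately show "\<bar>T - t * L2_norm_of (base \<theta>) w\<bar> \<le> Ct * (t * N)\<^sup>2" by linarith
qed

text \<open>The Hamilton-Jacobi bound sees a competitor only through its two end measures. Both are
  images of \<open>base \<theta>\<close>, so the bound becomes a single integral to which the
  pointwise cost estimate applies.\<close>

lemma W_restricted_lower:
  assumes d1: "(\<theta>, \<eta>1) \<in> D" and d2: "(\<theta>, \<eta>2) \<in> D" and t: "t \<in> {0..1}"
    and s1: "t * tnorm M \<theta> \<eta>1 \<le> 1" and s2: "t * tnorm M \<theta> \<eta>2 \<le> 1"
  defines "w \<equiv> B \<theta> (\<lambda>i. \<eta>2 i - \<eta>1 i)" and "N \<equiv> tnorm M \<theta> \<eta>1 + tnorm M \<theta> \<eta>2"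
    and "T \<equiv> L2_norm_of (base \<theta>) (\<lambda>x. flow \<theta> \<eta>2 t x - flow \<theta> \<eta>1 t x)"
  assumes small: "C0 * (t * N) \<le> 1 / 10"
  shows "ennreal (T - (20 * C0\<^sup>2 + 2 * (Ct + 2 * C0\<^sup>2)) * (t * N)\<^sup>2)
    \<le> W_restricted \<Omega> (E ` S) (E (exp_curve M \<theta> \<eta>1 t)) (E (exp_curve M \<theta> \<eta>2 t))"
  unfolding W_restricted_def
proof (rule INF_greatest)
  fix \<rho> assume "\<rho> \<in> {\<rho>. lipschitz_curve W2 (E ` S) \<rho> \<and> \<rho> 0 = E (exp_curve M \<theta> \<eta>1 t) \<and> \<rho> 1 = E (exp_curve M \<theta> \<eta>2 t)}"
  then have \<rho>: "lipschitz_curve W2 (E ` S) \<rho>" "\<rho> 0 = E (exp_curve M \<theta> \<eta>1 t)" "\<rho> 1 = E (exp_curve M \<theta> \<eta>2 t)"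
    by auto
  note p = base_prob[OF D_tangent(1)[OF d1]]
  interpret finite_measure "base \<theta>" by (rule p)
  note wb = B_diff_bounds[OF d1 d2, folded w_def N_def]
  note f = flow_pair_taylor[OF d1 d2 t s1 s2, folded w_def N_def]
  note l2 = flow_pair_L2[OF d1 d2 t s1 s2, folded w_def N_def T_def]
  have t0: "0 \<le> t" using t by simp
  have N: "0 \<le> N" using D_tangent d1 d2 by (auto simp: N_def)
  obtain \<psi> where \<psi>: "\<And>x. GDERIV \<psi> x :> w x" using wb(6) unfolding gradient_field_def by blast
  define K u c \<epsilon> where "K = C0 * N" and "u = t * K" and "c = 1 + 4 * (t * K)" and "\<epsilon> = (Ct + 2 * C0\<^sup>2) * (t * N)\<^sup>2"
  have K: "0 \<le> K" using C0 N by (simp add: K_def)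
  have tK: "t * K \<le> 1 / 10" using small by (simp add: K_def mult_ac)
  have u0: "0 \<le> u" "u \<le> 1 / 10" using tK K t0 by (auto simp: u_def)
  let ?X = "\<lambda>x. flow \<theta> \<eta>1 t x" and ?Y = "\<lambda>x. flow \<theta> \<eta>2 t x"
  let ?f = "\<lambda>y. t * \<psi> y - c * t\<^sup>2 * (norm (w y))\<^sup>2 / 2"
  have le: "ennreal (2 * ((\<integral>x. ?f x \<partial>\<rho> 1) - (\<integral>x. t * \<psi> x \<partial>\<rho> 0))) \<le> energy \<Omega> \<rho>"
  proof (rule energy_lower_bound_gradient[where K = K, OF Om _ \<rho>(1) \<psi>])
    show "E ` S \<subseteq> prob_measures_on \<Omega>" using E_prob by blast
    show "w differentiable at x" "continuous_on UNIV (\<lambda>x. frechet_derivative w (at x) h)" for x h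
      using wb(5) by (auto simp: Ck_on_1_UNIV_iff)
  qed (use wb(2-4) t0 tK in \<open>simp_all add: K_def c_def\<close>)
  have c\<psi>: "continuous_on UNIV \<psi>" by (rule GDERIV_continuous_on[OF \<psi>])
  have cf: "continuous_on UNIV ?f" by (intro continuous_intros c\<psi> continuous_on_Ck_on_1[OF wb(5)]) auto
  have c\<psi>t: "continuous_on UNIV (\<lambda>x. t * \<psi> x)" by (intro continuous_intros c\<psi>)
  have "2 * ((\<integral>x. ?f x \<partial>\<rho> 1) - (\<integral>x. t * \<psi> x \<partial>\<rho> 0)) = 2 * ((\<integral>x. ?f (?Y x) \<partial>base \<theta>) - (\<integral>x. t * \<psi> (?X x) \<partial>base \<theta>))"
    unfolding \<rho> integral_flow[OF d1 t borel_measurable_continuous_onI[OF c\<psi>t]]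
      integral_flow[OF d2 t borel_measurable_continuous_onI[OF cf]] ..
  also have "\<dots> = 2 * (\<integral>x. ?f (?Y x) - t * \<psi> (?X x) \<partial>base \<theta>)"
    by (subst Bochner_Integration.integral_diff[OF integrable_flow[OF d2 t cf] integrable_flow[OF d1 t c\<psi>t]]) (rule refl)
  also have "\<dots> = (\<integral>x. 2 * (?f (?Y x) - t * \<psi> (?X x)) \<partial>base \<theta>)"
    by (rule integral_mult_right_zero[symmetric])
  finally have eq: "2 * ((\<integral>x. ?f x \<partial>\<rho> 1) - (\<integral>x. t * \<psi> x \<partial>\<rho> 0)) = \<dots>" .
  have "(1 - 10 * u) * T\<^sup>2 - 2 * \<epsilon>\<^sup>2 = (\<integral>x. (1 - 10 * u) * (norm (?Y x - ?X x))\<^sup>2 - 2 * \<epsilon>\<^sup>2 \<partial>base \<theta>)"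
    using l2(3) p(4) by (simp add: T_def L2_norm_of_def)
  also have "\<dots> \<le> (\<integral>x. 2 * (?f (?Y x) - t * \<psi> (?X x)) \<partial>base \<theta>)"
  proof (rule integral_mono)
    show "integrable (base \<theta>) (\<lambda>x. (1 - 10 * u) * (norm (?Y x - ?X x))\<^sup>2 - 2 * \<epsilon>\<^sup>2)" using l2(3) by simp
    show "integrable (base \<theta>) (\<lambda>x. 2 * (?f (?Y x) - t * \<psi> (?X x)))"
      by (intro integrable_mult_right Bochner_Integration.integrable_diff integrable_flow[OF d1 t c\<psi>t] integrable_flow[OF d2 t cf])
    fix x assume "x \<in> space (base \<theta>)"
    then have x: "x \<in> \<Omega>" using p(1) by simp
    have L: "norm (w x - w y) \<le> K * norm (x - y)" for x y using wb(3) by (simp add: K_def)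
    have e: "norm (?Y x - ?X x - t *\<^sub>R w (?Y x)) \<le> \<epsilon>" unfolding \<epsilon>_def by (rule f(3)[OF x])
    show "(1 - 10 * u) * (norm (?Y x - ?X x))\<^sup>2 - 2 * \<epsilon>\<^sup>2 \<le> 2 * (?f (?Y x) - t * \<psi> (?X x))"
      unfolding u_def by (rule gradient_cost_lower_bound[OF \<psi> L K t0 tK c_def e])
  qed
  finally have X: "(1 - 10 * u) * T\<^sup>2 - 2 * \<epsilon>\<^sup>2 \<le> 2 * ((\<integral>x. ?f x \<partial>\<rho> 1) - (\<integral>x. t * \<psi> x \<partial>\<rho> 0))"
    unfolding eq .
  have T0: "0 \<le> T" by (simp add: T_def L2_norm_of_def)
  have \<epsilon>0: "0 \<le> \<epsilon>" using Ct_nonneg by (simp add: \<epsilon>_def)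
  \<comment> \<open>If the left side is negative, nothing is to be shown; otherwise
    \<open>shifted_square_le\<close> applies, with \<open>1 - 10 * u\<close> nonnegative by the
    smallness assumption.\<close>
  have "(1 - 10 * u) * T - 2 * \<epsilon> \<le> 0 \<or>
      ((1 - 10 * u) * T - 2 * \<epsilon>)\<^sup>2 \<le> 2 * ((\<integral>x. ?f x \<partial>\<rho> 1) - (\<integral>x. t * \<psi> x \<partial>\<rho> 0))"
    using shifted_square_le[of "1 - 10 * u" T \<epsilon>] X u0 T0 \<epsilon>0 by linarith
  from ennreal_le_ennsqrt[OF le this] have "ennreal ((1 - 10 * u) * T - 2 * \<epsilon>) \<le> ennsqrt (energy \<Omega> \<rho>)" .
  moreover have "T - (20 * C0\<^sup>2 + 2 * (Ct + 2 * C0\<^sup>2)) * (t * N)\<^sup>2 \<le> (1 - 10 * u) * T - 2 * \<epsilon>"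
  proof -
    \<comment> \<open>The relative error \<open>10 * u\<close> multiplies \<open>T\<close>, itself
      of first order; this produces the constant \<open>20 * C0\<^sup>2\<close>.\<close>
    have "u * T \<le> u * (2 * C0 * (t * N))" using l2(2) u0 by (intro mult_left_mono) auto
    also have "\<dots> = 2 * (C0\<^sup>2 * (t * N)\<^sup>2)" by (simp add: u_def K_def power2_eq_square mult_ac)
    finally show ?thesis by (simp add: \<epsilon>_def algebra_simps)
  qed
  ultimately show "ennreal (T - (20 * C0\<^sup>2 + 2 * (Ct + 2 * C0\<^sup>2)) * (t * N)\<^sup>2) \<le> ennsqrt (energy \<Omega> \<rho>)"
    using ennreal_leI order_trans by blast
qed

text \<open>The two flows couple the measures. Combined with the lower bi-Lipschitz bound, this
  limits the length of the geodesic between the two parameters.\<close>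

lemma W2_exp_curves_le:
  assumes d1: "(\<theta>, \<eta>1) \<in> D" and d2: "(\<theta>, \<eta>2) \<in> D" and t: "t \<in> {0..1}"
    and s1: "t * tnorm M \<theta> \<eta>1 \<le> 1" and s2: "t * tnorm M \<theta> \<eta>2 \<le> 1"
  shows "W2 (E (exp_curve M \<theta> \<eta>1 t)) (E (exp_curve M \<theta> \<eta>2 t))
    \<le> 2 * C0 * (t * (tnorm M \<theta> \<eta>1 + tnorm M \<theta> \<eta>2))"
  unfolding flow_solution_flow(2)[OF d1 t] flow_solution_flow(2)[OF d2 t]
proof (rule W2_le_of_maps[OF flow_measurable[OF d1 t] flow_measurable[OF d2 t]])
  note p = base_prob[OF D_tangent(1)[OF d1]]
  show "emeasure (base \<theta>) (space (base \<theta>)) = 1" by (rule p)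
  show "AE x in base \<theta>. norm (flow \<theta> \<eta>1 t x - flow \<theta> \<eta>2 t x) \<le> 2 * C0 * (t * (tnorm M \<theta> \<eta>1 + tnorm M \<theta> \<eta>2))"
    using flow_pair_taylor(2)[OF d1 d2 t s1 s2] p(1) by (intro AE_I2) (simp add: norm_minus_commute)
  show "0 \<le> 2 * C0 * (t * (tnorm M \<theta> \<eta>1 + tnorm M \<theta> \<eta>2))"
    using C0 t D_tangent(3)[OF d1] D_tangent(3)[OF d2] by simp
qed

text \<open>The initial velocity of a geodesic between the two images is a gradient, so the map it
  generates is almost optimal. Its potential is integrated against the end points along the geodesic
  and along the coupling \<open>(X, Y)\<close>.\<close>

lemma connecting_velocity_le:
  assumes d1: "(\<theta>, \<eta>1) \<in> D" and d2: "(\<theta>, \<eta>2) \<in> D" and t: "t \<in> {0..1}"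
    and s1: "t * tnorm M \<theta> \<eta>1 \<le> 1" and s2: "t * tnorm M \<theta> \<eta>2 \<le> 1"
    and \<theta>': "\<theta>' = exp_curve M \<theta> \<eta>1 t" and z: "(\<theta>', \<zeta>) \<in> D" and e: "exp_curve M \<theta>' \<zeta> 1 = exp_curve M \<theta> \<eta>2 t"
    and sz: "tnorm M \<theta>' \<zeta> \<le> 1"
  shows "L2_norm_of (base \<theta>') (B \<theta>' \<zeta>)
    \<le> L2_norm_of (base \<theta>) (\<lambda>x. flow \<theta> \<eta>2 t x - flow \<theta> \<eta>1 t x) + (10 * C0\<^sup>2 + 2 * Ct) * (tnorm M \<theta>' \<zeta>)\<^sup>2"
proof -
  define T where "T = L2_norm_of (base \<theta>) (\<lambda>x. flow \<theta> \<eta>2 t x - flow \<theta> \<eta>1 t x)"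
  define b where "b = L2_norm_of (base \<theta>') (B \<theta>' \<zeta>)"
  define n where "n = tnorm M \<theta>' \<zeta>"
  define k m where "k = C0 * n" and "m = Ct * n\<^sup>2"
  note tz = D_tangent[OF z]
  note p = base_prob[OF D_tangent(1)[OF d1]] and p' = base_prob[OF tz(1)]
  interpret P: finite_measure "base \<theta>" by (rule p)
  interpret P': finite_measure "base \<theta>'" by (rule p')
  note l2 = flow_pair_L2[OF d1 d2 t s1 s2, folded T_def]
  have n0: "0 \<le> n" using tz by (simp add: n_def)
  have k0: "0 \<le> k" using C0 n0 by (simp add: k_def)
  have m0: "0 \<le> m" using Ct_nonneg by (simp add: m_def)
  obtain \<psi> where \<psi>: "\<And>x. GDERIV \<psi> x :> B \<theta>' \<zeta> x"
    using B_gradient[OF tz(1,2)] unfolding gradient_field_def by blast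
  note Bb = B_bounds[OF z, folded n_def, folded k_def]
  have c\<psi>: "continuous_on UNIV \<psi>" by (rule GDERIV_continuous_on[OF \<psi>])
  have cB: "continuous_on UNIV (B \<theta>' \<zeta>)" by (rule B_continuous[OF tz(1,2)])
  have cN: "continuous_on UNIV (\<lambda>x. (norm (B \<theta>' \<zeta> x))\<^sup>2)" by (intro continuous_intros cB)
  note tay = gradient_taylor[OF \<psi> Bb(2) k0]
  let ?X = "\<lambda>x. flow \<theta> \<eta>1 t x" and ?Y = "\<lambda>x. flow \<theta> \<eta>2 t x" and ?\<Phi> = "\<lambda>x. flow \<theta>' \<zeta> 1 x" and ?v = "B \<theta>' \<zeta>"
  have one: "1 \<in> {0..1::real}" by simp
  have Bi: "integrable (base \<theta>') (\<lambda>x. (norm (?v x))\<^sup>2)" by (rule base_continuous_integrable[OF tz(1) cN])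
  have Bn: "integrable (base \<theta>') (\<lambda>x. norm (?v x))"
    by (intro base_continuous_integrable tz(1) continuous_intros cB)
  have b2: "b\<^sup>2 = (\<integral>x. (norm (?v x))\<^sup>2 \<partial>base \<theta>')" by (simp add: b_def L2_norm_of_def)
  have b0: "0 \<le> b" by (simp add: b_def L2_norm_of_def)
  have T0: "0 \<le> T" by (simp add: T_def L2_norm_of_def)
  have T2: "T\<^sup>2 = (\<integral>x. (norm (?Y x - ?X x))\<^sup>2 \<partial>base \<theta>)" by (simp add: T_def L2_norm_of_def)
  have bn: "(\<integral>x. norm (?v x) \<partial>base \<theta>') \<le> b"
    unfolding b_def L2_norm_of_def using square_integral_le[OF p'(3,4) Bn Bi] by (rule real_le_rsqrt)
  have bk: "b \<le> k"
  proof -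
    have "b\<^sup>2 \<le> (\<integral>x. k\<^sup>2 \<partial>base \<theta>')"
      unfolding b2 using Bb(1) Bi by (intro integral_mono) (auto intro!: power_mono)
    also have "\<dots> = k\<^sup>2" using p'(4) by simp
    finally show ?thesis using k0 by (rule power2_le_imp_le)
  qed
  \<comment> \<open>The connecting flow displaces \<open>x\<close> by \<open>?v x\<close> plus a
    remainder of norm at most \<open>m\<close>, so the potential gains |v|^2 up to the relative
    error \<open>2 * k\<close> and terms in \<open>m\<close>.\<close>
  have "(1 - 2 * k) * b\<^sup>2 - m * b - 2 * k * m\<^sup>2
      \<le> (\<integral>x. (1 - 2 * k) * (norm (?v x))\<^sup>2 - m * norm (?v x) - 2 * k * m\<^sup>2 \<partial>base \<theta>')"
    using Bi Bn p'(4) mult_left_mono[OF bn m0] by (simp add: b2)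
  also have "\<dots> \<le> (\<integral>x. \<psi> (?\<Phi> x) - \<psi> x \<partial>base \<theta>')"
  proof (rule integral_mono)
    show "integrable (base \<theta>') (\<lambda>x. (1 - 2 * k) * (norm (?v x))\<^sup>2 - m * norm (?v x) - 2 * k * m\<^sup>2)"
      using Bi Bn by simp
    show "integrable (base \<theta>') (\<lambda>x. \<psi> (?\<Phi> x) - \<psi> x)"
      by (intro Bochner_Integration.integrable_diff integrable_flow[OF z one c\<psi>] base_continuous_integrable[OF tz(1) c\<psi>])
    fix x assume "x \<in> space (base \<theta>')"
    then have x: "x \<in> \<Omega>" using p'(1) by simp
    define r where "r = ?\<Phi> x - x - ?v x"
    have r: "norm r \<le> m"
      using flow_taylor(3)[OF z x one] sz by (simp add: r_def m_def n_def)
    have \<Phi>: "?\<Phi> x - x = ?v x + r" by (simp add: r_def)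
    have "- (norm (?v x) * m) \<le> ?v x \<bullet> r"
    proof -
      have "\<bar>?v x \<bullet> r\<bar> \<le> norm (?v x) * norm r" by (rule Cauchy_Schwarz_ineq2)
      also have "\<dots> \<le> norm (?v x) * m" using r by (rule mult_left_mono) simp
      finally show ?thesis by linarith
    qed
    moreover have "(norm (?v x + r))\<^sup>2 \<le> 2 * (norm (?v x))\<^sup>2 + 2 * m\<^sup>2"
    proof -
      have "0 \<le> (norm (?v x - r))\<^sup>2" by simp
      then have "(norm (?v x + r))\<^sup>2 \<le> 2 * (norm (?v x))\<^sup>2 + 2 * (norm r)\<^sup>2"
        by (simp add: power2_norm_eq_inner inner_add inner_diff inner_commute)
      also have "(norm r)\<^sup>2 \<le> m\<^sup>2" using r by (intro power_mono) auto
      finally show ?thesis by simp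
    qed
    then have "k * (norm (?v x + r))\<^sup>2 \<le> k * (2 * (norm (?v x))\<^sup>2 + 2 * m\<^sup>2)" using k0 by (rule mult_left_mono)
    moreover have "?v x \<bullet> (?v x + r) - k * (norm (?v x + r))\<^sup>2 \<le> \<psi> (?\<Phi> x) - \<psi> x"
      using tay[of "?\<Phi> x" x] unfolding \<Phi> by linarith
    moreover have "?v x \<bullet> (?v x + r) = (norm (?v x))\<^sup>2 + ?v x \<bullet> r" by (simp add: inner_add_right power2_norm_eq_inner)
    ultimately show "(1 - 2 * k) * (norm (?v x))\<^sup>2 - m * norm (?v x) - 2 * k * m\<^sup>2 \<le> \<psi> (?\<Phi> x) - \<psi> x"
      by (simp add: algebra_simps)
  qed
  also have "\<dots> = (\<integral>x. \<psi> x \<partial>E (exp_curve M \<theta>' \<zeta> 1)) - (\<integral>x. \<psi> x \<partial>E \<theta>')"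
    using integrable_flow[OF z one c\<psi>] base_continuous_integrable[OF tz(1) c\<psi>]
      integral_flow[OF z one borel_measurable_continuous_onI[OF c\<psi>]] integral_base[OF tz(1) borel_measurable_continuous_onI[OF c\<psi>]]
    by simp
  also have "\<dots> = (\<integral>x. \<psi> (?Y x) - \<psi> (?X x) \<partial>base \<theta>)"
    using integrable_flow[OF d1 t c\<psi>] integrable_flow[OF d2 t c\<psi>]
      integral_flow[OF d1 t borel_measurable_continuous_onI[OF c\<psi>]] integral_flow[OF d2 t borel_measurable_continuous_onI[OF c\<psi>]]
    by (simp add: e) (simp add: \<theta>')
  \<comment> \<open>Young's inequality leaves |v|^2 / 2 at \<open>?X x\<close>. The law of
    \<open>?X\<close> is \<open>E \<theta>'\<close>, so this integrates to b^2 / 2, exactly half of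
    the leading term on the left, and is moved there; doubling then gives the factor
    \<open>1 - 4 * k\<close>.\<close>
  also have "\<dots> \<le> (\<integral>x. (norm (?v (?X x)))\<^sup>2 / 2 + (1 / 2 + k) * (norm (?Y x - ?X x))\<^sup>2 \<partial>base \<theta>)"
  proof (rule integral_mono)
    show "integrable (base \<theta>) (\<lambda>x. \<psi> (?Y x) - \<psi> (?X x))"
      using integrable_flow[OF d1 t c\<psi>] integrable_flow[OF d2 t c\<psi>] by simp
    show "integrable (base \<theta>) (\<lambda>x. (norm (?v (?X x)))\<^sup>2 / 2 + (1 / 2 + k) * (norm (?Y x - ?X x))\<^sup>2)"
      using integrable_flow[OF d1 t cN] l2(3) by simp
    fix x
    have "0 \<le> (norm (?v (?X x) - (?Y x - ?X x)))\<^sup>2" by simp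
    also have "\<dots> = (norm (?v (?X x)))\<^sup>2 + (norm (?Y x - ?X x))\<^sup>2 - 2 * (?v (?X x) \<bullet> (?Y x - ?X x))"
      by (simp add: power2_norm_eq_inner inner_diff inner_commute)
    finally have "?v (?X x) \<bullet> (?Y x - ?X x) \<le> (norm (?v (?X x)))\<^sup>2 / 2 + (norm (?Y x - ?X x))\<^sup>2 / 2" by simp
    then show "\<psi> (?Y x) - \<psi> (?X x) \<le> (norm (?v (?X x)))\<^sup>2 / 2 + (1 / 2 + k) * (norm (?Y x - ?X x))\<^sup>2"
      using tay[of "?Y x" "?X x"] by (simp add: distrib_right)
  qed
  also have "\<dots> = b\<^sup>2 / 2 + (1 / 2 + k) * T\<^sup>2"
  proof -
    have "(\<integral>x. (norm (?v (?X x)))\<^sup>2 \<partial>base \<theta>) = b\<^sup>2"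
      using integral_flow[OF d1 t borel_measurable_continuous_onI[OF cN]] integral_base[OF tz(1) borel_measurable_continuous_onI[OF cN]]
      by (simp add: b2 \<theta>')
    then show ?thesis using integrable_flow[OF d1 t cN] l2(3) by (simp add: T2)
  qed
  finally have "b\<^sup>2 * (1 - 4 * k) \<le> (1 + 2 * k) * T\<^sup>2 + 2 * m * b + 4 * k * m\<^sup>2"
    by (simp add: algebra_simps)
  from le_of_perturbed_square_le[OF b0 T0 k0 m0 bk this]
  show ?thesis by (simp add: b_def T_def k_def m_def n_def power_mult_distrib algebra_simps)
qed

text \<open>A competitor has to stay in \<Lambda>, which displacement interpolation would in general
  leave; a geodesic of \<open>S\<close> takes its place. The constant \<open>q\<close> enters only
  to bound the norm of its initial vector.\<close>

lemma W_restricted_upper: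
  assumes d1: "(\<theta>, \<eta>1) \<in> D" and d2: "(\<theta>, \<eta>2) \<in> D" and t: "t \<in> {0..1}"
    and s1: "t * tnorm M \<theta> \<eta>1 \<le> 1" and s2: "t * tnorm M \<theta> \<eta>2 \<le> 1"
    and q: "0 < q" "\<And>\<theta> \<theta>'. \<theta> \<in> S \<Longrightarrow> \<theta>' \<in> S \<Longrightarrow> q * riem_dist M S \<theta> \<theta>' \<le> W2 (E \<theta>) (E \<theta>')"
  defines "N \<equiv> tnorm M \<theta> \<eta>1 + tnorm M \<theta> \<eta>2"
    and "T \<equiv> L2_norm_of (base \<theta>) (\<lambda>x. flow \<theta> \<eta>2 t x - flow \<theta> \<eta>1 t x)"
  assumes small: "2 * C0 / q * (t * N) \<le> 1"
  shows "W_restricted \<Omega> (E ` S) (E (exp_curve M \<theta> \<eta>1 t)) (E (exp_curve M \<theta> \<eta>2 t))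
    \<le> ennreal (T + (10 * C0\<^sup>2 + 3 * Ct) * (2 * C0 / q)\<^sup>2 * (t * N)\<^sup>2)"
proof -
  define \<theta>' \<theta>'' where "\<theta>' = exp_curve M \<theta> \<eta>1 t" and "\<theta>'' = exp_curve M \<theta> \<eta>2 t"
  have S: "\<theta>' \<in> S" "\<theta>'' \<in> S" using exp_curve_tangent(1) d1 d2 t by (auto simp: \<theta>'_def \<theta>''_def)
  have "\<forall>\<theta>0\<in>S. \<forall>\<theta>1\<in>S. \<exists>\<eta>. (\<theta>0, \<eta>) \<in> D \<and> \<theta>1 = riem_exp M \<theta>0 \<eta>"
    using PM unfolding parameter_manifold_def by (elim conjE)
  then obtain \<zeta> where z: "(\<theta>', \<zeta>) \<in> D" "\<theta>'' = riem_exp M \<theta>' \<zeta>" using S by blast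
  have e: "exp_curve M \<theta>' \<zeta> 1 = \<theta>''" using z(2) by (simp add: exp_curve_def)
  define n where "n = tnorm M \<theta>' \<zeta>"
  have n0: "0 \<le> n" using D_tangent(3)[OF z(1)] by (simp add: n_def)
  \<comment> \<open>A geodesic from \<open>D\<close> has length equal to the distance of its end
    points, so the lower bi-Lipschitz bound controls \<open>n\<close>.\<close>
  have "q * n \<le> W2 (E \<theta>') (E \<theta>'')"
    using q(2)[OF S] exp_curve_D(6)[OF z(1)] z(2) by (simp add: n_def)
  also have "\<dots> \<le> 2 * C0 * (t * N)"
    unfolding \<theta>'_def \<theta>''_def N_def by (rule W2_exp_curves_le[OF d1 d2 t s1 s2])
  finally have n: "n \<le> 2 * C0 / q * (t * N)" using q(1) by (simp add: field_simps)
  then have n1: "n \<le> 1" using small by simp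
  have "n\<^sup>2 \<le> (2 * C0 / q * (t * N))\<^sup>2" using n n0 by (rule power_mono)
  then have n2: "n\<^sup>2 \<le> (2 * C0 / q)\<^sup>2 * (t * N)\<^sup>2" by (simp only: power_mult_distrib)
  have "W_restricted \<Omega> (E ` S) (E \<theta>') (E \<theta>'') \<le> ennreal (L2_norm_of (base \<theta>') (B \<theta>' \<zeta>) + Ct * n\<^sup>2)"
    using W_restricted_exp_curve_le[OF z(1)] n1 e by (simp add: n_def)
  \<comment> \<open>Two of the three \<open>Ct\<close> come from comparing the initial velocity with
    \<open>T\<close>, the third from the variation of the velocity along the geodesic.\<close>
  also have "\<dots> \<le> ennreal (T + (10 * C0\<^sup>2 + 3 * Ct) * n\<^sup>2)"
    using connecting_velocity_le[OF d1 d2 t s1 s2 \<theta>'_def z(1) e[unfolded \<theta>''_def]] n1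
    by (intro ennreal_leI) (simp add: n_def T_def algebra_simps)
  also have "\<dots> \<le> ennreal (T + (10 * C0\<^sup>2 + 3 * Ct) * ((2 * C0 / q)\<^sup>2 * (t * N)\<^sup>2))"
    using n2 Ct_nonneg by (intro ennreal_leI add_left_mono mult_left_mono) auto
  finally show ?thesis by (simp only: \<theta>'_def \<theta>''_def mult.assoc)
qed

text \<open>The time restriction is written with products, which avoids dividing by a vanishing
  norm. The two-sided bound stays in \<open>ennreal\<close>, so finiteness of the distance is part
  of the conclusion.\<close>

lemma W_restricted_expansion:
  "\<exists>C>0. \<forall>\<theta> \<eta>1 \<eta>2 t. (\<theta>, \<eta>1) \<in> D \<and> (\<theta>, \<eta>2) \<in> D \<and> 0 \<le> t \<and> t < 1 \<and>
      t * (C * tnorm M \<theta> \<eta>1) < 1 \<and> t * (C * tnorm M \<theta> \<eta>2) < 1 \<longrightarrow>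
    (let W = W_restricted \<Omega> (E ` S) (E (exp_curve M \<theta> \<eta>1 t)) (E (exp_curve M \<theta> \<eta>2 t));
         L = L2_norm_of (E \<theta>) (B \<theta> (\<lambda>i. \<eta>1 i - \<eta>2 i));
         r = t\<^sup>2 * C * (tnorm M \<theta> \<eta>1 + tnorm M \<theta> \<eta>2)\<^sup>2
     in ennreal (t * L - r) \<le> W \<and> W \<le> ennreal (t * L + r))"
proof -
  obtain q where q: "0 < q" "\<And>\<theta> \<theta>'. \<theta> \<in> S \<Longrightarrow> \<theta>' \<in> S \<Longrightarrow> q * riem_dist M S \<theta> \<theta>' \<le> W2 (E \<theta>) (E \<theta>')"
    using MP unfolding measure_parametrization_def by blast
  define c1 c2 c3 where "c1 = 20 * C0\<^sup>2 + 2 * (Ct + 2 * C0\<^sup>2)"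
    and "c2 = (10 * C0\<^sup>2 + 3 * Ct) * (2 * C0 / q)\<^sup>2" and "c3 = 2 * C0 / q"
  have c: "0 \<le> c1" "0 \<le> c2" "0 \<le> c3" using C0 Ct_nonneg q(1) by (simp_all add: c1_def c2_def c3_def)
  \<comment> \<open>The summand 1 gives \<open>t * tnorm M \<theta> \<eta> \<le> 1\<close> for both
    vectors. From \<open>C * (t * N) < 2\<close> the term \<open>20 * C0\<close> gives the smallness
    for the lower bound, and \<open>2 * c3\<close> keeps the connecting geodesic at length at most
    1. The rest covers the errors \<open>Ct + c1\<close> and \<open>Ct + c2\<close>.\<close>
  define C where "C = 1 + 20 * C0 + 2 * c3 + c1 + c2 + Ct"
  have C: "1 \<le> C" "20 * C0 \<le> C" "2 * c3 \<le> C" "Ct + c1 \<le> C" "Ct + c2 \<le> C"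
    using c C0 Ct_nonneg by (auto simp: C_def)
  show ?thesis
  proof (intro exI[of _ C] conjI allI impI)
    show "0 < C" using C by simp
    fix \<theta> \<eta>1 \<eta>2 t
    assume a: "(\<theta>, \<eta>1) \<in> D \<and> (\<theta>, \<eta>2) \<in> D \<and> 0 \<le> t \<and> t < 1 \<and>
      t * (C * tnorm M \<theta> \<eta>1) < 1 \<and> t * (C * tnorm M \<theta> \<eta>2) < 1"
    define n1 n2 N where "n1 = tnorm M \<theta> \<eta>1" and "n2 = tnorm M \<theta> \<eta>2" and "N = tnorm M \<theta> \<eta>1 + tnorm M \<theta> \<eta>2"
    have d: "(\<theta>, \<eta>1) \<in> D" "(\<theta>, \<eta>2) \<in> D" and t: "t \<in> {0..1}" "0 \<le> t" using a by auto
    have n: "0 \<le> n1" "0 \<le> n2" using D_tangent(3) d by (auto simp: n1_def n2_def)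
    have tn: "0 \<le> t * n1" "0 \<le> t * n2" using t n by auto
    have a': "C * (t * n1) < 1" "C * (t * n2) < 1" using a by (auto simp: n1_def n2_def mult_ac)
    have "1 * (t * n1) \<le> C * (t * n1)" "1 * (t * n2) \<le> C * (t * n2)"
      by (rule mult_right_mono[OF C(1) tn(1)], rule mult_right_mono[OF C(1) tn(2)])
    then have s: "t * tnorm M \<theta> \<eta>1 \<le> 1" "t * tnorm M \<theta> \<eta>2 \<le> 1" using a' by (auto simp: n1_def n2_def)
    have tN: "t * N = t * n1 + t * n2" by (simp add: N_def n1_def n2_def distrib_left)
    have "C * (t * N) < 2" using a' by (simp add: tN distrib_left)
    moreover have "20 * C0 * (t * N) \<le> C * (t * N)" "2 * c3 * (t * N) \<le> C * (t * N)"
      using C tn by (auto intro!: mult_right_mono simp: tN)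
    ultimately have small: "C0 * (t * N) \<le> 1 / 10" "2 * C0 / q * (t * N) \<le> 1" by (auto simp: c3_def)
    let ?W = "W_restricted \<Omega> (E ` S) (E (exp_curve M \<theta> \<eta>1 t)) (E (exp_curve M \<theta> \<eta>2 t))"
    let ?L = "L2_norm_of (E \<theta>) (B \<theta> (\<lambda>i. \<eta>1 i - \<eta>2 i))"
    define T where "T = L2_norm_of (base \<theta>) (\<lambda>x. flow \<theta> \<eta>2 t x - flow \<theta> \<eta>1 t x)"
    note tan = D_tangent[OF d(1)] D_tangent[OF d(2)]
    \<comment> \<open>The flows are compared in the order \<open>Y - X\<close>, opposite to the sign
      in the statement; the norm does not see the sign, nor the restriction of the measure to
      \<Omega>.\<close>
    have L: "?L = L2_norm_of (base \<theta>) (B \<theta> (\<lambda>i. \<eta>2 i - \<eta>1 i))"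
    proof -
      have "norm (B \<theta> (\<lambda>i. \<eta>1 i - \<eta>2 i) x) = norm (B \<theta> (\<lambda>i. \<eta>2 i - \<eta>1 i) x)" for x
        using B_diff[OF tan(1) tan(2) tan(5), of x] B_diff[OF tan(1) tan(5) tan(2), of x] by (simp add: norm_minus_commute)
      moreover have "(\<lambda>x. (norm (B \<theta> (\<lambda>i. \<eta>2 i - \<eta>1 i) x))\<^sup>2) \<in> borel_measurable borel"
        by (intro borel_measurable_continuous_onI continuous_intros continuous_on_Ck_on_1 B_diff_bounds(5)[OF d])
      from integral_base[OF tan(1) this] show ?thesis
        unfolding L2_norm_of_def calculation by simp
    qed
    have T: "\<bar>T - t * ?L\<bar> \<le> Ct * (t * N)\<^sup>2"
      using flow_pair_L2(1)[OF d t(1) s] unfolding L T_def N_def .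
    have r: "t\<^sup>2 * C * N\<^sup>2 = C * (t * N)\<^sup>2" by (simp add: power_mult_distrib)
    have le1: "(Ct + c1) * (t * N)\<^sup>2 \<le> C * (t * N)\<^sup>2" and le2: "(Ct + c2) * (t * N)\<^sup>2 \<le> C * (t * N)\<^sup>2"
      using C by (auto intro: mult_right_mono)
    have "ennreal (t * ?L - t\<^sup>2 * C * N\<^sup>2) \<le> ennreal (T - c1 * (t * N)\<^sup>2)"
      using T le1 unfolding r by (intro ennreal_leI) (simp add: distrib_right)
    also have "\<dots> \<le> ?W"
      unfolding c1_def T_def N_def by (rule W_restricted_lower[OF d t(1) s small(1)[unfolded N_def]])
    finally have lower: "ennreal (t * ?L - t\<^sup>2 * C * N\<^sup>2) \<le> ?W" .
    have "?W \<le> ennreal (T + c2 * (t * N)\<^sup>2)"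
      unfolding c2_def T_def N_def by (rule W_restricted_upper[OF d t(1) s q small(2)[unfolded N_def]])
    also have "\<dots> \<le> ennreal (t * ?L + t\<^sup>2 * C * N\<^sup>2)"
      using T le2 unfolding r by (intro ennreal_leI) (simp add: distrib_right)
    finally show "let W = ?W; L = ?L; r = t\<^sup>2 * C * (tnorm M \<theta> \<eta>1 + tnorm M \<theta> \<eta>2)\<^sup>2
        in ennreal (t * L - r) \<le> W \<and> W \<le> ennreal (t * L + r)"
      using lower by (simp add: Let_def N_def)
  qed
qed

end

theorem theorem2p14:
  fixes \<Omega> :: "'x::euclidean_space set"
    and M :: "('i, 'm::{t2_space, second_countable_topology}, 'e::euclidean_space) riem_data"
    and S :: "'m set"
    and D :: "('m \<times> ('i, 'e) tangent) set"
    and E :: "'m \<Rightarrow> 'x measure"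
    and B :: "'m \<Rightarrow> ('i, 'e) tangent \<Rightarrow> 'x \<Rightarrow> 'x"
  assumes "compact \<Omega>" and "convex \<Omega>"
    and "parameter_manifold M S D"
    and "measure_parametrization M S \<Omega> E"
    and "tangent_model M S D E B"
    and "flow_compatible M S \<Omega> E B"
  shows "\<exists>C::real. 0 < C \<and>
    (\<forall>\<theta> \<eta>1 \<eta>2. \<theta> \<in> S \<and> (\<theta>, \<eta>1) \<in> D \<and> (\<theta>, \<eta>2) \<in> D \<longrightarrow>
       (let \<gamma>1 = exp_curve M \<theta> \<eta>1;
            \<gamma>2 = exp_curve M \<theta> \<eta>2;
            WL = (\<lambda>t. W_restricted \<Omega> (E ` S) (E (\<gamma>1 t)) (E (\<gamma>2 t)));
            L = L2_norm_of (E \<theta>) (B \<theta> (\<lambda>i. \<eta>1 i - \<eta>2 i))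
        in (\<forall>t::real. 0 \<le> t \<and>
               ereal t < min 1 (min (1 / ereal (C * tnorm M \<theta> \<eta>1)) (1 / ereal (C * tnorm M \<theta> \<eta>2)))
             \<longrightarrow> \<bar>enn2ereal (WL t) - ereal (t * L)\<bar>
                 \<le> ereal (t\<^sup>2 * C * (tnorm M \<theta> \<eta>1 + tnorm M \<theta> \<eta>2)\<^sup>2)) \<and>
           ((\<lambda>t. enn2real (WL t)) has_real_derivative L) (at 0 within {0..1})))"
proof -
  obtain C0 where C0: "0 < C0" and bd: "\<forall>(\<theta>, \<eta>)\<in>D.
        inverse C0 * tnorm M \<theta> \<eta> \<le> L2_norm_of (E \<theta>) (B \<theta> \<eta>) \<and>
        L2_norm_of (E \<theta>) (B \<theta> \<eta>) \<le> C0 * tnorm M \<theta> \<eta> \<and>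
        C1_norm (B \<theta> \<eta>) \<le> ennreal (C0 * tnorm M \<theta> \<eta>) \<and>
        (let \<gamma> = exp_curve M \<theta> \<eta> in
           \<forall>x. \<forall>t\<in>{0..1}. \<exists>u.
             ((\<lambda>s. B (\<gamma> s) (velocity M \<gamma> s) x) has_vector_derivative u) (at t within {0..1}) \<and>
             norm u \<le> C0 * (tnorm M \<theta> \<eta>)\<^sup>2)"
    using assms(5) unfolding tangent_model_def by (elim conjE exE)
  interpret geodesic_restriction \<Omega> M S D E B C0
  proof (unfold_locales, fact+)
    show "C1_norm (B \<theta> \<eta>) \<le> ennreal (C0 * tnorm M \<theta> \<eta>)" if "(\<theta>, \<eta>) \<in> D" for \<theta> \<eta>
      using bspec[OF bd that] by simp
    show "\<exists>u. ((\<lambda>s. B (exp_curve M \<theta> \<eta> s) (velocity M (exp_curve M \<theta> \<eta>) s) x) has_vector_derivative u)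
         (at t within {0..1}) \<and> norm u \<le> C0 * (tnorm M \<theta> \<eta>)\<^sup>2"
      if "(\<theta>, \<eta>) \<in> D" "t \<in> {0..1}" for \<theta> \<eta> x t
      using bspec[OF bd that(1)] that(2) by (simp add: Let_def)
  qed
  obtain C where C: "0 < C" and ex: "\<And>\<theta> \<eta>1 \<eta>2 t. (\<theta>, \<eta>1) \<in> D \<Longrightarrow> (\<theta>, \<eta>2) \<in> D \<Longrightarrow> 0 \<le> t \<Longrightarrow> t < 1 \<Longrightarrow>
      t * (C * tnorm M \<theta> \<eta>1) < 1 \<Longrightarrow> t * (C * tnorm M \<theta> \<eta>2) < 1 \<Longrightarrow>
    (let W = W_restricted \<Omega> (E ` S) (E (exp_curve M \<theta> \<eta>1 t)) (E (exp_curve M \<theta> \<eta>2 t));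
         L = L2_norm_of (E \<theta>) (B \<theta> (\<lambda>i. \<eta>1 i - \<eta>2 i));
         r = t\<^sup>2 * C * (tnorm M \<theta> \<eta>1 + tnorm M \<theta> \<eta>2)\<^sup>2
     in ennreal (t * L - r) \<le> W \<and> W \<le> ennreal (t * L + r))"
    using W_restricted_expansion by blast
  show ?thesis
  proof (intro exI[of _ C] conjI C allI impI)
    fix \<theta> \<eta>1 \<eta>2
    assume "\<theta> \<in> S \<and> (\<theta>, \<eta>1) \<in> D \<and> (\<theta>, \<eta>2) \<in> D"
    then have d: "(\<theta>, \<eta>1) \<in> D" "(\<theta>, \<eta>2) \<in> D" by auto
    define n1 n2 where "n1 = tnorm M \<theta> \<eta>1" and "n2 = tnorm M \<theta> \<eta>2"
    define W where "W t = W_restricted \<Omega> (E ` S) (E (exp_curve M \<theta> \<eta>1 t)) (E (exp_curve M \<theta> \<eta>2 t))" for t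
    define L where "L = L2_norm_of (E \<theta>) (B \<theta> (\<lambda>i. \<eta>1 i - \<eta>2 i))"
    have n: "0 \<le> C * n1" "0 \<le> C * n2" using D_tangent(3) d C by (auto simp: n1_def n2_def)
    have bound: "\<bar>enn2ereal (W t) - ereal (t * L)\<bar> \<le> ereal (t\<^sup>2 * C * (n1 + n2)\<^sup>2)"
      "\<bar>enn2real (W t) - t * L\<bar> \<le> t\<^sup>2 * C * (n1 + n2)\<^sup>2"
      if "0 \<le> t" "t < 1" "t * (C * n1) < 1" "t * (C * n2) < 1" for t
    proof -
      have "0 \<le> L" by (simp add: L_def L2_norm_of_def)
      then have "0 \<le> t * L + t\<^sup>2 * C * (n1 + n2)\<^sup>2" using that(1) C by simp
      moreover have "ennreal (t * L - t\<^sup>2 * C * (n1 + n2)\<^sup>2) \<le> W t" "W t \<le> ennreal (t * L + t\<^sup>2 * C * (n1 + n2)\<^sup>2)"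
        using ex[OF d that(1,2)] that(3,4) unfolding Let_def W_def L_def n1_def n2_def by blast+
      ultimately show "\<bar>enn2ereal (W t) - ereal (t * L)\<bar> \<le> ereal (t\<^sup>2 * C * (n1 + n2)\<^sup>2)"
        "\<bar>enn2real (W t) - t * L\<bar> \<le> t\<^sup>2 * C * (n1 + n2)\<^sup>2"
        using abs_enn2ereal_diff_le by blast+
    qed
    have der: "((\<lambda>t. enn2real (W t)) has_real_derivative L) (at 0 within {0..1})"
    proof (rule has_real_derivative_of_quadratic_bound)
      \<comment> \<open>With this choice \<open>t < \<delta>\<close> implies all three time
        restrictions at once, also when a norm vanishes.\<close>
      define \<delta> where "\<delta> = 1 / (1 + C * n1 + C * n2)"
      have pos: "0 < 1 + C * n1 + C * n2" using n by simp
      then show "0 < \<delta>" by (simp add: \<delta>_def)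
      \<comment> \<open>At \<open>t = 0\<close> both the linear term and the error vanish, so the
        bound itself yields the value.\<close>
      show "enn2real (W 0) = 0" using bound(2)[of 0] by (simp add: order_antisym)
      fix t :: real assume t: "0 \<le> t" "t < \<delta>"
      have "t * (1 + C * n1 + C * n2) < 1" using t(2) pos by (simp add: \<delta>_def field_simps)
      moreover have "0 \<le> t * (C * n1)" "0 \<le> t * (C * n2)" using t n by auto
      ultimately have "t < 1" "t * (C * n1) < 1" "t * (C * n2) < 1" using t(1) by (auto simp: distrib_left)
      from bound(2)[OF t(1) this] show "\<bar>enn2real (W t) - t * L\<bar> \<le> t\<^sup>2 * (C * (n1 + n2)\<^sup>2)" by (simp add: mult.assoc)
    qed
    show "let \<gamma>1 = exp_curve M \<theta> \<eta>1;
            \<gamma>2 = exp_curve M \<theta> \<eta>2;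
            WL = (\<lambda>t. W_restricted \<Omega> (E ` S) (E (\<gamma>1 t)) (E (\<gamma>2 t)));
            L = L2_norm_of (E \<theta>) (B \<theta> (\<lambda>i. \<eta>1 i - \<eta>2 i))
        in (\<forall>t::real. 0 \<le> t \<and>
               ereal t < min 1 (min (1 / ereal (C * tnorm M \<theta> \<eta>1)) (1 / ereal (C * tnorm M \<theta> \<eta>2)))
             \<longrightarrow> \<bar>enn2ereal (WL t) - ereal (t * L)\<bar>
                 \<le> ereal (t\<^sup>2 * C * (tnorm M \<theta> \<eta>1 + tnorm M \<theta> \<eta>2)\<^sup>2)) \<and>
           ((\<lambda>t. enn2real (WL t)) has_real_derivative L) (at 0 within {0..1})"
      unfolding Let_def W_def[symmetric] L_def[symmetric] n1_def[symmetric] n2_def[symmetric]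
    proof (intro conjI allI impI der)
      fix t assume t: "0 \<le> t \<and> ereal t < min 1 (min (1 / ereal (C * n1)) (1 / ereal (C * n2)))"
      then have "t < 1" by (simp add: one_ereal_def)
      moreover have "t * (C * n1) < 1" "t * (C * n2) < 1"
        using t ereal_less_inverse_iff n by auto
      ultimately show "\<bar>enn2ereal (W t) - ereal (t * L)\<bar> \<le> ereal (t\<^sup>2 * C * (n1 + n2)\<^sup>2)"
        using bound(1) t by blast
    qed
  qed
qed

end
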